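(* Let $T$ be a complete stable first-order theory and let $G$ be a type-definable group in the monster model of $T$ with $\mathrm{U}_\omega(G)<\infty$. Then there is no infinite sequence of relatively definable subgroups of $G$, each having infinite index in its predecessor.
   Context: We work in the monster model of $T$ (imaginaries allowed); sets and tuples are small. A subgroup of $G$ is relatively definable if it is the intersection of $G$ with a definable set (with parameters). For a natural number $k\ge 1$, a partial type $\pi(\bar x)$ skew $k$-divides over $A$ if there are an $A$-indiscernible sequence $(\bar b_n)_{n<\omega}$ and a formula $\varphi(\bar x;\bar y_0,\ldots,\bar y_{k-1})$ such that $\pi(\bar x)\vdash\varphi(\bar x;\bar b_0,\bar b_2,\ldots,\bar b_{2(k-1)})$ and $\pi(\bar x)\vdash\neg\varphi(\bar x;\bar b_{i_0},\ldots,\bar b_{i_{k-1}})$ for any $i_0<\ldots<i_{k-1}<2k$ with $(i_0,\ldots,i_{k-1})\neq(0,2,\ldots,2(k-1))$. A partial type $k$-forks over $A$ if it implies a finite disjunction of formulas (with parameters), each of them skew $k$-dividing over $A$. It $\omega$-forks over $A$ if it $k$-forks over $A$ for every natural number $k\ge1$. For complete types $p\in S(A)$ and $q\in S(B)$ with $A\subseteq B$ and $q\supseteq p$, $q$ is an $\omega$-forking extension of $p$ if $q$ $\omega$-forks over $A$. The $\mathrm{U}_\omega$-rank is the least function from the collection of all (complete) types with parameters from the monster model to the ordinals together with $\infty$ such that for every ordinal $\alpha$: $\mathrm{U}_\omega(p)\ge\alpha+1$ if there is an $\omega$-forking extension $q$ of $p$ with $\mathrm{U}_\omega(q)\ge\alpha$.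 For a type-definable group $G$, $\mathrm{U}_\omega(G)$ is the $\mathrm{U}_\omega$-rank of some (equivalently, any) generic type of $G$. *)

theory Defs
  imports Main "HOL-Algebra.Coset"
begin

unbundle cardinal_syntax

section \<open>Many-sorted first-order logic\<close>

text \<open>Logic is many-sorted because $M^{eq}$ is; a one-sorted language is the case of a
  single sort. The symbol sets are explicit, so that e.g. purely relational languages are covered
  although HOL types are nonempty.\<close>

record ('s, 'f, 'r) language =
  sorts :: "'s set"
  funs :: "'f set"
  rels :: "'r set"
  fargs :: "'f \<Rightarrow> 's list"
  fres :: "'f \<Rightarrow> 's"
  rargs :: "'r \<Rightarrow> 's list"

type_synonym 's var = "'s \<times> nat"

datatype ('s, 'f) trm = Var "'s var" | App 'f "('s, 'f) trm list"

datatype ('s, 'f, 'r) fm =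
    Eq "('s, 'f) trm" "('s, 'f) trm"
  | Rel 'r "('s, 'f) trm list"
  | Neg "('s, 'f, 'r) fm"
  | And "('s, 'f, 'r) fm" "('s, 'f, 'r) fm"
  | Ex "'s var" "('s, 'f, 'r) fm"

definition wf_language :: "('s, 'f, 'r) language \<Rightarrow> bool" where
  "wf_language L \<longleftrightarrow> sorts L \<noteq> {}
     \<and> (\<forall>f\<in>funs L. set (fargs L f) \<subseteq> sorts L \<and> fres L f \<in> sorts L)
     \<and> (\<forall>r\<in>rels L. set (rargs L r) \<subseteq> sorts L)"

primrec sort_of :: "('s, 'f, 'r) language \<Rightarrow> ('s, 'f) trm \<Rightarrow> 's" where
  "sort_of L (Var v) = fst v"
| "sort_of L (App f ts) = fres L f"

fun wf_trm :: "('s, 'f, 'r) language \<Rightarrow> ('s, 'f) trm \<Rightarrow> bool" where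
  "wf_trm L (Var v) \<longleftrightarrow> fst v \<in> sorts L"
| "wf_trm L (App f ts) \<longleftrightarrow> f \<in> funs L \<and> map (sort_of L) ts = fargs L f \<and> list_all (wf_trm L) ts"

primrec wf_fm :: "('s, 'f, 'r) language \<Rightarrow> ('s, 'f, 'r) fm \<Rightarrow> bool" where
  "wf_fm L (Eq t u) \<longleftrightarrow> wf_trm L t \<and> wf_trm L u \<and> sort_of L t = sort_of L u"
| "wf_fm L (Rel r ts) \<longleftrightarrow> r \<in> rels L \<and> map (sort_of L) ts = rargs L r \<and> list_all (wf_trm L) ts"
| "wf_fm L (Neg \<phi>) \<longleftrightarrow> wf_fm L \<phi>"
| "wf_fm L (And \<phi> \<psi>) \<longleftrightarrow> wf_fm L \<phi> \<and> wf_fm L \<psi>"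
| "wf_fm L (Ex v \<phi>) \<longleftrightarrow> fst v \<in> sorts L \<and> wf_fm L \<phi>"

primrec fv_trm :: "('s, 'f) trm \<Rightarrow> 's var set" where
  "fv_trm (Var v) = {v}"
| "fv_trm (App f ts) = \<Union> (set (map fv_trm ts))"

primrec fv :: "('s, 'f, 'r) fm \<Rightarrow> 's var set" where
  "fv (Eq t u) = fv_trm t \<union> fv_trm u"
| "fv (Rel r ts) = \<Union> (fv_trm ` set ts)"
| "fv (Neg \<phi>) = fv \<phi>"
| "fv (And \<phi> \<psi>) = fv \<phi> \<union> fv \<psi>"
| "fv (Ex v \<phi>) = fv \<phi> - {v}"

record ('s, 'f, 'r, 'a) struc =
  lang :: "('s, 'f, 'r) language"
  univ :: "'s \<Rightarrow> 'a set"
  fint :: "'f \<Rightarrow> 'a list \<Rightarrow> 'a"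
  rint :: "'r \<Rightarrow> 'a list \<Rightarrow> bool"

definition ltuples :: "('s, 'f, 'r, 'a) struc \<Rightarrow> 's list \<Rightarrow> 'a list set" where
  "ltuples M ss = {as. list_all2 (\<lambda>a s. a \<in> univ M s) as ss}"

definition elems :: "('s, 'f, 'r, 'a) struc \<Rightarrow> 'a set" where
  "elems M = (\<Union>s\<in>sorts (lang M). univ M s)"

text \<open>Distinct sorts have disjoint universes, so an element determines its sort.\<close>

definition wf_struc :: "('s, 'f, 'r, 'a) struc \<Rightarrow> bool" where
  "wf_struc M \<longleftrightarrow> wf_language (lang M)
     \<and> (\<forall>s\<in>sorts (lang M). univ M s \<noteq> {})
     \<and> (\<forall>s\<in>sorts (lang M). \<forall>t\<in>sorts (lang M). s \<noteq> t \<longrightarrow> univ M s \<inter> univ M t = {})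
     \<and> (\<forall>f\<in>funs (lang M). \<forall>as\<in>ltuples M (fargs (lang M) f). fint M f as \<in> univ M (fres (lang M) f))"

primrec eval_trm :: "('s, 'f, 'r, 'a) struc \<Rightarrow> ('s var \<Rightarrow> 'a) \<Rightarrow> ('s, 'f) trm \<Rightarrow> 'a" where
  "eval_trm M e (Var v) = e v"
| "eval_trm M e (App f ts) = fint M f (map (eval_trm M e) ts)"

primrec sat :: "('s, 'f, 'r, 'a) struc \<Rightarrow> ('s var \<Rightarrow> 'a) \<Rightarrow> ('s, 'f, 'r) fm \<Rightarrow> bool" where
  "sat M e (Eq t u) \<longleftrightarrow> eval_trm M e t = eval_trm M e u"
| "sat M e (Rel r ts) \<longleftrightarrow> rint M r (map (eval_trm M e) ts)"
| "sat M e (Neg \<phi>) \<longleftrightarrow> \<not> sat M e \<phi>"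
| "sat M e (And \<phi> \<psi>) \<longleftrightarrow> sat M e \<phi> \<and> sat M e \<psi>"
| "sat M e (Ex v \<phi>) \<longleftrightarrow> (\<exists>a\<in>univ M (fst v). sat M (e(v := a)) \<phi>)"

definition assignment :: "('s, 'f, 'r, 'a) struc \<Rightarrow> ('s var \<Rightarrow> 'a) \<Rightarrow> bool" where
  "assignment M e \<longleftrightarrow> (\<forall>v. fst v \<in> sorts (lang M) \<longrightarrow> e v \<in> univ M (fst v))"

section \<open>Tuples of variables and formulas with parameters\<close>

text \<open>A tuple $\bar x = (x_i)_{i \in I}$ of sorted variables is the partial map sending
  $i \in I$ to the sort of $x_i$; it may be infinite.\<close>

type_synonym ('i, 's) tvar = "'i \<Rightarrow> 's option"

definition wf_tvar :: "('s, 'f, 'r, 'a) struc \<Rightarrow> ('i, 's) tvar \<Rightarrow> bool" where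
  "wf_tvar M X \<longleftrightarrow> ran X \<subseteq> sorts (lang M)"

definition tuples :: "('s, 'f, 'r, 'a) struc \<Rightarrow> ('i, 's) tvar \<Rightarrow> ('i \<Rightarrow> 'a) set" where
  "tuples M X = {c. \<forall>i. case X i of None \<Rightarrow> c i = undefined | Some s \<Rightarrow> c i \<in> univ M s}"

text \<open>A formula with parameters in $\bar x$ is an $L$-formula with a substitution of
  its free variables by coordinates \<open>Inl i\<close> of $\bar x$ or by parameters \<open>Inr a\<close>.\<close>

type_synonym ('s, 'f, 'r, 'a, 'i) pfm = "('s, 'f, 'r) fm \<times> ('s var \<Rightarrow> 'i + 'a)"

definition pfms ::
  "('s, 'f, 'r, 'a) struc \<Rightarrow> ('i, 's) tvar \<Rightarrow> 'a set \<Rightarrow> ('s, 'f, 'r, 'a, 'i) pfm set" where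
  "pfms M X A = {(\<phi>, \<sigma>). wf_fm (lang M) \<phi> \<and>
     (\<forall>v\<in>fv \<phi>. case \<sigma> v of Inl i \<Rightarrow> X i = Some (fst v) | Inr a \<Rightarrow> a \<in> A \<inter> univ M (fst v))}"

definition holds ::
  "('s, 'f, 'r, 'a) struc \<Rightarrow> ('s, 'f, 'r, 'a, 'i) pfm \<Rightarrow> ('i \<Rightarrow> 'a) \<Rightarrow> bool" where
  "holds M \<psi> c \<longleftrightarrow> sat M (\<lambda>v. case snd \<psi> v of Inl i \<Rightarrow> c i | Inr a \<Rightarrow> a) (fst \<psi>)"

definition pneg :: "('s, 'f, 'r, 'a, 'i) pfm \<Rightarrow> ('s, 'f, 'r, 'a, 'i) pfm" where
  "pneg \<psi> = (Neg (fst \<psi>), snd \<psi>)"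

definition solutions ::
  "('s, 'f, 'r, 'a) struc \<Rightarrow> ('i, 's) tvar \<Rightarrow> ('s, 'f, 'r, 'a, 'i) pfm set \<Rightarrow> ('i \<Rightarrow> 'a) set" where
  "solutions M X \<pi> = {c \<in> tuples M X. \<forall>\<psi>\<in>\<pi>. holds M \<psi> c}"

text \<open>In the monster model, $\pi \vdash \psi$ for a small partial type $\pi$ means that every
  realization of $\pi$ satisfies $\psi$.\<close>

definition entails ::
  "('s, 'f, 'r, 'a) struc \<Rightarrow> ('i, 's) tvar \<Rightarrow> ('s, 'f, 'r, 'a, 'i) pfm set
    \<Rightarrow> ('s, 'f, 'r, 'a, 'i) pfm \<Rightarrow> bool" where
  "entails M X \<pi> \<psi> \<longleftrightarrow> (\<forall>c\<in>solutions M X \<pi>. holds M \<psi> c)"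

definition finitely_satisfiable ::
  "('s, 'f, 'r, 'a) struc \<Rightarrow> ('i, 's) tvar \<Rightarrow> ('s, 'f, 'r, 'a, 'i) pfm set \<Rightarrow> bool" where
  "finitely_satisfiable M X \<pi> \<longleftrightarrow> (\<forall>\<pi>0\<subseteq>\<pi>. finite \<pi>0 \<longrightarrow> solutions M X \<pi>0 \<noteq> {})"

section \<open>Monster models and stability\<close>

text \<open>A complete theory is taken to be deductively closed, i.e. a maximal consistent
  set of sentences; consistency is part of having a monster model.\<close>

definition complete_theory :: "('s, 'f, 'r) language \<Rightarrow> ('s, 'f, 'r) fm set \<Rightarrow> bool" where
  "complete_theory L T \<longleftrightarrow> T \<subseteq> {\<phi>. wf_fm L \<phi> \<and> fv \<phi> = {}}
     \<and> (\<forall>\<phi>. wf_fm L \<phi> \<and> fv \<phi> = {} \<longrightarrow> \<phi> \<in> T \<or> Neg \<phi> \<in> T)"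

definition models :: "('s, 'f, 'r, 'a) struc \<Rightarrow> ('s, 'f, 'r) fm set \<Rightarrow> bool" where
  "models M T \<longleftrightarrow> wf_struc M \<and> (\<forall>\<phi>\<in>T. \<forall>e. assignment M e \<longrightarrow> sat M e \<phi>)"

definition small :: "'k rel \<Rightarrow> 'b set \<Rightarrow> bool" where
  "small \<kappa> A \<longleftrightarrow> |A| <o \<kappa>"

definition saturated :: "'k rel \<Rightarrow> ('s, 'f, 'r, 'a) struc \<Rightarrow> bool" where
  "saturated \<kappa> M \<longleftrightarrow> (\<forall>A s \<pi>. A \<subseteq> elems M \<longrightarrow> small \<kappa> A \<longrightarrow> s \<in> sorts (lang M) \<longrightarrow>
     \<pi> \<subseteq> pfms M (\<lambda>_::unit. Some s) A \<longrightarrow> finitely_satisfiable M (\<lambda>_. Some s) \<pi> \<longrightarrow>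
     solutions M (\<lambda>_. Some s) \<pi> \<noteq> {})"

definition automorphism :: "('s, 'f, 'r, 'a) struc \<Rightarrow> ('a \<Rightarrow> 'a) \<Rightarrow> bool" where
  "automorphism M g \<longleftrightarrow> (\<forall>s\<in>sorts (lang M). bij_betw g (univ M s) (univ M s))
     \<and> (\<forall>f\<in>funs (lang M). \<forall>as\<in>ltuples M (fargs (lang M) f). g (fint M f as) = fint M f (map g as))
     \<and> (\<forall>r\<in>rels (lang M). \<forall>as\<in>ltuples M (rargs (lang M) r). rint M r (map g as) \<longleftrightarrow> rint M r as)"

definition partial_elementary :: "('s, 'f, 'r, 'a) struc \<Rightarrow> 'a set \<Rightarrow> ('a \<Rightarrow> 'a) \<Rightarrow> bool" where
  "partial_elementary M A h \<longleftrightarrow> (\<forall>s\<in>sorts (lang M). h ` (A \<inter> univ M s) \<subseteq> univ M s)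
     \<and> (\<forall>\<phi> e. wf_fm (lang M) \<phi> \<longrightarrow> (\<forall>v\<in>fv \<phi>. e v \<in> A \<inter> univ M (fst v)) \<longrightarrow>
          (sat M (h \<circ> e) \<phi> \<longleftrightarrow> sat M e \<phi>))"

definition strongly_homogeneous :: "'k rel \<Rightarrow> ('s, 'f, 'r, 'a) struc \<Rightarrow> bool" where
  "strongly_homogeneous \<kappa> M \<longleftrightarrow> (\<forall>A h. A \<subseteq> elems M \<longrightarrow> small \<kappa> A \<longrightarrow> partial_elementary M A h \<longrightarrow>
     (\<exists>g. automorphism M g \<and> (\<forall>a\<in>A. g a = h a)))"

text \<open>The cardinal $\kappa$ is only required to exceed $|L| + \aleph_0$, the number of formulas.\<close>

definition monster_model ::
  "'k rel \<Rightarrow> ('s, 'f, 'r) fm set \<Rightarrow> ('s, 'f, 'r, 'a) struc \<Rightarrow> bool" where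
  "monster_model \<kappa> T M \<longleftrightarrow> Card_order \<kappa> \<and> |{\<phi>. wf_fm (lang M) \<phi>}| <o \<kappa>
     \<and> models M T \<and> saturated \<kappa> M \<and> strongly_homogeneous \<kappa> M"

text \<open>Stability of the theory of $M$, read off in the monster model $M$: no formula
  $\varphi(\bar x; \bar y)$, with $\bar x$ the free variables in \<open>V\<close> and $\bar y$ the remaining
  ones, has the order property.\<close>

definition stable_monster :: "('s, 'f, 'r, 'a) struc \<Rightarrow> bool" where
  "stable_monster M \<longleftrightarrow> \<not> (\<exists>\<phi> V a b. wf_fm (lang M) \<phi> \<and> (\<forall>i::nat. assignment M (a i) \<and> assignment M (b i))
     \<and> (\<forall>i j. sat M (\<lambda>v. if v \<in> V then a i v else b j v) \<phi> \<longleftrightarrow> i < j))"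

section \<open>Imaginaries\<close>

text \<open>The structure $M^{eq}$ has, besides the sorts of $M$, for every $L$-formula
  $\varphi(\bar x, \bar y)$ without parameters defining an equivalence relation on tuples of
  sorts \<open>ss\<close> a sort \<open>Quot ss \<phi>\<close> for the classes, and a function symbol \<open>Proj ss \<phi>\<close> for the
  projection. In $\varphi$ the $i$-th entry of the concatenated tuple $\bar x \bar y$ is the
  variable with index $i$ of the appropriate sort.\<close>

datatype ('s, 'f, 'r) eqsort = Home 's | Quot "'s list" "('s, 'f, 'r) fm"

datatype ('s, 'f, 'r) eqfun = Old 'f | Proj "'s list" "('s, 'f, 'r) fm"

datatype ('s, 'f, 'r, 'a) eqelem =
    Real (un_real: 'a)
  | Imag "'s list" "('s, 'f, 'r) fm" "'a list set"

definition eqrel ::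
  "('s, 'f, 'r, 'a) struc \<Rightarrow> 's list \<Rightarrow> ('s, 'f, 'r) fm \<Rightarrow> ('a list \<times> 'a list) set" where
  "eqrel M ss \<phi> = {(as, bs). as \<in> ltuples M ss \<and> bs \<in> ltuples M ss \<and>
     sat M (\<lambda>v. (as @ bs) ! snd v) \<phi>}"

definition defines_eqrel :: "('s, 'f, 'r, 'a) struc \<Rightarrow> 's list \<Rightarrow> ('s, 'f, 'r) fm \<Rightarrow> bool" where
  "defines_eqrel M ss \<phi> \<longleftrightarrow> ss \<noteq> [] \<and> set ss \<subseteq> sorts (lang M) \<and> wf_fm (lang M) \<phi>
     \<and> fv \<phi> \<subseteq> {((ss @ ss) ! i, i) | i. i < 2 * length ss}
     \<and> equiv (ltuples M ss) (eqrel M ss \<phi>)"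

definition eq_lang ::
  "('s, 'f, 'r, 'a) struc \<Rightarrow> (('s, 'f, 'r) eqsort, ('s, 'f, 'r) eqfun, 'r) language" where
  "eq_lang M =
     \<lparr> sorts = Home ` sorts (lang M) \<union> {Quot ss \<phi> | ss \<phi>. defines_eqrel M ss \<phi>},
       funs = Old ` funs (lang M) \<union> {Proj ss \<phi> | ss \<phi>. defines_eqrel M ss \<phi>},
       rels = rels (lang M),
       fargs = (\<lambda>f. case f of Old g \<Rightarrow> map Home (fargs (lang M) g) | Proj ss \<phi> \<Rightarrow> map Home ss),
       fres = (\<lambda>f. case f of Old g \<Rightarrow> Home (fres (lang M) g) | Proj ss \<phi> \<Rightarrow> Quot ss \<phi>),
       rargs = (\<lambda>r. map Home (rargs (lang M) r)) \<rparr>"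

definition eq_struc ::
  "('s, 'f, 'r, 'a) struc
    \<Rightarrow> (('s, 'f, 'r) eqsort, ('s, 'f, 'r) eqfun, 'r, ('s, 'f, 'r, 'a) eqelem) struc" where
  "eq_struc M =
     \<lparr> lang = eq_lang M,
       univ = (\<lambda>s. case s of Home s \<Rightarrow> Real ` univ M s
                | Quot ss \<phi> \<Rightarrow> Imag ss \<phi> ` (ltuples M ss // eqrel M ss \<phi>)),
       fint = (\<lambda>f xs. case f of Old g \<Rightarrow> Real (fint M g (map un_real xs))
                | Proj ss \<phi> \<Rightarrow> Imag ss \<phi> (eqrel M ss \<phi> `` {map un_real xs})),
       rint = (\<lambda>r xs. rint M r (map un_real xs)) \<rparr>"

section \<open>Skew dividing and \<open>\<omega>\<close>-forking\<close>

definition indiscernible ::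
  "('s, 'f, 'r, 'a) struc \<Rightarrow> ('j, 's) tvar \<Rightarrow> 'a set \<Rightarrow> (nat \<Rightarrow> 'j \<Rightarrow> 'a) \<Rightarrow> bool" where
  "indiscernible M Y A b \<longleftrightarrow> (\<forall>n. b n \<in> tuples M Y) \<and>
     (\<forall>m is js. sorted_wrt (<) is \<longrightarrow> sorted_wrt (<) js \<longrightarrow> length is = m \<longrightarrow> length js = m \<longrightarrow>
        (\<forall>\<psi>\<in>pfms M (\<lambda>(l, j). if l < m then Y j else None) A.
           holds M \<psi> (\<lambda>(l, j). b (is ! l) j) \<longleftrightarrow> holds M \<psi> (\<lambda>(l, j). b (js ! l) j)))"

text \<open>For an $L$-formula $\varphi(\bar x; \bar y_0, \ldots, \bar y_{k-1})$ whose free variables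
  are assigned by \<open>\<tau>\<close> to coordinates of $\bar x$ (\<open>Inl i\<close>) or of some $\bar y_l$
  (\<open>Inr (l, j)\<close>), this is $\varphi(\bar x; \bar b_{i_0}, \ldots, \bar b_{i_{k-1}})$.\<close>

definition plug ::
  "('s, 'f, 'r) fm \<Rightarrow> ('s var \<Rightarrow> 'i + nat \<times> 'j) \<Rightarrow> (nat \<Rightarrow> 'j \<Rightarrow> 'a) \<Rightarrow> nat list
    \<Rightarrow> ('s, 'f, 'r, 'a, 'i) pfm" where
  "plug \<phi> \<tau> b is = (\<phi>, \<lambda>v. case \<tau> v of Inl i \<Rightarrow> Inl i | Inr (l, j) \<Rightarrow> Inr (b (is ! l) j))"

text \<open>The tuples $\bar b_n$ are indexed by (a subset of) \<open>nat\<close>: only the finitely many coordinates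
  occurring in $\varphi$ matter.\<close>

definition skew_divides ::
  "('s, 'f, 'r, 'a) struc \<Rightarrow> ('i, 's) tvar \<Rightarrow> nat \<Rightarrow> 'a set \<Rightarrow> ('s, 'f, 'r, 'a, 'i) pfm set \<Rightarrow> bool"
where
  "skew_divides M X k A \<pi> \<longleftrightarrow> (\<exists>(Y :: (nat, 's) tvar) b \<phi> \<tau>.
     wf_tvar M Y \<and> indiscernible M Y A b \<and> wf_fm (lang M) \<phi> \<and>
     (\<forall>v\<in>fv \<phi>. case \<tau> v of Inl i \<Rightarrow> X i = Some (fst v)
                         | Inr (l, j) \<Rightarrow> l < k \<and> Y j = Some (fst v)) \<and>
     entails M X \<pi> (plug \<phi> \<tau> b (map (\<lambda>l. 2 * l) [0..<k])) \<and>
     (\<forall>is. sorted_wrt (<) is \<and> length is = k \<and> set is \<subseteq> {..<2 * k}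
           \<and> is \<noteq> map (\<lambda>l. 2 * l) [0..<k]
        \<longrightarrow> entails M X \<pi> (pneg (plug \<phi> \<tau> b is))))"

definition k_forks ::
  "('s, 'f, 'r, 'a) struc \<Rightarrow> ('i, 's) tvar \<Rightarrow> nat \<Rightarrow> 'a set \<Rightarrow> ('s, 'f, 'r, 'a, 'i) pfm set \<Rightarrow> bool"
where
  "k_forks M X k A \<pi> \<longleftrightarrow> (\<exists>\<Psi>. finite \<Psi> \<and> \<Psi> \<subseteq> pfms M X (elems M) \<and>
     (\<forall>\<psi>\<in>\<Psi>. skew_divides M X k A {\<psi>}) \<and>
     (\<forall>c\<in>solutions M X \<pi>. \<exists>\<psi>\<in>\<Psi>. holds M \<psi> c))"

definition omega_forks ::
  "('s, 'f, 'r, 'a) struc \<Rightarrow> ('i, 's) tvar \<Rightarrow> 'a set \<Rightarrow> ('s, 'f, 'r, 'a, 'i) pfm set \<Rightarrow> bool" where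
  "omega_forks M X A \<pi> \<longleftrightarrow> (\<forall>k\<ge>1. k_forks M X k A \<pi>)"

section \<open>Complete types and the \<open>U\<^sub>\<omega>\<close>-rank\<close>

record ('s, 'f, 'r, 'a, 'i) ctype =
  tvars :: "('i, 's) tvar"
  tbase :: "'a set"
  tfms :: "('s, 'f, 'r, 'a, 'i) pfm set"

definition complete_type ::
  "'k rel \<Rightarrow> ('s, 'f, 'r, 'a) struc \<Rightarrow> ('s, 'f, 'r, 'a, 'i) ctype \<Rightarrow> bool" where
  "complete_type \<kappa> M p \<longleftrightarrow> wf_tvar M (tvars p) \<and> small \<kappa> (dom (tvars p))
     \<and> tbase p \<subseteq> elems M \<and> small \<kappa> (tbase p)
     \<and> tfms p \<subseteq> pfms M (tvars p) (tbase p)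
     \<and> finitely_satisfiable M (tvars p) (tfms p)
     \<and> (\<forall>\<psi>\<in>pfms M (tvars p) (tbase p). \<psi> \<in> tfms p \<or> pneg \<psi> \<in> tfms p)"

definition omega_forking_extension ::
  "'k rel \<Rightarrow> ('s, 'f, 'r, 'a) struc \<Rightarrow> ('s, 'f, 'r, 'a, 'i) ctype \<Rightarrow> ('s, 'f, 'r, 'a, 'i) ctype
    \<Rightarrow> bool" where
  "omega_forking_extension \<kappa> M q p \<longleftrightarrow> complete_type \<kappa> M p \<and> complete_type \<kappa> M q
     \<and> tvars q = tvars p \<and> tbase p \<subseteq> tbase q \<and> tfms p \<subseteq> tfms q
     \<and> omega_forks M (tvars q) (tbase p) (tfms q)"

text \<open>The ordinals below the successor cardinal of the cardinality of \<open>'a\<close>. For a rank on objects of type \<open>'a\<close> these are enough: the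
  ordinal values of a rank defined by such a recursion form an initial segment, whose cardinality is
  at most that of \<open>'a\<close>.\<close>

typedef 'a ordinal = "Field (cardSuc |UNIV :: 'a set| )"
proof -
  let ?r = "cardSuc |UNIV :: 'a set|"
  have "|Field ?r| =o ?r"
    by (rule card_of_Field_ordIso[OF cardSuc_Card_order[OF card_of_Card_order]])
  moreover have "\<not> ?r \<le>o |UNIV :: 'a set|"
    using cardSuc_greater[OF card_of_Card_order, of "UNIV :: 'a set"]
    by (auto dest: not_ordLess_ordLeq)
  ultimately have "Field ?r \<noteq> {}"
    by (metis card_of_empty ordIso_ordLeq_trans ordIso_symmetric)
  then show ?thesis by blast
qed

instantiation ordinal :: (type) wellorder
begin

definition less_eq_ordinal :: "'a ordinal \<Rightarrow> 'a ordinal \<Rightarrow> bool" where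
  "\<alpha> \<le> \<beta> \<longleftrightarrow> (Rep_ordinal \<alpha>, Rep_ordinal \<beta>) \<in> cardSuc |UNIV :: 'a set|"

definition less_ordinal :: "'a ordinal \<Rightarrow> 'a ordinal \<Rightarrow> bool" where
  "\<alpha> < \<beta> \<longleftrightarrow> \<alpha> \<le> \<beta> \<and> \<alpha> \<noteq> (\<beta> :: 'a ordinal)"

instance
proof
  let ?r = "cardSuc |UNIV :: 'a set|"
  have wo: "Well_order ?r"
    using cardSuc_Card_order[OF card_of_Card_order] by (rule card_order_on_well_order_on)
  have lin: "Refl ?r" "trans ?r" "antisym ?r" "Total ?r" and wf: "wf (?r - Id)"
    using wo by (auto simp: well_order_on_def linear_order_on_def partial_order_on_def preorder_on_def)
  fix x y z :: "'a ordinal"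
  show "x < y \<longleftrightarrow> x \<le> y \<and> \<not> y \<le> x"
    using lin(3) unfolding less_ordinal_def less_eq_ordinal_def
    by (metis Rep_ordinal_inject antisymD)
  show "x \<le> x"
    using lin(1) Rep_ordinal[of x] by (simp add: less_eq_ordinal_def refl_on_def)
  show "x \<le> y \<Longrightarrow> y \<le> z \<Longrightarrow> x \<le> z"
    using lin(2) unfolding less_eq_ordinal_def by (meson transD)
  show "x \<le> y \<Longrightarrow> y \<le> x \<Longrightarrow> x = y"
    using lin(3) unfolding less_eq_ordinal_def by (metis Rep_ordinal_inject antisymD)
  show "x \<le> y \<or> y \<le> x"
    using lin(1,4) Rep_ordinal[of x] Rep_ordinal[of y]
    unfolding less_eq_ordinal_def refl_on_def total_on_def by metis
next
  fix P :: "'a ordinal \<Rightarrow> bool" and a :: "'a ordinal"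
  assume step: "\<And>x. (\<And>y. y < x \<Longrightarrow> P y) \<Longrightarrow> P x"
  let ?r = "cardSuc |UNIV :: 'a set|"
  have "wf (?r - Id)"
    using card_order_on_well_order_on[OF cardSuc_Card_order[OF card_of_Card_order, of "UNIV :: 'a set"]]
    by (simp add: well_order_on_def)
  then have "wf (inv_image (?r - Id) (Rep_ordinal :: 'a ordinal \<Rightarrow> _))"
    by (rule wf_inv_image)
  then show "P a"
  proof (induction a rule: wf_induct_rule)
    case (less x)
    show ?case
    proof (rule step)
      fix y assume "y < x"
      then have "(y, x) \<in> inv_image (?r - Id) Rep_ordinal"
        by (simp add: less_ordinal_def less_eq_ordinal_def Rep_ordinal_inject)
      then show "P y" by (rule less)
    qed
  qed
qed

end

datatype 'a ord_infty = Ord "'a ordinal" | Infty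

instantiation ord_infty :: (type) linorder
begin

definition less_eq_ord_infty :: "'a ord_infty \<Rightarrow> 'a ord_infty \<Rightarrow> bool" where
  "x \<le> y \<longleftrightarrow> (case y of Infty \<Rightarrow> True
     | Ord \<beta> \<Rightarrow> (case x of Infty \<Rightarrow> False | Ord \<alpha> \<Rightarrow> \<alpha> \<le> \<beta>))"

definition less_ord_infty :: "'a ord_infty \<Rightarrow> 'a ord_infty \<Rightarrow> bool" where
  "x < y \<longleftrightarrow> x \<le> y \<and> x \<noteq> (y :: 'a ord_infty)"

instance
  by standard
    (auto simp: less_eq_ord_infty_def less_ord_infty_def split: ord_infty.splits)

end

text \<open>The least function is taken pointwise; \<open>Ord \<alpha> < F p\<close> is $F(p) \ge \alpha + 1$.\<close>

definition U_omega ::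
  "'k rel \<Rightarrow> ('s, 'f, 'r, 'a) struc \<Rightarrow> ('s, 'f, 'r, 'a, 'i) ctype
    \<Rightarrow> ('s, 'f, 'r, 'a, 'i) ctype ord_infty" where
  "U_omega \<kappa> M = (LEAST F. \<forall>\<alpha> p q.
     omega_forking_extension \<kappa> M q p \<and> Ord \<alpha> \<le> F q \<longrightarrow> Ord \<alpha> < F p)"

section \<open>Type-definable groups\<close>

definition type_definable_over ::
  "('s, 'f, 'r, 'a) struc \<Rightarrow> ('i, 's) tvar \<Rightarrow> 'a set \<Rightarrow> ('i \<Rightarrow> 'a) set \<Rightarrow> bool" where
  "type_definable_over M X A S \<longleftrightarrow> (\<exists>\<pi>\<subseteq>pfms M X A. S = solutions M X \<pi>)"

text \<open>The graph of multiplication is a set of tuples in three copies of $\bar x$.\<close>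

definition type_definable_group_over ::
  "('s, 'f, 'r, 'a) struc \<Rightarrow> ('i, 's) tvar \<Rightarrow> 'a set \<Rightarrow> ('i \<Rightarrow> 'a) monoid \<Rightarrow> bool" where
  "type_definable_group_over M X A G \<longleftrightarrow> group G \<and> type_definable_over M X A (carrier G)
     \<and> type_definable_over M (case_sum X (case_sum X X)) A
         {case_sum a (case_sum b (a \<otimes>\<^bsub>G\<^esub> b)) | a b. a \<in> carrier G \<and> b \<in> carrier G}"

definition type_definable_group ::
  "'k rel \<Rightarrow> ('s, 'f, 'r, 'a) struc \<Rightarrow> ('i, 's) tvar \<Rightarrow> ('i \<Rightarrow> 'a) monoid \<Rightarrow> bool" where
  "type_definable_group \<kappa> M X G \<longleftrightarrow> wf_tvar M X \<and> small \<kappa> (dom X)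
     \<and> (\<exists>A\<subseteq>elems M. small \<kappa> A \<and> type_definable_group_over M X A G)"

text \<open>A type of $G$ is generic if, for each of its formulas $\psi$, finitely many (left) translates
  of $\psi(G)$ cover $G$.\<close>

definition generic_type ::
  "'k rel \<Rightarrow> ('s, 'f, 'r, 'a) struc \<Rightarrow> ('i, 's) tvar \<Rightarrow> ('i \<Rightarrow> 'a) monoid
    \<Rightarrow> ('s, 'f, 'r, 'a, 'i) ctype \<Rightarrow> bool" where
  "generic_type \<kappa> M X G p \<longleftrightarrow> complete_type \<kappa> M p \<and> tvars p = X
     \<and> type_definable_group_over M X (tbase p) G
     \<and> solutions M X (tfms p) \<subseteq> carrier G
     \<and> (\<forall>\<psi>\<in>tfms p. \<exists>F\<subseteq>carrier G. finite F \<and>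
          carrier G = (\<Union>g\<in>F. g <#\<^bsub>G\<^esub> {c \<in> carrier G. holds M \<psi> c}))"

text \<open>The rank of $G$ is the rank of some (equivalently, any) generic type of $G$.\<close>

definition has_U_omega ::
  "'k rel \<Rightarrow> ('s, 'f, 'r, 'a) struc \<Rightarrow> ('i, 's) tvar \<Rightarrow> ('i \<Rightarrow> 'a) monoid
    \<Rightarrow> ('s, 'f, 'r, 'a, 'i) ctype ord_infty \<Rightarrow> bool" where
  "has_U_omega \<kappa> M X G u \<longleftrightarrow> (\<exists>p. generic_type \<kappa> M X G p \<and> U_omega \<kappa> M p = u)"

definition rel_definable_subgroup ::
  "('s, 'f, 'r, 'a) struc \<Rightarrow> ('i, 's) tvar \<Rightarrow> ('i \<Rightarrow> 'a) monoid \<Rightarrow> ('i \<Rightarrow> 'a) set \<Rightarrow> bool" where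
  "rel_definable_subgroup M X G H \<longleftrightarrow> subgroup H G
     \<and> (\<exists>\<psi>\<in>pfms M X (elems M). H = {c \<in> carrier G. holds M \<psi> c})"

definition infinite_index :: "('g, 'b) monoid_scheme \<Rightarrow> 'g set \<Rightarrow> 'g set \<Rightarrow> bool" where
  "infinite_index G H K \<longleftrightarrow> infinite (rcosets\<^bsub>G\<lparr>carrier := H\<rparr>\<^esub> K)"

end

theory Submission
  imports Defs "HOL-Library.Ramsey"
begin

text \<open>
  A coset of a subgroup of infinite index skew $k$-divides for every $k$, so one step of the chain
  already yields an $\omega$-forking extension. Let $K \le H$ have infinite index. By
  B. H. Neumann's lemma there are $b_0, b_1, \ldots$ in $H$ such that the cosets
  $b_{i_{k-1}} \cdots b_{i_0} K$ for $i_0 < \ldots < i_{k-1}$ are pairwise distinct. If moreover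
  $(b_i)$ is indiscernible over $A$, then ``$x \in b_{2(k-1)} \cdots b_2 b_0 K$, and $x$ lies in
  none of the other cosets of this shape'' skew $k$-divides over $A$.

  By compactness one obtains a realization $x$ of a generic type $p$ and a sequence of
  parameters for which this happens simultaneously for all $k$ and all consecutive members
  $H_{n+1} \le H_n$ of the chain, with the sequences of step $n$ indiscernible over all parameters
  used before. For finite satisfiability Ramsey's theorem yields sequences $b^n$ in $H_n$; for
  $k \le K$ the product $b^n_{2(K-1)} \cdots b^n_0$ serves step $n$ with the right factor
  $d = b^n_{2(K-k-1)} \cdots b^n_0$ as an additional parameter and the $k$ remaining factors as a
  product of the shifted sequence. Since finitely many translates of a formula of $p$ cover $G$, a
  left translation by one of finitely many elements, fixed in advance, makes $x$ satisfy a given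
  finite part of $p$. The types of $x$ over the increasing sets of parameters are an infinite chain
  of $\omega$-forking extensions, which contradicts $U_\omega(p) < \infty$.
\<close>

section \<open>Definable predicates\<close>

text \<open>All k have to be served by one element x, so there is a single sequence per step and not
  one per k. Products put the newest factor on the left: a common last factor then cancels, and "b u
  lies in v K" puts b into a coset of the conjugate v K v^-1, which is why Neumann's lemma is needed
  for several subgroups. The right factor d consists of the earliest terms; the later ones are still
  homogeneous over it. The steps are combined as x = f^-1 e_0 e_1 ... with e_n in H_n the product of
  step n. The factors after e_n lie in H_(n+1), so they do not change the coset reached at step n,
  and f^-1 e_0 ... e_(n-1) is one more parameter, on the left. Two obstacles come from logic.
  Multiplication is only type-definable, so that membership in a coset is given by a formula only
  relative to G, and this takes a compactness argument. Saturation is given for types in one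
  variable of the home structure and has to be extended to small tuples of variables and to
  imaginaries.\<close>

lemma eval_trm_cong:
  "(\<And>v. v \<in> fv_trm t \<Longrightarrow> e v = e' v) \<Longrightarrow> eval_trm M e t = eval_trm M e' t"
proof (induction t)
  case (App f ts)
  have "map (eval_trm M e) ts = map (eval_trm M e') ts"
    using App by (intro map_cong refl App.IH) auto
  then show ?case by (metis eval_trm.simps(2))
qed simp

lemma sat_cong:
  "(\<And>v. v \<in> fv \<phi> \<Longrightarrow> e v = e' v) \<Longrightarrow> sat M e \<phi> \<longleftrightarrow> sat M e' \<phi>"
proof (induction \<phi> arbitrary: e e')
  case (Eq t u)
  then show ?case
    using eval_trm_cong[of t e e' M] eval_trm_cong[of u e e' M] by auto
next
  case (Rel r ts)
  have "map (eval_trm M e) ts = map (eval_trm M e') ts"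
    using Rel by (intro map_cong refl eval_trm_cong) auto
  then show ?case by (metis sat.simps(2))
next
  case (Neg \<phi>)
  have "sat M e \<phi> \<longleftrightarrow> sat M e' \<phi>" by (rule Neg.IH) (use Neg.prems in auto)
  then show ?case by simp
next
  case (And \<phi>1 \<phi>2)
  have "sat M e \<phi>1 \<longleftrightarrow> sat M e' \<phi>1" by (rule And.IH(1)) (use And.prems in auto)
  moreover have "sat M e \<phi>2 \<longleftrightarrow> sat M e' \<phi>2" by (rule And.IH(2)) (use And.prems in auto)
  ultimately show ?case by simp
next
  case (Ex v \<phi>)
  have "sat M (e(v := a)) \<phi> \<longleftrightarrow> sat M (e'(v := a)) \<phi>" for a
    by (rule Ex.IH) (use Ex.prems in auto)
  then show ?case by simp
qed

lemma finite_fv_trm: "finite (fv_trm t)"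
  by (induction t) auto

lemma finite_fv: "finite (fv \<phi>)"
  by (induction \<phi>) (auto simp: finite_fv_trm)

section \<open>Injective renaming of variables\<close>

primrec rename_trm :: "('s var \<Rightarrow> 's var) \<Rightarrow> ('s, 'f) trm \<Rightarrow> ('s, 'f) trm" where
  "rename_trm \<rho> (Var v) = Var (\<rho> v)"
| "rename_trm \<rho> (App f ts) = App f (map (rename_trm \<rho>) ts)"

text \<open>Bound variables are renamed as well, so that an injective \<rho> cannot cause capture.
  The purpose is to give two formulas disjoint variables.\<close>

primrec rename_fm :: "('s var \<Rightarrow> 's var) \<Rightarrow> ('s, 'f, 'r) fm \<Rightarrow> ('s, 'f, 'r) fm" where
  "rename_fm \<rho> (Eq t u) = Eq (rename_trm \<rho> t) (rename_trm \<rho> u)"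
| "rename_fm \<rho> (Rel r ts) = Rel r (map (rename_trm \<rho>) ts)"
| "rename_fm \<rho> (Neg \<phi>) = Neg (rename_fm \<rho> \<phi>)"
| "rename_fm \<rho> (And \<phi> \<psi>) = And (rename_fm \<rho> \<phi>) (rename_fm \<rho> \<psi>)"
| "rename_fm \<rho> (Ex v \<phi>) = Ex (\<rho> v) (rename_fm \<rho> \<phi>)"

lemma eval_rename_trm: "eval_trm M e (rename_trm \<rho> t) = eval_trm M (e \<circ> \<rho>) t"
  by (induction t) (auto simp: comp_def cong: map_cong)

lemma fv_rename_trm: "fv_trm (rename_trm \<rho> t) = \<rho> ` fv_trm t"
  by (induction t) auto

lemma sort_of_rename_trm:
  assumes "\<And>v. fst (\<rho> v) = fst v"
  shows "sort_of L (rename_trm \<rho> t) = sort_of L t"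
  by (cases t) (simp_all add: assms)

lemma wf_rename_trm:
  assumes "\<And>v. fst (\<rho> v) = fst v"
  shows "wf_trm L t \<Longrightarrow> wf_trm L (rename_trm \<rho> t)"
proof (induction t)
  case (App f ts)
  have "map (sort_of L) (map (rename_trm \<rho>) ts) = map (sort_of L) ts"
    by (simp add: sort_of_rename_trm[OF assms])
  moreover have "list_all (wf_trm L) (map (rename_trm \<rho>) ts)"
    using App by (auto simp: list_all_iff)
  ultimately show ?case using App.prems by (metis rename_trm.simps(2) wf_trm.simps(2))
qed (simp add: assms)

lemma sat_rename_fm:
  assumes \<rho>: "\<And>v. fst (\<rho> v) = fst v" "inj \<rho>"
  shows "sat M e (rename_fm \<rho> \<phi>) \<longleftrightarrow> sat M (e \<circ> \<rho>) \<phi>"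
proof (induction \<phi> arbitrary: e)
  case (Rel r ts)
  then show ?case by (simp add: eval_rename_trm comp_def cong: map_cong)
next
  case (Ex v \<phi>)
  have "e(\<rho> v := a) \<circ> \<rho> = (e \<circ> \<rho>)(v := a)" for a
    using \<rho>(2) by (auto simp: fun_eq_iff inj_eq)
  then show ?case by (simp only: rename_fm.simps sat.simps Ex.IH \<rho>)
qed (simp_all add: eval_rename_trm)

lemma fv_rename_fm: "inj \<rho> \<Longrightarrow> fv (rename_fm \<rho> \<phi>) = \<rho> ` fv \<phi>"
  by (induction \<phi>) (auto simp: fv_rename_trm image_Un inj_eq image_set_diff)

lemma wf_rename_fm:
  assumes "\<And>v. fst (\<rho> v) = fst v"
  shows "wf_fm L \<phi> \<Longrightarrow> wf_fm L (rename_fm \<rho> \<phi>)"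
proof (induction \<phi>)
  case (Rel r ts)
  have "map (sort_of L) (map (rename_trm \<rho>) ts) = map (sort_of L) ts"
    by (simp add: sort_of_rename_trm[OF assms])
  moreover have "list_all (wf_trm L) (map (rename_trm \<rho>) ts)"
    using Rel by (auto simp: list_all_iff wf_rename_trm[OF assms])
  ultimately show ?case using Rel by (metis rename_fm.simps(2) wf_fm.simps(2))
qed (auto simp: wf_rename_trm[OF assms] sort_of_rename_trm[OF assms] assms)

section \<open>Closure properties of definable predicates\<close>

definition sorted_asg :: "('s, 'f, 'r, 'a) struc \<Rightarrow> ('i, 's) tvar \<Rightarrow> ('i \<Rightarrow> 'a) \<Rightarrow> bool" where
  "sorted_asg M X c \<longleftrightarrow> (\<forall>i s. X i = Some s \<longrightarrow> c i \<in> univ M s)"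

text \<open>Assignments are, unlike tuples, arbitrary outside the domain of $\bar x$; this makes
  definability stable under all substitutions of coordinates.\<close>

definition definable ::
  "('s, 'f, 'r, 'a) struc \<Rightarrow> ('i, 's) tvar \<Rightarrow> 'a set \<Rightarrow> (('i \<Rightarrow> 'a) \<Rightarrow> bool) \<Rightarrow> bool" where
  "definable M X B P \<longleftrightarrow> (\<exists>\<psi>\<in>pfms M X B. \<forall>c. sorted_asg M X c \<longrightarrow> P c = holds M \<psi> c)"

lemma pfms_iff:
  "(\<phi>, \<sigma>) \<in> pfms M X A \<longleftrightarrow> wf_fm (lang M) \<phi> \<and>
     (\<forall>v\<in>fv \<phi>. (\<forall>i. \<sigma> v = Inl i \<longrightarrow> X i = Some (fst v)) \<and>
        (\<forall>a. \<sigma> v = Inr a \<longrightarrow> a \<in> A \<and> a \<in> univ M (fst v)))"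
  by (auto simp: pfms_def split: sum.splits)

lemma pfms_mono: "X \<subseteq>\<^sub>m X' \<Longrightarrow> B \<subseteq> B' \<Longrightarrow> pfms M X B \<subseteq> pfms M X' B'"
  by (auto simp: pfms_iff map_le_def dom_def subset_eq)

lemma tuples_iff: "c \<in> tuples M X \<longleftrightarrow> sorted_asg M X c \<and> (\<forall>i. X i = None \<longrightarrow> c i = undefined)"
proof -
  have "(case X i of None \<Rightarrow> c i = undefined | Some s \<Rightarrow> c i \<in> univ M s) \<longleftrightarrow>
      (\<forall>s. X i = Some s \<longrightarrow> c i \<in> univ M s) \<and> (X i = None \<longrightarrow> c i = undefined)" for i
    by (cases "X i") auto
  then show ?thesis by (auto simp: tuples_def sorted_asg_def)
qed

lemma sorted_asg_mono: "X \<subseteq>\<^sub>m X' \<Longrightarrow> sorted_asg M X' c \<Longrightarrow> sorted_asg M X c"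
  by (auto simp: sorted_asg_def map_le_def dom_def)

lemma holds_cong:
  assumes "(\<phi>, \<sigma>) \<in> pfms M X B" "\<And>i s. X i = Some s \<Longrightarrow> c i = c' i"
  shows "holds M (\<phi>, \<sigma>) c \<longleftrightarrow> holds M (\<phi>, \<sigma>) c'"
  unfolding holds_def fst_conv snd_conv
  by (rule sat_cong) (use assms in \<open>auto simp: pfms_iff split: sum.splits\<close>)

lemma definable_holds: "\<psi> \<in> pfms M X B \<Longrightarrow> definable M X B (holds M \<psi>)"
  by (auto simp: definable_def)

lemma definable_cong:
  "(\<And>c. sorted_asg M X c \<Longrightarrow> P c = Q c) \<Longrightarrow> definable M X B P = definable M X B Q"
  by (auto simp: definable_def)

lemma definable_mono:
  assumes "definable M X B P" "X \<subseteq>\<^sub>m X'" "B \<subseteq> B'"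
  shows "definable M X' B' P"
  using assms pfms_mono[of X X' B B' M] sorted_asg_mono[of X X' M] unfolding definable_def by blast

lemma definable_asg_cong:
  assumes "definable M X B P" "sorted_asg M X c" "\<And>i s. X i = Some s \<Longrightarrow> c i = c' i"
  shows "P c \<longleftrightarrow> P c'"
proof -
  have "sorted_asg M X c'" using assms(2,3) by (auto simp: sorted_asg_def)
  with assms show ?thesis
    unfolding definable_def by (metis holds_cong prod.collapse)
qed

text \<open>The L-formula stays as it is; only its assignment of variables to coordinates and
  parameters is composed with \<open>f\<close>, so no capture can occur.\<close>

lemma definable_subst:
  assumes P: "definable M X B P" and "B \<subseteq> B'"
    and f: "\<And>i s. X i = Some s \<Longrightarrow> case f i of Inl j \<Rightarrow> X' j = Some s | Inr a \<Rightarrow> a \<in> B' \<inter> univ M s"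
  shows "definable M X' B' (\<lambda>c. P (\<lambda>i. case_sum c (\<lambda>a. a) (f i)))"
proof -
  obtain \<phi> \<sigma> where \<psi>: "(\<phi>, \<sigma>) \<in> pfms M X B" "\<And>c. sorted_asg M X c \<Longrightarrow> P c = holds M (\<phi>, \<sigma>) c"
    using P by (auto simp: definable_def)
  let ?\<sigma> = "\<lambda>v. case \<sigma> v of Inl i \<Rightarrow> f i | Inr a \<Rightarrow> Inr a"
  have "(\<phi>, ?\<sigma>) \<in> pfms M X' B'"
    using \<psi>(1) f \<open>B \<subseteq> B'\<close> by (fastforce simp: pfms_iff split: sum.splits)
  moreover have "P (\<lambda>i. case_sum c (\<lambda>a. a) (f i)) = holds M (\<phi>, ?\<sigma>) c" if "sorted_asg M X' c" for c
  proof -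
    have "sorted_asg M X (\<lambda>i. case_sum c (\<lambda>a. a) (f i))"
      using f that by (fastforce simp: sorted_asg_def split: sum.splits)
    then have "P (\<lambda>i. case_sum c (\<lambda>a. a) (f i)) = holds M (\<phi>, \<sigma>) (\<lambda>i. case_sum c (\<lambda>a. a) (f i))"
      by (rule \<psi>(2))
    also have "\<dots> = holds M (\<phi>, ?\<sigma>) c"
      unfolding holds_def fst_conv snd_conv by (rule sat_cong) (auto split: sum.splits)
    finally show ?thesis .
  qed
  ultimately show ?thesis unfolding definable_def by blast
qed

lemma definable_reindex:
  assumes "definable M X B P" "\<And>i s. X i = Some s \<Longrightarrow> X' (f i) = Some s"
  shows "definable M X' B (\<lambda>c. P (\<lambda>i. c (f i)))"
  using definable_subst[OF assms(1) order_refl, where f="\<lambda>i. Inl (f i)" and X'=X'] assms(2) by simp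

lemma definable_not:
  assumes "definable M X B P"
  shows "definable M X B (\<lambda>c. \<not> P c)"
proof -
  obtain \<phi> \<sigma> where \<psi>: "(\<phi>, \<sigma>) \<in> pfms M X B" "\<And>c. sorted_asg M X c \<Longrightarrow> P c = holds M (\<phi>, \<sigma>) c"
    using assms by (auto simp: definable_def)
  have "(Neg \<phi>, \<sigma>) \<in> pfms M X B" using \<psi>(1) by (auto simp: pfms_iff)
  moreover have "(\<not> P c) = holds M (Neg \<phi>, \<sigma>) c" if "sorted_asg M X c" for c
    using \<psi>(2)[OF that] by (simp add: holds_def)
  ultimately show ?thesis unfolding definable_def by blast
qed

lemma definable_conj:
  assumes "definable M X B P" "definable M X B Q"
  shows "definable M X B (\<lambda>c. P c \<and> Q c)"
proof -
  obtain \<phi> \<sigma> where 1: "(\<phi>, \<sigma>) \<in> pfms M X B" "\<And>c. sorted_asg M X c \<Longrightarrow> P c = holds M (\<phi>, \<sigma>) c"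
    using assms(1) by (auto simp: definable_def)
  obtain \<phi>' \<sigma>' where 2: "(\<phi>', \<sigma>') \<in> pfms M X B" "\<And>c. sorted_asg M X c \<Longrightarrow> Q c = holds M (\<phi>', \<sigma>') c"
    using assms(2) by (auto simp: definable_def)
  \<comment> \<open>The two formulas may attach different objects to the same variable, so their
    variables are first moved to even and to odd indices.\<close>
  let ?\<rho> = "\<lambda>v. (fst v, 2 * snd v :: nat)" and ?\<rho>' = "\<lambda>v. (fst v, Suc (2 * snd v))"
  let ?\<tau> = "\<lambda>v. if even (snd v) then \<sigma> (fst v, snd v div 2) else \<sigma>' (fst v, snd v div 2)"
  let ?\<psi> = "(And (rename_fm ?\<rho> \<phi>) (rename_fm ?\<rho>' \<phi>'), ?\<tau>)"
  have inj: "inj ?\<rho>" "inj ?\<rho>'" by (auto simp: inj_def)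
  have "?\<psi> \<in> pfms M X B"
    using 1(1) 2(1) by (auto simp: pfms_iff wf_rename_fm fv_rename_fm inj)
  moreover have "(P c \<and> Q c) = holds M ?\<psi> c" if "sorted_asg M X c" for c
    using 1(2)[OF that] 2(2)[OF that]
    by (simp add: holds_def sat_rename_fm inj comp_def)
  ultimately show ?thesis unfolding definable_def by blast
qed

lemma definable_True:
  assumes "sorts (lang M) \<noteq> {}"
  shows "definable M X B (\<lambda>_. True)"
proof -
  obtain s where s: "s \<in> sorts (lang M)" using assms by auto
  \<comment> \<open>The equation is closed off by a quantifier, since \<open>X\<close> and
    \<open>B\<close> may be empty and offer nothing to attach to a free variable.\<close>
  let ?\<phi> = "Eq (Var (s, 0)) (Var (s, 0))"
  have "(Neg (Ex (s, 0) (Neg ?\<phi>)), \<sigma>) \<in> pfms M X B" for \<sigma>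
    using s by (auto simp: pfms_iff)
  moreover have "holds M (Neg (Ex (s, 0) (Neg ?\<phi>)), \<sigma>) c" for \<sigma> c
    by (simp add: holds_def)
  ultimately show ?thesis unfolding definable_def by blast
qed

lemma definable_Ball:
  assumes "sorts (lang M) \<noteq> {}" "finite S" "\<And>x. x \<in> S \<Longrightarrow> definable M X B (P x)"
  shows "definable M X B (\<lambda>c. \<forall>x\<in>S. P x c)"
  using assms(2,3) by (induction S) (auto simp: definable_True[OF assms(1)] intro: definable_conj)

text \<open>A formula mentions finitely many coordinates and parameters. This makes conditions on
  infinite tuples accessible to first-order quantifiers.\<close>

lemma definable_finite_support:
  assumes "definable M X B P"
  obtains F B' Q where "finite F" "F \<subseteq> dom X" "finite B'" "B' \<subseteq> B" "definable M (X |` F) B' Q"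
    "\<And>c. sorted_asg M X c \<Longrightarrow> P c = Q c"
proof -
  obtain \<phi> \<sigma> where \<psi>: "(\<phi>, \<sigma>) \<in> pfms M X B" "\<And>c. sorted_asg M X c \<Longrightarrow> P c = holds M (\<phi>, \<sigma>) c"
    using assms by (auto simp: definable_def)
  let ?F = "{i. \<exists>v\<in>fv \<phi>. \<sigma> v = Inl i}" and ?B = "{a. \<exists>v\<in>fv \<phi>. \<sigma> v = Inr a}"
  have "?F \<subseteq> (\<lambda>v. projl (\<sigma> v)) ` fv \<phi>" "?B \<subseteq> (\<lambda>v. projr (\<sigma> v)) ` fv \<phi>"
    by force+
  then have "finite ?F" "finite ?B" by (meson finite_subset finite_imageI finite_fv)+
  moreover have "(\<phi>, \<sigma>) \<in> pfms M (X |` ?F) ?B"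
    using \<psi>(1) by (auto simp: pfms_iff restrict_map_def)
  moreover have "?F \<subseteq> dom X" "?B \<subseteq> B" using \<psi>(1) by (auto simp: pfms_iff)
  ultimately show ?thesis using that[of ?F ?B "holds M (\<phi>, \<sigma>)"] \<psi>(2) definable_holds by blast
qed

section \<open>Existential quantification over coordinates\<close>

lemma fv_trm_sorts: "wf_trm L t \<Longrightarrow> v \<in> fv_trm t \<Longrightarrow> fst v \<in> sorts L"
  by (induction t) (auto simp: list_all_iff)

lemma fv_sorts: "wf_fm L \<phi> \<Longrightarrow> v \<in> fv \<phi> \<Longrightarrow> fst v \<in> sorts L"
  by (induction \<phi>) (auto simp: list_all_iff dest: fv_trm_sorts)

lemma sat_foldr_eq:
  "sat M e (foldr (\<lambda>w. And (Eq (Var v) (Var w))) vs \<phi>) \<longleftrightarrow> (\<forall>w\<in>set vs. e v = e w) \<and> sat M e \<phi>"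
  by (induction vs) auto

lemma sat_foldr_Ex:
  "sat M e (foldr Ex vs \<phi>) \<longleftrightarrow>
     (\<exists>g. (\<forall>v\<in>set vs. g v \<in> univ M (fst v)) \<and> sat M (override_on e g (set vs)) \<phi>)"
proof (induction vs arbitrary: e)
  case (Cons v vs)
  have upd: "override_on (e(v := g v)) g (set vs) = override_on e g (insert v (set vs))" for g
    by (auto simp: override_on_def fun_eq_iff)
  have "(\<exists>a\<in>univ M (fst v). \<exists>g. (\<forall>v\<in>set vs. g v \<in> univ M (fst v)) \<and>
      sat M (override_on (e(v := a)) g (set vs)) \<phi>) \<longleftrightarrow>
    (\<exists>g. (\<forall>v\<in>insert v (set vs). g v \<in> univ M (fst v)) \<and>
      sat M (override_on (e(v := g v)) g (set vs)) \<phi>)" (is "?L \<longleftrightarrow> ?R")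
  proof
    assume ?L
    then obtain a g where a: "a \<in> univ M (fst v)" and g: "\<forall>v\<in>set vs. g v \<in> univ M (fst v)"
      "sat M (override_on (e(v := a)) g (set vs)) \<phi>" by blast
    \<comment> \<open>If \<open>v\<close> occurs again in \<open>vs\<close>, the inner quantifier
      overrides \<open>a\<close>.\<close>
    let ?g = "\<lambda>w. if w \<in> set vs then g w else a"
    have "override_on (e(v := ?g v)) ?g (set vs) = override_on (e(v := a)) g (set vs)"
      by (auto simp: override_on_def fun_eq_iff)
    with a g show ?R by (intro exI[of _ ?g]) auto
  qed auto
  then show ?case by (simp only: foldr.simps comp_def sat.simps Cons.IH upd list.set)
qed simp

text \<open>Several variables of the formula may be attached to the coordinate \<open>i\<close>. All
  of them are quantified and equated with the first, \<open>hd vs\<close>, which has the effect of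
  one quantifier over the coordinate.\<close>

lemma definable_Ex:
  assumes P: "definable M X B P" and i: "X i = Some s" and ne: "univ M s \<noteq> {}"
  shows "definable M (X(i := None)) B (\<lambda>c. \<exists>a\<in>univ M s. P (c(i := a)))"
proof -
  obtain \<phi> \<sigma> where \<psi>: "(\<phi>, \<sigma>) \<in> pfms M X B" "\<And>c. sorted_asg M X c \<Longrightarrow> P c = holds M (\<phi>, \<sigma>) c"
    using P by (auto simp: definable_def)
  let ?V = "{v \<in> fv \<phi>. \<sigma> v = Inl i}"
  obtain vs where vs: "set vs = ?V"
    using finite_list[of ?V] finite_fv[of \<phi>] by auto
  have V: "fst v = s" "fst v \<in> sorts (lang M)" if "v \<in> ?V" for v
    using that \<psi>(1) i fv_sorts[of "lang M" \<phi> v] by (auto simp: pfms_iff)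
  define \<phi>' where "\<phi>' = foldr Ex vs (foldr (\<lambda>w. And (Eq (Var (hd vs)) (Var w))) vs \<phi>)"
  have wf_eq: "wf_fm (lang M) (foldr (\<lambda>w. And (Eq (Var v) (Var w))) ws \<phi>)"
    if "insert v (set ws) \<subseteq> ?V" for v ws
    using that \<psi>(1) V by (induction ws) (auto simp: pfms_iff)
  have fv_eq: "fv (foldr (\<lambda>w. And (Eq (Var v) (Var w))) ws \<phi>) = fv \<phi> \<union> set ws \<union> (if ws = [] then {} else {v})"
    for v ws by (induction ws) auto
  have wf_Ex: "wf_fm (lang M) (foldr Ex ws \<chi>)" if "wf_fm (lang M) \<chi>" "set ws \<subseteq> ?V" for ws \<chi>
    using that V(2) by (induction ws) auto
  have fv_Ex: "fv (foldr Ex ws \<chi>) = fv \<chi> - set ws" for ws \<chi>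
    by (induction ws) auto
  have hd: "vs \<noteq> [] \<Longrightarrow> hd vs \<in> ?V" using vs hd_in_set by blast
  have "wf_fm (lang M) \<phi>'" unfolding \<phi>'_def
    using wf_eq[of "hd vs" vs] hd vs \<psi>(1) by (cases "vs = []") (auto simp: pfms_iff intro!: wf_Ex)
  moreover have "fv \<phi>' = fv \<phi> - ?V"
    using hd vs by (auto simp: \<phi>'_def fv_Ex fv_eq)
  ultimately have "(\<phi>', \<sigma>) \<in> pfms M (X(i := None)) B"
    using \<psi>(1) by (auto simp: pfms_iff)
  moreover have "(\<exists>a\<in>univ M s. P (c(i := a))) = holds M (\<phi>', \<sigma>) c"
    if c: "sorted_asg M (X(i := None)) c" for c
  proof -
    let ?e = "\<lambda>c v. case \<sigma> v of Inl i \<Rightarrow> c i | Inr a \<Rightarrow> a"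
    have P_iff: "P (c(i := a)) \<longleftrightarrow> sat M (?e (c(i := a))) \<phi>" if "a \<in> univ M s" for a
    proof -
      have "sorted_asg M X (c(i := a))" using c that i by (auto simp: sorted_asg_def)
      then show ?thesis using \<psi>(2) by (simp add: holds_def)
    qed
    have e: "sat M (?e (c(i := a))) \<phi> \<longleftrightarrow> sat M (override_on (?e c) (\<lambda>_. a) ?V) \<phi>" for a
      by (rule sat_cong) (auto simp: override_on_def split: sum.splits)
    have "holds M (\<phi>', \<sigma>) c \<longleftrightarrow> (\<exists>g. (\<forall>v\<in>?V. g v \<in> univ M (fst v)) \<and>
       (\<forall>w\<in>?V. override_on (?e c) g ?V (hd vs) = override_on (?e c) g ?V w) \<and>
       sat M (override_on (?e c) g ?V) \<phi>)"
      by (simp only: holds_def \<phi>'_def fst_conv snd_conv sat_foldr_eq sat_foldr_Ex vs)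
    also have "\<dots> \<longleftrightarrow> (\<exists>g. (\<forall>v\<in>?V. g v \<in> univ M s) \<and> (\<forall>w\<in>?V. g (hd vs) = g w) \<and>
       sat M (override_on (?e c) g ?V) \<phi>)"
    proof (intro ex_cong1 conj_cong refl ball_cong)
      fix g w assume w: "w \<in> ?V"
      then have "hd vs \<in> ?V" using hd vs by (metis (no_types, lifting) empty_iff list.set(1))
      with w show "(override_on (?e c) g ?V (hd vs) = override_on (?e c) g ?V w) = (g (hd vs) = g w)"
        by (simp add: override_on_def)
    qed (simp add: V(1))
    also have "\<dots> \<longleftrightarrow> (\<exists>a\<in>univ M s. sat M (override_on (?e c) (\<lambda>_. a) ?V) \<phi>)" (is "?L \<longleftrightarrow> ?R")
    proof
      assume ?L
      then obtain g where g: "\<forall>v\<in>?V. g v \<in> univ M s" "\<forall>w\<in>?V. g (hd vs) = g w"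
        "sat M (override_on (?e c) g ?V) \<phi>" by blast
      obtain a where a: "a \<in> univ M s" "\<forall>w\<in>?V. g w = a"
      proof (cases "?V = {}")
        \<comment> \<open>No variable is attached to \<open>i\<close>, so any value will do; here
          the sort has to be nonempty.\<close>
        case True
        obtain a where "a \<in> univ M s" using ne by blast
        then show ?thesis by (rule that) (simp only: True ball_empty)
      next
        case False
        then have "vs \<noteq> []" using vs by (metis list.set(1))
        then have "hd vs \<in> ?V" by (rule hd)
        then have "g (hd vs) \<in> univ M s" using g(1) by blast
        moreover have "\<forall>w\<in>?V. g w = g (hd vs)" using g(2) by metis
        ultimately show ?thesis by (rule that)
      qed
      then have "override_on (?e c) g ?V = override_on (?e c) (\<lambda>_. a) ?V"
        by (auto simp: override_on_def fun_eq_iff)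
      then show ?R using a g(3) by auto
    next
      assume ?R
      then obtain a where "a \<in> univ M s" "sat M (override_on (?e c) (\<lambda>_. a) ?V) \<phi>" by blast
      then show ?L by (intro exI[of _ "\<lambda>_. a"]) auto
    qed
    finally show ?thesis using P_iff e by auto
  qed
  ultimately show ?thesis unfolding definable_def by blast
qed

lemma sorted_asg_restrict:
  "sorted_asg M (X |` S) c \<longleftrightarrow> (\<forall>i\<in>S. \<forall>s. X i = Some s \<longrightarrow> c i \<in> univ M s)"
  by (auto simp: sorted_asg_def restrict_map_def)

lemma definable_Ex_finite:
  assumes P: "definable M X B P" and S: "finite S" "S \<subseteq> dom X"
    and ne: "\<And>i s. i \<in> S \<Longrightarrow> X i = Some s \<Longrightarrow> univ M s \<noteq> {}"
  shows "definable M (X |` (- S)) B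
    (\<lambda>c. \<exists>c'. sorted_asg M (X |` S) c' \<and> P (override_on c c' S))"
  using S ne
proof (induction S)
  case empty
  then show ?case using P by (auto simp: sorted_asg_def restrict_map_def)
next
  case (insert i S)
  let ?Q = "\<lambda>S c. \<exists>c'. sorted_asg M (X |` S) c' \<and> P (override_on c c' S)"
  obtain s where s: "X i = Some s" using insert.prems by auto
  then have si: "(X |` (- S)) i = Some s" using insert.hyps by simp
  have dom: "(X |` (- S))(i := None) = X |` (- insert i S)"
    by (auto simp: restrict_map_def fun_eq_iff)
  have "definable M (X |` (- S)) B (?Q S)" using insert by auto
  from definable_Ex[OF this si insert.prems(2)[OF _ s]] have
    "definable M (X |` (- insert i S)) B (\<lambda>c. \<exists>a\<in>univ M s. ?Q S (c(i := a)))"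
    unfolding dom by simp
  moreover have "(\<exists>a\<in>univ M s. ?Q S (c(i := a))) = ?Q (insert i S) c" for c
  proof
    assume "\<exists>a\<in>univ M s. ?Q S (c(i := a))"
    then obtain a c' where "a \<in> univ M s" "sorted_asg M (X |` S) c'"
      "P (override_on (c(i := a)) c' S)" by blast
    moreover have "override_on (c(i := a)) c' S = override_on c (c'(i := a)) (insert i S)"
      using insert.hyps by (auto simp: override_on_def fun_eq_iff)
    ultimately show "?Q (insert i S) c"
      using s by (intro exI[of _ "c'(i := a)"]) (simp add: sorted_asg_restrict)
  next
    assume "?Q (insert i S) c"
    then obtain c' where "sorted_asg M (X |` insert i S) c'" "P (override_on c c' (insert i S))"
      by blast
    moreover have "override_on (c(i := c' i)) c' S = override_on c c' (insert i S)"
      by (auto simp: override_on_def fun_eq_iff)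
    ultimately show "\<exists>a\<in>univ M s. ?Q S (c(i := a))"
      using s by (intro bexI[of _ "c' i"] exI[of _ c'] conjI) (simp_all add: sorted_asg_restrict)
  qed
  ultimately show ?case by simp
qed

section \<open>Saturation for infinite tuples\<close>

definition fin_sat :: "('s, 'f, 'r, 'a) struc \<Rightarrow> ('i, 's) tvar \<Rightarrow> (('i \<Rightarrow> 'a) \<Rightarrow> bool) set \<Rightarrow> bool" where
  "fin_sat M X \<P> \<longleftrightarrow> (\<forall>\<Q>\<subseteq>\<P>. finite \<Q> \<longrightarrow> (\<exists>c. sorted_asg M X c \<and> (\<forall>P\<in>\<Q>. P c)))"

lemma saturated_unary:
  fixes \<P> :: "((unit \<Rightarrow> 'a) \<Rightarrow> bool) set"
  assumes sat: "saturated \<kappa> M" and A: "A \<subseteq> elems M" "small \<kappa> A" and s: "s \<in> sorts (lang M)"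
    and def: "\<And>P. P \<in> \<P> \<Longrightarrow> definable M (\<lambda>_. Some s) A P"
    and fin: "fin_sat M (\<lambda>_. Some s) \<P>"
  shows "\<exists>c. sorted_asg M (\<lambda>_. Some s) c \<and> (\<forall>P\<in>\<P>. P c)"
proof -
  let ?X = "\<lambda>_::unit. Some s"
  \<comment> \<open>All formulas that define some member of \<open>\<P>\<close> are taken, so none
    has to be selected.\<close>
  define \<pi> where "\<pi> = {\<psi> \<in> pfms M ?X A. \<exists>P\<in>\<P>. \<forall>c. sorted_asg M ?X c \<longrightarrow> P c = holds M \<psi> c}"
  have "finitely_satisfiable M ?X \<pi>"
    unfolding finitely_satisfiable_def
  proof (intro allI impI)
    fix \<pi>0 assume "\<pi>0 \<subseteq> \<pi>" "finite \<pi>0"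
    then have "\<forall>\<psi>\<in>\<pi>0. \<exists>P. P \<in> \<P> \<and> (\<forall>c. sorted_asg M ?X c \<longrightarrow> P c = holds M \<psi> c)"
      by (auto simp: \<pi>_def)
    from bchoice[OF this] obtain f where f: "\<And>\<psi>. \<psi> \<in> \<pi>0 \<Longrightarrow> f \<psi> \<in> \<P>"
      "\<And>\<psi> c. \<psi> \<in> \<pi>0 \<Longrightarrow> sorted_asg M ?X c \<Longrightarrow> f \<psi> c = holds M \<psi> c"
      by blast
    have "f ` \<pi>0 \<subseteq> \<P>" "finite (f ` \<pi>0)" using f(1) \<open>finite \<pi>0\<close> by auto
    then obtain c where "sorted_asg M ?X c" "\<forall>P\<in>f ` \<pi>0. P c"
      using fin unfolding fin_sat_def by meson
    then have "c \<in> solutions M ?X \<pi>0" using f(2) by (auto simp: solutions_def tuples_iff)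
    then show "solutions M ?X \<pi>0 \<noteq> {}" by blast
  qed
  moreover have "\<pi> \<subseteq> pfms M ?X A" by (auto simp: \<pi>_def)
  ultimately obtain c where "c \<in> solutions M ?X \<pi>"
    using sat A s unfolding saturated_def by blast
  then have c: "sorted_asg M ?X c" "\<And>\<psi>. \<psi> \<in> \<pi> \<Longrightarrow> holds M \<psi> c"
    by (auto simp: solutions_def tuples_iff)
  have "P c" if "P \<in> \<P>" for P
    using def[OF that] that c unfolding definable_def \<pi>_def by blast
  with c(1) show ?thesis by blast
qed

section \<open>Closure properties of small sets\<close>

lemma small_subset: "A \<subseteq> B \<Longrightarrow> small \<kappa> B \<Longrightarrow> small \<kappa> A"
  unfolding small_def by (rule ordLeq_ordLess_trans[OF card_of_mono1])

lemma small_image: "small \<kappa> A \<Longrightarrow> small \<kappa> (f ` A)"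
  unfolding small_def by (rule ordLeq_ordLess_trans[OF card_of_image])

lemma small_Un:
  assumes "Card_order \<kappa>" "infinite (Field \<kappa>)" "small \<kappa> A" "small \<kappa> B"
  shows "small \<kappa> (A \<union> B)"
  using assms unfolding small_def by (intro card_of_Un_ordLess_infinite_Field)

lemma small_finite:
  assumes "Card_order \<kappa>" "infinite (Field \<kappa>)" "finite A"
  shows "small \<kappa> A"
  using assms finite_ordLess_infinite[of "|A|" \<kappa>] card_of_Well_order
  by (auto simp: small_def card_order_on_well_order_on Field_card_of)

lemma small_Times:
  assumes "Card_order \<kappa>" "infinite (Field \<kappa>)" "small \<kappa> A" "small \<kappa> B"
  shows "small \<kappa> (A \<times> B)"
proof (cases "finite (A <+> B)")
  case True
  then have "finite (A \<times> B)" by simp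
  with assms(1,2) show ?thesis by (rule small_finite)
next
  case False
  let ?C = "A <+> B"
  have "A \<times> B \<subseteq> (\<lambda>p. (projl (fst p), projr (snd p))) ` (?C \<times> ?C)"
    by force
  moreover have "|?C \<times> ?C| =o |?C|" using False by (rule card_of_Times_same_infinite)
  moreover have "|?C| <o \<kappa>"
    using assms unfolding small_def by (intro card_of_Plus_ordLess_infinite_Field)
  ultimately show ?thesis
    by (meson small_def small_image small_subset ordIso_ordLess_trans)
qed

lemma small_nat_list: "Card_order \<kappa> \<Longrightarrow> infinite (Field \<kappa>) \<Longrightarrow> small \<kappa> (UNIV :: nat set) \<Longrightarrow> small \<kappa> (UNIV :: nat list set)"
  using small_image[of \<kappa> "UNIV :: nat set" "from_nat :: nat \<Rightarrow> nat list"] by simp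

lemma definable_restrict_cong:
  assumes "definable M (X |` F) B P" "sorted_asg M X c" "\<And>i. i \<in> F \<Longrightarrow> c i = c' i"
  shows "P c \<longleftrightarrow> P c'"
proof (rule definable_asg_cong[OF assms(1)])
  show "sorted_asg M (X |` F) c"
    using assms(2) by (simp add: sorted_asg_restrict) (simp add: sorted_asg_def)
  show "c i = c' i" if "(X |` F) i = Some s" for i s
    using that assms(3) by (auto simp: restrict_map_def split: if_splits)
qed

text \<open>Zorn's lemma for the partial assignments of values that are finitely consistent with
  \<open>\<P>\<close>. A maximal one is total: at a missing coordinate the remaining demands form a
  type in one variable over \<open>B\<close> and the values given so far. These parameters are few
  because \<open>dom X\<close> is small, so saturation supplies a further value.\<close>

theorem saturated_tuple:
  fixes M :: "('s, 'f, 'r, 'a) struc" and X :: "('i, 's) tvar"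
  assumes ne: "sorts (lang M) \<noteq> {}" "\<And>s. s \<in> sorts (lang M) \<Longrightarrow> univ M s \<noteq> {}"
    and \<kappa>: "Card_order \<kappa>" "infinite (Field \<kappa>)" and sat: "saturated \<kappa> M"
    and X: "wf_tvar M X" "small \<kappa> (dom X)" and B: "B \<subseteq> elems M" "small \<kappa> B"
    and def: "\<And>P. P \<in> \<P> \<Longrightarrow> definable M X B P"
    and fin: "fin_sat M X \<P>"
  shows "\<exists>c. sorted_asg M X c \<and> (\<forall>P\<in>\<P>. P c)"
proof -
  define R where "R f0 \<Q> c \<longleftrightarrow> sorted_asg M X c \<and> (\<forall>(i, a)\<in>f0. c i = a) \<and> (\<forall>P\<in>\<Q>. P c)"
    for f0 :: "('i \<times> 'a) set" and \<Q> :: "(('i \<Rightarrow> 'a) \<Rightarrow> bool) set" and c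
  have R_D: "sorted_asg M X c" "\<And>i a. (i, a) \<in> f0 \<Longrightarrow> c i = a" "\<And>P. P \<in> \<Q> \<Longrightarrow> P c"
    if "R f0 \<Q> c" for f0 \<Q> c
    using that by (auto simp: R_def)
  have R_I: "R f0 \<Q> c"
    if "sorted_asg M X c" "\<And>i a. (i, a) \<in> f0 \<Longrightarrow> c i = a" "\<And>P. P \<in> \<Q> \<Longrightarrow> P c"
    for f0 \<Q> c
    using that by (auto simp: R_def)
  \<comment> \<open>Functionality of \<open>f\<close> is not imposed: two values at one coordinate
    are already inconsistent for a two-element \<open>f0\<close>.\<close>
  define \<A> where "\<A> = {f. f \<subseteq> dom X \<times> UNIV \<and> (\<forall>f0 \<Q>. f0 \<subseteq> f \<and> finite f0 \<and> \<Q> \<subseteq> \<P> \<and> finite \<Q> \<longrightarrow> (\<exists>c. R f0 \<Q> c))}"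
  have Xs: "s \<in> sorts (lang M)" if "X i = Some s" for i s
    using X(1) that by (auto simp: wf_tvar_def ran_def)
  have "\<exists>f\<in>\<A>. \<forall>g\<in>\<A>. f \<subseteq> g \<longrightarrow> g = f"
  proof (rule subset_Zorn_nonempty)
    have "{} \<in> \<A>" using fin by (auto simp: \<A>_def R_def fin_sat_def)
    then show "\<A> \<noteq> {}" by blast
    fix \<C> assume \<C>: "\<C> \<noteq> {}" "subset.chain \<A> \<C>"
    then have sub: "\<C> \<subseteq> \<A>" by (auto simp: subset.chain_def)
    have "\<exists>c. R f0 \<Q> c" if f0: "f0 \<subseteq> \<Union> \<C>" "finite f0" and \<Q>: "\<Q> \<subseteq> \<P>" "finite \<Q>" for f0 \<Q>
    proof -
      obtain f where "f \<in> \<C>" "f0 \<subseteq> f"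
        using finite_subset_Union_chain[OF f0(2,1) \<C>] by blast
      then show ?thesis using sub f0(2) \<Q> unfolding \<A>_def by blast
    qed
    then show "\<Union> \<C> \<in> \<A>" using sub by (auto simp: \<A>_def)
  qed
  then obtain f where f: "f \<in> \<A>" and max: "\<And>g. g \<in> \<A> \<Longrightarrow> f \<subseteq> g \<Longrightarrow> g = f" by blast
  have f_dom: "i \<in> dom X" if "(i, a) \<in> f" for i a using f that by (auto simp: \<A>_def)
  have f_ext: "\<exists>c. R f0 \<Q> c" if "f0 \<subseteq> f" "finite f0" "\<Q> \<subseteq> \<P>" "finite \<Q>" for f0 \<Q>
    using f that by (auto simp: \<A>_def)
  have f_fun: "a = b" if ab: "(i, a) \<in> f" "(i, b) \<in> f" for i a b
  proof -
    obtain c where "R {(i, a), (i, b)} {} c"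
      using f_ext[of "{(i, a), (i, b)}" "{}"] ab by auto
    then show ?thesis by (auto simp: R_def)
  qed
  have f_sorted: "a \<in> univ M s" if ia: "(i, a) \<in> f" "X i = Some s" for i a s
  proof -
    obtain c where "R {(i, a)} {} c"
      using f_ext[of "{(i, a)}" "{}"] ia by auto
    then show ?thesis using ia by (auto simp: R_def sorted_asg_def)
  qed
  define val where "val i = (THE a. (i, a) \<in> f)" for i
  have val: "val i = a" if "(i, a) \<in> f" for i a
    unfolding val_def using that by (intro the_equality f_fun[OF _ that])
  have Range_f: "Range f \<subseteq> val ` dom X" using val f_dom by force
  have total: "i \<in> Domain f" if i: "X i = Some s" for i s
  proof (rule ccontr)
    assume nd: "i \<notin> Domain f"
    \<comment> \<open>What \<open>f0\<close> and \<open>\<Q>\<close> demand of the value at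
      \<open>i\<close> when the other coordinates are left open.\<close>
    define Q where "Q f0 \<Q> u \<longleftrightarrow> (\<exists>c. R f0 \<Q> c \<and> c i = u ())"
      for f0 :: "('i \<times> 'a) set" and \<Q> :: "(('i \<Rightarrow> 'a) \<Rightarrow> bool) set" and u :: "unit \<Rightarrow> 'a"
    define \<U> where "\<U> = {Q f0 \<Q> | f0 \<Q>. f0 \<subseteq> f \<and> finite f0 \<and> \<Q> \<subseteq> \<P> \<and> finite \<Q>}"
    let ?A = "B \<union> Range f"
    have small_A: "small \<kappa> ?A"
      using B(2) X(2) small_subset[OF Range_f] small_image by (intro small_Un \<kappa>) auto
    have A_elems: "?A \<subseteq> elems M"
      using B(1) f_dom f_sorted Xs by (force simp: elems_def)
    have def_U: "definable M (\<lambda>_. Some s) ?A U" if "U \<in> \<U>" for U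
    proof -
      obtain f0 \<Q> where U: "U = Q f0 \<Q>" and f0: "f0 \<subseteq> f" "finite f0" and \<Q>: "\<Q> \<subseteq> \<P>" "finite \<Q>"
        using \<open>U \<in> \<U>\<close> by (auto simp: \<U>_def)
      have "definable M X B (\<lambda>c. \<forall>P\<in>\<Q>. P c)"
        using \<Q> def by (intro definable_Ball ne) auto
      then obtain F B' Q' where F: "finite F" "F \<subseteq> dom X" "B' \<subseteq> B" and Q': "definable M (X |` F) B' Q'"
        "\<And>c. sorted_asg M X c \<Longrightarrow> (\<forall>P\<in>\<Q>. P c) = Q' c"
        by (rule definable_finite_support) blast
      \<comment> \<open>To be quantified: the coordinates on which \<open>Q'\<close> depends, except
        \<open>i\<close> and those that receive a value from \<open>f0\<close>.\<close>
      let ?S = "F - insert i (Domain f0)"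
      have dQ': "definable M (X |` F |` (- ?S)) B'
         (\<lambda>c. \<exists>c'. sorted_asg M (X |` F |` ?S) c' \<and> Q' (override_on c c' ?S))"
        using F by (intro definable_Ex_finite Q' ne(2) Xs) (auto simp: restrict_map_def split: if_splits)
      let ?g = "\<lambda>j. if j = i then Inl () else Inr (val j)"
      have val_f0: "(j, val j) \<in> f0" if "j \<in> Domain f0" for j
        using that val f0(1) by (metis DomainE subsetD)
      have "definable M (\<lambda>_. Some s) ?A (\<lambda>u. \<exists>c'. sorted_asg M (X |` F |` ?S) c' \<and>
          Q' (override_on (\<lambda>j. case_sum u (\<lambda>a. a) (?g j)) c' ?S))"
      proof (rule definable_subst[OF dQ'])
        show "B' \<subseteq> ?A" using F(3) by blast
        fix j t assume j: "(X |` F |` (- ?S)) j = Some t"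
        then have "X j = Some t" "j = i \<or> j \<in> Domain f0"
          by (auto simp: restrict_map_def split: if_splits)
        then show "case ?g j of Inl _ \<Rightarrow> Some s = Some t | Inr a \<Rightarrow> a \<in> ?A \<inter> univ M t"
          using i val_f0[of j] f0(1) f_sorted[of j "val j" t] by auto
      qed
      moreover have "U u = (\<exists>c'. sorted_asg M (X |` F |` ?S) c' \<and>
          Q' (override_on (\<lambda>j. case_sum u (\<lambda>a. a) (?g j)) c' ?S))" (is "_ = ?R")
        if u: "sorted_asg M (\<lambda>_. Some s) u" for u
      proof
        assume "U u"
        then obtain c where c: "R f0 \<Q> c" "c i = u ()" by (auto simp: U Q_def)
        then have Qc: "Q' c" and sc: "sorted_asg M X c" using Q'(2) by (auto simp: R_def)
        let ?ov = "override_on (\<lambda>j. case_sum u (\<lambda>a. a) (?g j)) c ?S"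
        have "Q' c \<longleftrightarrow> Q' ?ov"
        proof (rule definable_restrict_cong[OF Q'(1) sc])
          fix j assume j: "j \<in> F"
          have "c j = val j" if "j \<in> Domain f0" using c(1) val_f0[OF that] by (auto simp: R_def)
          then show "c j = ?ov j" using c(2) j by (cases "j = i") (simp_all add: override_on_def)
        qed
        with Qc have "Q' ?ov" by blast
        moreover have "sorted_asg M (X |` F |` ?S) c"
          using c(1) by (simp add: R_def sorted_asg_restrict) (simp add: sorted_asg_def restrict_map_def)
        ultimately show ?R by blast
      next
        assume ?R
        then obtain c' where c': "sorted_asg M (X |` F |` ?S) c'"
          "Q' (override_on (\<lambda>j. case_sum u (\<lambda>a. a) (?g j)) c' ?S)" by blast
        \<comment> \<open>Coordinates outside \<open>F\<close> do not matter for \<open>Q'\<close>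
          and receive any element of their sort.\<close>
        let ?c = "\<lambda>j. if j = i then u () else if j \<in> Domain f0 then val j else
          if j \<in> F then c' j else SOME a. a \<in> univ M (the (X j))"
        have "?c j \<in> univ M t" if j: "X j = Some t" for j t
        proof -
          have "(SOME a. a \<in> univ M t) \<in> univ M t" using ne(2)[OF Xs[OF j]] some_in_eq by blast
          moreover have "j \<in> Domain f0 \<Longrightarrow> val j \<in> univ M t"
            using val_f0[of j] f0(1) f_sorted j by blast
          moreover have "j \<in> ?S \<Longrightarrow> c' j \<in> univ M t"
            using c'(1) j by (auto simp: sorted_asg_def restrict_map_def)
          ultimately show ?thesis using u i j by (auto simp: sorted_asg_def)
        qed
        then have c: "sorted_asg M X ?c" by (simp add: sorted_asg_def)
        let ?ov = "override_on (\<lambda>j. case_sum u (\<lambda>a. a) (?g j)) c' ?S"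
        have "Q' ?c \<longleftrightarrow> Q' ?ov"
          by (rule definable_restrict_cong[OF Q'(1) c]) (simp add: override_on_def)
        with c'(2) have "Q' ?c" by blast
        moreover have "?c j = a" if "(j, a) \<in> f0" for j a
          using that f0(1) nd val by auto
        ultimately have "R f0 \<Q> ?c" using c Q'(2) by (auto simp: R_def)
        then show "U u" unfolding U Q_def by (intro exI[of _ ?c]) simp
      qed
      ultimately show ?thesis by (subst definable_cong)
    qed
    have "fin_sat M (\<lambda>_. Some s) \<U>"
      unfolding fin_sat_def
    proof (intro allI impI)
      fix \<V> assume \<V>: "\<V> \<subseteq> \<U>" "finite \<V>"
      then have "\<forall>V\<in>\<V>. \<exists>p. V = Q (fst p) (snd p) \<and> fst p \<subseteq> f \<and> finite (fst p) \<and> snd p \<subseteq> \<P> \<and> finite (snd p)"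
        by (force simp: \<U>_def)
      from bchoice[OF this] obtain p where p: "\<And>V. V \<in> \<V> \<Longrightarrow> V = Q (fst (p V)) (snd (p V))"
        "\<And>V. V \<in> \<V> \<Longrightarrow> fst (p V) \<subseteq> f \<and> finite (fst (p V)) \<and> snd (p V) \<subseteq> \<P> \<and> finite (snd (p V))"
        by blast
      obtain c where c: "R (\<Union>V\<in>\<V>. fst (p V)) (\<Union>V\<in>\<V>. snd (p V)) c"
        using f_ext[of "\<Union>V\<in>\<V>. fst (p V)" "\<Union>V\<in>\<V>. snd (p V)"] p(2) \<V>(2) by auto
      have "V (\<lambda>_. c i)" if "V \<in> \<V>" for V
      proof -
        have "R (fst (p V)) (snd (p V)) c" using c that by (auto simp: R_def)
        then have "Q (fst (p V)) (snd (p V)) (\<lambda>_. c i)" by (auto simp: Q_def)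
        then show ?thesis using p(1)[OF that] by metis
      qed
      moreover have "sorted_asg M (\<lambda>_. Some s) (\<lambda>_. c i)"
        using c i by (auto simp: R_def sorted_asg_def)
      ultimately show "\<exists>u. sorted_asg M (\<lambda>_. Some s) u \<and> (\<forall>V\<in>\<V>. V u)" by blast
    qed
    from saturated_unary[OF sat A_elems small_A Xs[OF i] def_U this]
    obtain u where "sorted_asg M (\<lambda>_. Some s) u \<and> (\<forall>U\<in>\<U>. U u)" by (rule exE)
    then have u: "\<And>U. U \<in> \<U> \<Longrightarrow> U u" by (rule conjunct2[THEN bspec])
    have "\<exists>c. R f0 \<Q> c" if f0: "f0 \<subseteq> insert (i, u ()) f" "finite f0" and \<Q>: "\<Q> \<subseteq> \<P>" "finite \<Q>" for f0 \<Q>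
    proof -
      have "Q (f0 - {(i, u ())}) \<Q> \<in> \<U>"
        unfolding \<U>_def mem_Collect_eq using f0 \<Q>
        by (intro exI[of _ "f0 - {(i, u ())}"] exI[of _ \<Q>]) auto
      then have "Q (f0 - {(i, u ())}) \<Q> u" by (rule u)
      then obtain c where c: "R (f0 - {(i, u ())}) \<Q> c \<and> c i = u ()" unfolding Q_def by (rule exE)
      have c_f0: "c j = a" if "(j, a) \<in> f0" for j a
      proof (cases "(j, a) = (i, u ())")
        case True
        with c show ?thesis by blast
      next
        case False
        with that have "(j, a) \<in> f0 - {(i, u ())}" by blast
        with R_D(2)[OF conjunct1[OF c]] show ?thesis .
      qed
      from R_D(1)[OF conjunct1[OF c]] c_f0 R_D(3)[OF conjunct1[OF c]] have "R f0 \<Q> c" by (rule R_I)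
      then show ?thesis by (rule exI[of _ c])
    qed
    moreover have "insert (i, u ()) f \<subseteq> dom X \<times> UNIV"
      using f_dom i by auto
    ultimately have "insert (i, u ()) f \<in> \<A>" by (simp add: \<A>_def)
    from max[OF this] nd show False by blast
  qed
  have val_in: "(i, val i) \<in> f" if "X i = Some s" for i s
    using total[OF that] val by (metis DomainE)
  then have c: "sorted_asg M X val" using f_sorted unfolding sorted_asg_def by blast
  have "P val" if P: "P \<in> \<P>" for P
  proof -
    obtain F B' Q' where F: "finite F" "F \<subseteq> dom X" and Q': "definable M (X |` F) B' Q'"
      "\<And>c. sorted_asg M X c \<Longrightarrow> P c = Q' c"
      by (rule definable_finite_support[OF def[OF P]]) blast
    \<comment> \<open>\<open>P\<close> depends only on the coordinates in \<open>F\<close>, and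
      there \<open>val\<close> agrees with an assignment that satisfies \<open>P\<close>.\<close>
    let ?f = "(\<lambda>i. (i, val i)) ` F"
    have "?f \<subseteq> f" using F(2) val_in by force
    then obtain c' where c': "R ?f {P} c'"
      using f_ext[of ?f "{P}"] F(1) P by auto
    have "Q' c'" using Q'(2)[OF R_D(1)[OF c']] R_D(3)[OF c', of P] by simp
    moreover have "Q' c' \<longleftrightarrow> Q' val"
      by (rule definable_restrict_cong[OF Q'(1) R_D(1)[OF c']], rule R_D(2)[OF c']) simp
    ultimately show ?thesis using Q'(2)[OF c] by simp
  qed
  with c show ?thesis by (intro exI[of _ val] conjI ballI)
qed

section \<open>Saturation of the structure with imaginaries\<close>

lemma eval_trm_in_univ:
  assumes "wf_struc M"
  shows "wf_trm (lang M) t \<Longrightarrow> (\<And>v. v \<in> fv_trm t \<Longrightarrow> e v \<in> univ M (fst v)) \<Longrightarrow>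
    eval_trm M e t \<in> univ M (sort_of (lang M) t)"
proof (induction t)
  case (App f ts)
  have "eval_trm M e t \<in> univ M (sort_of (lang M) t)" if "t \<in> set ts" for t
    using App that by (auto simp: list_all_iff)
  then have "map (eval_trm M e) ts \<in> ltuples M (map (sort_of (lang M)) ts)"
    by (simp add: ltuples_def list_all2_conv_all_nth)
  then show ?case using App.prems(1) assms by (auto simp: wf_struc_def)
qed simp

section \<open>Functions given by terms\<close>

definition term_function ::
  "('s, 'f, 'r, 'a) struc \<Rightarrow> ('i, 's) tvar \<Rightarrow> 's \<Rightarrow> (('i \<Rightarrow> 'a) \<Rightarrow> 'a) \<Rightarrow> bool" where
  "term_function M X s F \<longleftrightarrow> (\<exists>t \<tau>. wf_trm (lang M) t \<and> sort_of (lang M) t = s \<and>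
     (\<forall>v\<in>fv_trm t. X (\<tau> v) = Some (fst v)) \<and>
     (\<forall>c. sorted_asg M X c \<longrightarrow> F c = eval_trm M (\<lambda>v. c (\<tau> v)) t))"

lemma term_function_in_univ:
  assumes "wf_struc M" "term_function M X s F" "sorted_asg M X c"
  shows "F c \<in> univ M s"
proof -
  obtain t \<tau> where t: "wf_trm (lang M) t" "sort_of (lang M) t = s"
    "\<And>v. v \<in> fv_trm t \<Longrightarrow> X (\<tau> v) = Some (fst v)" "F c = eval_trm M (\<lambda>v. c (\<tau> v)) t"
    using assms(2,3) unfolding term_function_def by blast
  show ?thesis
    using eval_trm_in_univ[OF assms(1) t(1), of "\<lambda>v. c (\<tau> v)"] t(2-4) assms(3)
    by (auto simp: sorted_asg_def)
qed

text \<open>Terms are not substituted into \<psi>, where variables could be captured. Instead fresh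
  coordinates \<open>Inr j\<close> are required to equal the values of \<open>F j\<close> and are
  then quantified away.\<close>

lemma definable_subst_terms:
  assumes M: "wf_struc M" and \<psi>: "wf_fm (lang M) \<psi>"
    and F: "\<And>v. v \<in> fv \<psi> \<Longrightarrow> fst v = ss ! snd v \<and> term_function M X (fst v) (F (snd v))"
  shows "definable M X {} (\<lambda>c. sat M (\<lambda>v. F (snd v) c) \<psi>)"
proof -
  \<comment> \<open>By the assumption on \<open>ss\<close> an index determines the sort of its
    variable, so indices suffice to name the fresh coordinates.\<close>
  define J where "J = snd ` fv \<psi>"
  have J: "finite J" by (simp add: J_def finite_fv)
  have ss: "ss ! j \<in> sorts (lang M)" if "j \<in> J" for j
    using that F fv_sorts[OF \<psi>] by (fastforce simp: J_def)
  have Ft: "term_function M X (ss ! j) (F j)" if "j \<in> J" for j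
    using that F by (fastforce simp: J_def)
  have ne: "sorts (lang M) \<noteq> {}" "\<And>s. s \<in> sorts (lang M) \<Longrightarrow> univ M s \<noteq> {}"
    using M by (auto simp: wf_struc_def wf_language_def)
  define Z where "Z = case_sum X (\<lambda>j. if j \<in> J then Some (ss ! j) else None)"
  define P where "P z \<longleftrightarrow> (\<forall>j\<in>J. z (Inr j) = F j (\<lambda>i. z (Inl i))) \<and> sat M (\<lambda>v. z (Inr (snd v))) \<psi>"
    for z :: "'e + nat \<Rightarrow> 'd"
  let ?S = "Inr ` J :: ('e + nat) set"
  have eq: "definable M Z {} (\<lambda>z. z (Inr j) = F j (\<lambda>i. z (Inl i)))" if j: "j \<in> J" for j
  proof -
    obtain t \<tau> where t: "wf_trm (lang M) t" "sort_of (lang M) t = ss ! j"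
      "\<And>v. v \<in> fv_trm t \<Longrightarrow> X (\<tau> v) = Some (fst v)"
      "\<And>c. sorted_asg M X c \<Longrightarrow> F j c = eval_trm M (\<lambda>v. c (\<tau> v)) t"
      using Ft[OF j] unfolding term_function_def by blast
    let ?\<rho> = "\<lambda>v. (fst v, Suc (snd v))"
    let ?\<sigma> = "\<lambda>v. if snd v = 0 then Inl (Inr j) else Inl (Inl (\<tau> (fst v, snd v - 1)))"
    let ?\<psi> = "(Eq (Var (ss ! j, 0)) (rename_trm ?\<rho> t), ?\<sigma>)"
    have "?\<psi> \<in> pfms M Z {}"
      using t(1-3) ss[OF j] j
      by (auto simp: pfms_iff wf_rename_trm sort_of_rename_trm fv_rename_trm Z_def)
    moreover have "holds M ?\<psi> z \<longleftrightarrow> z (Inr j) = F j (\<lambda>i. z (Inl i))" if "sorted_asg M Z z" for z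
    proof -
      have "sorted_asg M X (\<lambda>i. z (Inl i))" using that by (auto simp: sorted_asg_def Z_def)
      from t(4)[OF this] show ?thesis
        by (simp add: holds_def eval_rename_trm comp_def)
    qed
    ultimately show ?thesis unfolding definable_def by blast
  qed
  have "(\<psi>, \<lambda>v. Inl (Inr (snd v))) \<in> pfms M Z {}"
    using \<psi> F by (auto simp: pfms_iff Z_def J_def)
  then have "definable M Z {} (\<lambda>z. sat M (\<lambda>v. z (Inr (snd v))) \<psi>)"
    using definable_holds[of "(\<psi>, \<lambda>v. Inl (Inr (snd v)))" M Z "{}"]
    by (simp add: holds_def[abs_def])
  then have "definable M Z {} P"
    unfolding P_def[abs_def] by (intro definable_conj definable_Ball ne J eq)
  then have "definable M (Z |` (- ?S)) {} (\<lambda>c. \<exists>c'. sorted_asg M (Z |` ?S) c' \<and> P (override_on c c' ?S))"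
    using J ss ne(2) by (intro definable_Ex_finite) (auto simp: Z_def)
  \<comment> \<open>The fresh coordinates are overridden, so the default value
    \<open>undefined\<close> is never read.\<close>
  then have "definable M X {}
      (\<lambda>c. \<exists>c'. sorted_asg M (Z |` ?S) c' \<and> P (override_on (\<lambda>i. c (case_sum id undefined i)) c' ?S))"
    by (rule definable_reindex) (auto simp: Z_def restrict_map_def split: sum.splits if_splits)
  moreover have "sat M (\<lambda>v. F (snd v) c) \<psi> \<longleftrightarrow>
      (\<exists>c'. sorted_asg M (Z |` ?S) c' \<and> P (override_on (\<lambda>i. c (case_sum id undefined i)) c' ?S))"
    if c: "sorted_asg M X c" for c
  proof -
    have P_iff: "P (override_on (\<lambda>i. c (case_sum id undefined i)) c' ?S) \<longleftrightarrow>
        (\<forall>j\<in>J. c' (Inr j) = F j c) \<and> sat M (\<lambda>v. c' (Inr (snd v))) \<psi>" for c'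
    proof -
      have "sat M (\<lambda>v. override_on (\<lambda>i. c (case_sum id undefined i)) c' ?S (Inr (snd v))) \<psi> \<longleftrightarrow>
          sat M (\<lambda>v. c' (Inr (snd v))) \<psi>"
        by (rule sat_cong) (auto simp: override_on_def J_def)
      then show ?thesis by (simp add: P_def override_on_def image_iff)
    qed
    have sat_iff: "sat M (\<lambda>v. c' (Inr (snd v))) \<psi> \<longleftrightarrow> sat M (\<lambda>v. F (snd v) c) \<psi>"
      if "\<forall>j\<in>J. c' (Inr j) = F j c" for c'
      by (rule sat_cong) (use that in \<open>auto simp: J_def\<close>)
    show ?thesis
    proof
      assume "sat M (\<lambda>v. F (snd v) c) \<psi>"
      moreover have "sorted_asg M (Z |` ?S) (case_sum undefined (\<lambda>j. F j c))"
        using term_function_in_univ[OF M Ft c] by (auto simp: sorted_asg_restrict Z_def)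
      ultimately show "\<exists>c'. sorted_asg M (Z |` ?S) c' \<and>
          P (override_on (\<lambda>i. c (case_sum id undefined i)) c' ?S)"
        using sat_iff[of "case_sum undefined (\<lambda>j. F j c)"]
        by (intro exI[of _ "case_sum undefined (\<lambda>j. F j c)"]) (simp add: P_iff)
    qed (use P_iff sat_iff in blast)
  qed
  ultimately show ?thesis by (subst definable_cong)
qed

section \<open>Coding imaginaries by real tuples\<close>

definition real_tvar :: "('i, ('s, 'f, 'r) eqsort) tvar \<Rightarrow> ('i \<times> nat, 's) tvar" where
  "real_tvar X = (\<lambda>(i, j). case X i of None \<Rightarrow> None
     | Some (Home s) \<Rightarrow> if j = 0 then Some s else None
     | Some (Quot ss \<phi>) \<Rightarrow> if j < length ss then Some (ss ! j) else None)"

text \<open>An imaginary is coded by any representative of its class, one place per entry; a real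
  element uses place 0 only.\<close>

definition to_eq :: "('s, 'f, 'r, 'a) struc \<Rightarrow> ('i, ('s, 'f, 'r) eqsort) tvar
    \<Rightarrow> ('i \<times> nat \<Rightarrow> 'a) \<Rightarrow> 'i \<Rightarrow> ('s, 'f, 'r, 'a) eqelem" where
  "to_eq M X c i = (case X i of None \<Rightarrow> undefined | Some (Home s) \<Rightarrow> Real (c (i, 0))
     | Some (Quot ss \<phi>) \<Rightarrow> Imag ss \<phi> (eqrel M ss \<phi> `` {map (\<lambda>j. c (i, j)) [0..<length ss]}))"

text \<open>A section of \<open>to_eq\<close>: through it, parameters and realizations with
  imaginaries are coded by real elements.\<close>

fun representative :: "('s, 'f, 'r, 'a) eqelem \<Rightarrow> 'a list" where
  "representative (Real a) = [a]"
| "representative (Imag ss \<phi> C) = (SOME as. as \<in> C)"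

text \<open>No function symbol takes an argument of a quotient sort. So a term of a home sort
  contains neither \<open>Proj\<close> nor variables of quotient sorts, and the missing cases never
  matter for it.\<close>

fun real_trm :: "(('s, 'f, 'r) eqsort, ('s, 'f, 'r) eqfun) trm \<Rightarrow> ('s, 'f) trm" where
  "real_trm (Var v) = Var (case fst v of Home s \<Rightarrow> s, snd v)"
| "real_trm (App f ts) = App (case f of Old g \<Rightarrow> g) (map real_trm ts)"

lemma sorts_eq_lang [simp]:
  "Home s \<in> sorts (eq_lang M) \<longleftrightarrow> s \<in> sorts (lang M)"
  "Quot ss \<phi> \<in> sorts (eq_lang M) \<longleftrightarrow> defines_eqrel M ss \<phi>"
  by (auto simp: eq_lang_def)

lemma univ_eq_struc [simp]:
  "univ (eq_struc M) (Home s) = Real ` univ M s"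
  "univ (eq_struc M) (Quot ss \<phi>) = Imag ss \<phi> ` (ltuples M ss // eqrel M ss \<phi>)"
  by (simp_all add: eq_struc_def)

lemma lang_eq_struc [simp]: "lang (eq_struc M) = eq_lang M"
  by (simp add: eq_struc_def)

lemma representative_Quot:
  assumes \<phi>: "defines_eqrel M ss \<phi>" and C: "C \<in> ltuples M ss // eqrel M ss \<phi>"
  shows "representative (Imag ss \<phi> C) \<in> ltuples M ss"
    "C = eqrel M ss \<phi> `` {representative (Imag ss \<phi> C)}"
proof -
  have eq: "equiv (ltuples M ss) (eqrel M ss \<phi>)" using \<phi> by (simp add: defines_eqrel_def)
  have "C \<noteq> {}" using in_quotient_imp_non_empty[OF eq C] .
  then have r: "representative (Imag ss \<phi> C) \<in> C" by (simp add: some_in_eq)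
  then show "representative (Imag ss \<phi> C) \<in> ltuples M ss"
    using in_quotient_imp_subset[OF eq C] by blast
  obtain as where as: "C = eqrel M ss \<phi> `` {as}" using C by (rule quotientE)
  show "C = eqrel M ss \<phi> `` {representative (Imag ss \<phi> C)}"
    using r eq as by (metis Image_singleton_iff equiv_class_eq)
qed

lemma to_eq_in_univ:
  assumes "X i = Some s" "\<And>j t. real_tvar X (i, j) = Some t \<Longrightarrow> c (i, j) \<in> univ M t"
  shows "to_eq M X c i \<in> univ (eq_struc M) s"
proof (cases s)
  case (Home t)
  then show ?thesis using assms by (simp add: to_eq_def real_tvar_def)
next
  case (Quot ss \<phi>)
  then have "map (\<lambda>j. c (i, j)) [0..<length ss] \<in> ltuples M ss"
    using assms by (simp add: ltuples_def list_all2_conv_all_nth real_tvar_def)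
  then show ?thesis using Quot assms by (simp add: to_eq_def quotientI)
qed

lemma to_eq_representative:
  assumes "X i = Some s" "s \<in> sorts (eq_lang M)" "a \<in> univ (eq_struc M) s"
    and "\<And>j t. real_tvar X (i, j) = Some t \<Longrightarrow> c (i, j) = representative a ! j"
  shows "to_eq M X c i = a"
proof (cases s)
  case (Home t)
  then show ?thesis using assms by (auto simp: to_eq_def real_tvar_def)
next
  case (Quot ss \<phi>)
  then obtain C where C: "C \<in> ltuples M ss // eqrel M ss \<phi>" "a = Imag ss \<phi> C"
    using assms(3) by auto
  note r = representative_Quot[of M ss \<phi> C]
  have "length (representative a) = length ss"
    using r(1) C Quot assms(2) by (auto simp: ltuples_def list_all2_lengthD)
  then have "map (\<lambda>j. c (i, j)) [0..<length ss] = representative a"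
    using assms(1,4) Quot by (intro nth_equalityI) (auto simp: real_tvar_def)
  then show ?thesis using r(2) C Quot assms(1,2) by (simp add: to_eq_def)
qed

lemma representative_in_univ:
  assumes "X i = Some s" "s \<in> sorts (eq_lang M)" "a \<in> univ (eq_struc M) s"
    "real_tvar X (i, j) = Some t"
  shows "representative a ! j \<in> univ M t" "representative a ! j \<in> set (representative a)"
proof -
  have "representative a ! j \<in> univ M t \<and> j < length (representative a)"
  proof (cases s)
    case (Home t)
    then show ?thesis using assms by (auto simp: real_tvar_def split: if_splits)
  next
    case (Quot ss \<phi>)
    then obtain C where C: "C \<in> ltuples M ss // eqrel M ss \<phi>" "a = Imag ss \<phi> C"
      using assms(3) by auto
    then have "representative a \<in> ltuples M ss"
      using representative_Quot(1)[of M ss \<phi> C] Quot assms(2) by simp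
    then show ?thesis using Quot assms(1,4)
      by (auto simp: real_tvar_def ltuples_def list_all2_conv_all_nth split: if_splits)
  qed
  then show "representative a ! j \<in> univ M t" "representative a ! j \<in> set (representative a)"
    by auto
qed

lemma interp_eq_struc [simp]:
  "fint (eq_struc M) (Old g) xs = Real (fint M g (map un_real xs))"
  "fint (eq_struc M) (Proj ss \<phi>) xs = Imag ss \<phi> (eqrel M ss \<phi> `` {map un_real xs})"
  "rint (eq_struc M) r xs = rint M r (map un_real xs)"
  by (simp_all add: eq_struc_def)

lemma to_eq_cong:
  assumes "\<And>j t. real_tvar X (i, j) = Some t \<Longrightarrow> c (i, j) = c' (i, j)"
  shows "to_eq M X c i = to_eq M X c' i"
proof (cases "X i")
  case (Some s)
  show ?thesis
  proof (cases s)
    case (Home t)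
    then show ?thesis using Some assms by (simp add: to_eq_def real_tvar_def)
  next
    case (Quot ss \<phi>)
    have "map (\<lambda>j. c (i, j)) [0..<length ss] = map (\<lambda>j. c' (i, j)) [0..<length ss]"
      using Some Quot assms by (intro map_cong refl) (auto simp: real_tvar_def)
    then show ?thesis using Some Quot by (simp only: to_eq_def option.case eqsort.case)
  qed
qed (simp add: to_eq_def)

text \<open>The variables themselves name the coded objects, so that a formula can be translated
  before its variables are attached to coordinates and parameters.\<close>

definition eq_asg :: "('s, 'f, 'r, 'a) struc \<Rightarrow> (('s, 'f, 'r) eqsort var \<times> nat \<Rightarrow> 'a)
    \<Rightarrow> ('s, 'f, 'r) eqsort var \<Rightarrow> ('s, 'f, 'r, 'a) eqelem" where
  "eq_asg M = to_eq M (\<lambda>v. Some (fst v))"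

definition var_tvar :: "('s, 'f, 'r) eqsort var set \<Rightarrow> (('s, 'f, 'r) eqsort var \<times> nat, 's) tvar" where
  "var_tvar W = real_tvar (\<lambda>v. if v \<in> W then Some (fst v) else None)"

lemma var_tvar_mono: "W \<subseteq> W' \<Longrightarrow> var_tvar W \<subseteq>\<^sub>m var_tvar W'"
  by (auto simp: var_tvar_def real_tvar_def map_le_def dom_def)

lemma real_trm_Home:
  assumes "wf_trm (eq_lang M) t" "sort_of (eq_lang M) t = Home s"
  shows "wf_trm (lang M) (real_trm t) \<and> sort_of (lang M) (real_trm t) = s \<and>
    (\<forall>v\<in>fv_trm (real_trm t). (Home (fst v), snd v) \<in> fv_trm t) \<and>
    eval_trm (eq_struc M) (eq_asg M c) t =
      Real (eval_trm M (\<lambda>v. c ((Home (fst v), snd v), 0)) (real_trm t))"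
  using assms
proof (induction t arbitrary: s)
  case (Var v)
  then show ?case by (cases v) (auto simp: eq_asg_def to_eq_def)
next
  case (App f ts)
  obtain g where f: "f = Old g" and g: "g \<in> funs (lang M)" "fres (lang M) g = s"
    using App.prems by (auto simp: eq_lang_def)
  have args: "map (sort_of (eq_lang M)) ts = map Home (fargs (lang M) g)"
    and wf: "\<And>t. t \<in> set ts \<Longrightarrow> wf_trm (eq_lang M) t"
    using App.prems f by (auto simp: eq_lang_def list_all_iff)
  have len: "length ts = length (fargs (lang M) g)" using arg_cong[OF args, of length] by simp
  have srt: "sort_of (eq_lang M) (ts ! i) = Home (fargs (lang M) g ! i)" if "i < length ts" for i
    using arg_cong[OF args, of "\<lambda>l. l ! i"] that len by simp
  note IH = App.IH[OF nth_mem wf[OF nth_mem] srt]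
  have "map (sort_of (lang M)) (map real_trm ts) = fargs (lang M) g"
    using IH len by (intro nth_equalityI) auto
  moreover have "list_all (wf_trm (lang M)) (map real_trm ts)"
    using IH by (simp add: list_all_length)
  moreover have "fint M g (map (un_real \<circ> eval_trm (eq_struc M) (eq_asg M c)) ts) =
      fint M g (map (eval_trm M (\<lambda>v. c ((Home (fst v), snd v), 0)) \<circ> real_trm) ts)"
    by (intro arg_cong[where f="fint M g"] nth_equalityI) (use IH in auto)
  moreover have "\<forall>t\<in>set ts. \<forall>v\<in>fv_trm (real_trm t). (Home (fst v), snd v) \<in> fv_trm t"
  proof
    fix t assume "t \<in> set ts"
    then obtain i where "i < length ts" "t = ts ! i" by (auto simp: in_set_conv_nth)
    then show "\<forall>v\<in>fv_trm (real_trm t). (Home (fst v), snd v) \<in> fv_trm t"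
      using IH[of i] by blast
  qed
  ultimately show ?case
    using g by (simp add: f comp_def) blast
qed

lemma real_trm_function:
  assumes "wf_trm (eq_lang M) t" "sort_of (eq_lang M) t = Home s"
  shows "term_function M (var_tvar (fv_trm t)) s
     (\<lambda>c. eval_trm M (\<lambda>v. c ((Home (fst v), snd v), 0)) (real_trm t))"
  unfolding term_function_def
proof (intro exI conjI ballI allI impI)
  note rt = real_trm_Home[OF assms, of undefined]
  show "wf_trm (lang M) (real_trm t)" "sort_of (lang M) (real_trm t) = s"
    using rt by blast+
  fix v assume "v \<in> fv_trm (real_trm t)"
  then have "(Home (fst v), snd v) \<in> fv_trm t" using rt by blast
  then show "var_tvar (fv_trm t) ((Home (fst v), snd v), 0) = Some (fst v)"
    by (simp add: var_tvar_def real_tvar_def)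
qed (rule refl)

lemma term_function_mono:
  assumes "term_function M X s F" "X \<subseteq>\<^sub>m X'"
  shows "term_function M X' s F"
proof -
  obtain t \<tau> where t: "wf_trm (lang M) t" "sort_of (lang M) t = s"
    "\<forall>v\<in>fv_trm t. X (\<tau> v) = Some (fst v)"
    "\<forall>c. sorted_asg M X c \<longrightarrow> F c = eval_trm M (\<lambda>v. c (\<tau> v)) t"
    using assms(1) unfolding term_function_def by blast
  have "\<forall>v\<in>fv_trm t. X' (\<tau> v) = Some (fst v)"
    using t(3) assms(2) by (auto simp: map_le_def dom_def)
  then show ?thesis
    unfolding term_function_def using t sorted_asg_mono[OF assms(2)] by blast
qed

text \<open>As arguments are always of home sorts, such a term is a variable or one projection
  applied to home terms. \<open>F j\<close> is the j-th entry of the representative, either a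
  coordinate of the code or a real term.\<close>

lemma real_trm_Quot:
  assumes "wf_trm (eq_lang M) t" "sort_of (eq_lang M) t = Quot ss \<phi>"
  obtains F where "\<And>j. j < length ss \<Longrightarrow> term_function M (var_tvar (fv_trm t)) (ss ! j) (F j)"
    "\<And>c. eval_trm (eq_struc M) (eq_asg M c) t =
       Imag ss \<phi> (eqrel M ss \<phi> `` {map (\<lambda>j. F j c) [0..<length ss]})"
    "defines_eqrel M ss \<phi>"
proof (cases t)
  case (Var v)
  then have v: "fst v = Quot ss \<phi>" and eqr: "defines_eqrel M ss \<phi>"
    using assms by (cases v; auto)+
  have "set ss \<subseteq> sorts (lang M)" using eqr by (simp add: defines_eqrel_def)
  then have "term_function M (var_tvar (fv_trm t)) (ss ! j) (\<lambda>c. c (v, j))" if "j < length ss" for j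
    unfolding term_function_def using that v Var
    by (intro exI[of _ "trm.Var (ss ! j, 0)"] exI[of _ "\<lambda>_. (v, j)"])
      (auto simp: var_tvar_def real_tvar_def)
  moreover have "eval_trm (eq_struc M) (eq_asg M c) t =
       Imag ss \<phi> (eqrel M ss \<phi> `` {map (\<lambda>j. c (v, j)) [0..<length ss]})" for c
    using v Var by (simp add: eq_asg_def to_eq_def)
  ultimately show ?thesis using eqr by (rule that[where F="\<lambda>j c. c (v, j)"])
next
  case (App f ts)
  then have f: "f = Proj ss \<phi>" and eqr: "defines_eqrel M ss \<phi>"
    and args: "map (sort_of (eq_lang M)) ts = map Home ss"
    and wf: "\<And>t. t \<in> set ts \<Longrightarrow> wf_trm (eq_lang M) t"
    using assms by (auto simp: eq_lang_def list_all_iff)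
  have len: "length ts = length ss" using arg_cong[OF args, of length] by simp
  have srt: "sort_of (eq_lang M) (ts ! j) = Home (ss ! j)" if "j < length ts" for j
    using arg_cong[OF args, of "\<lambda>l. l ! j"] that len by simp
  let ?F = "\<lambda>j c. eval_trm M (\<lambda>v. c ((Home (fst v), snd v), 0)) (real_trm (ts ! j))"
  have "term_function M (var_tvar (fv_trm t)) (ss ! j) (?F j)" if j: "j < length ss" for j
  proof (rule term_function_mono)
    show "term_function M (var_tvar (fv_trm (ts ! j))) (ss ! j) (?F j)"
      using j len by (intro real_trm_function wf srt) auto
    show "var_tvar (fv_trm (ts ! j)) \<subseteq>\<^sub>m var_tvar (fv_trm t)"
      using j len by (intro var_tvar_mono) (auto simp: App intro!: bexI[of _ "ts ! j"])
  qed
  moreover have "eval_trm (eq_struc M) (eq_asg M c) t =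
       Imag ss \<phi> (eqrel M ss \<phi> `` {map (\<lambda>j. ?F j c) [0..<length ss]})" for c
  proof -
    have "map un_real (map (eval_trm (eq_struc M) (eq_asg M c)) ts) = map (\<lambda>j. ?F j c) [0..<length ss]"
      using len real_trm_Home[OF wf[OF nth_mem] srt] by (intro nth_equalityI) auto
    then show ?thesis by (simp add: App f)
  qed
  ultimately show ?thesis using eqr by (rule that)
qed

text \<open>Two classes modulo \<phi> are equal iff \<phi> holds between representatives, so an
  equation in a quotient sort translates into \<phi> with the entries put in.\<close>

lemma definable_eq_struc_Eq:
  assumes M: "wf_struc M" and wf: "wf_fm (eq_lang M) (Eq t u)"
  shows "definable M (var_tvar (fv_trm t \<union> fv_trm u)) {} (\<lambda>c. sat (eq_struc M) (eq_asg M c) (Eq t u))"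
proof -
  let ?V = "var_tvar (fv_trm t \<union> fv_trm u)"
  have mono: "var_tvar (fv_trm t) \<subseteq>\<^sub>m ?V" "var_tvar (fv_trm u) \<subseteq>\<^sub>m ?V"
    by (simp_all add: var_tvar_mono)
  show ?thesis
  proof (cases "sort_of (eq_lang M) t")
    case (Home s)
    then have s: "sort_of (eq_lang M) u = Home s" using wf by simp
    have wft: "wf_trm (eq_lang M) t" "wf_trm (eq_lang M) u" using wf by auto
    note rt = real_trm_Home[OF wft(1) Home] and ru = real_trm_Home[OF wft(2) s]
    let ?\<psi> = "(Eq (real_trm t) (real_trm u), \<lambda>v. Inl ((Home (fst v), snd v), 0))"
    have "?\<psi> \<in> pfms M ?V {}"
      using rt ru by (auto simp: pfms_iff var_tvar_def real_tvar_def)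
    moreover have "sat (eq_struc M) (eq_asg M c) (Eq t u) \<longleftrightarrow> holds M ?\<psi> c" for c
      using rt ru by (simp add: holds_def)
    ultimately show ?thesis unfolding definable_def by blast
  next
    case (Quot ss \<phi>)
    then have s: "sort_of (eq_lang M) u = Quot ss \<phi>" using wf by simp
    have wft: "wf_trm (eq_lang M) t" "wf_trm (eq_lang M) u" using wf by auto
    obtain F where F: "\<And>j. j < length ss \<Longrightarrow> term_function M (var_tvar (fv_trm t)) (ss ! j) (F j)"
      "\<And>c. eval_trm (eq_struc M) (eq_asg M c) t =
         Imag ss \<phi> (eqrel M ss \<phi> `` {map (\<lambda>j. F j c) [0..<length ss]})"
      and eqr: "defines_eqrel M ss \<phi>"
      using real_trm_Quot[OF wft(1) Quot] by metis
    obtain F' where F': "\<And>j. j < length ss \<Longrightarrow> term_function M (var_tvar (fv_trm u)) (ss ! j) (F' j)"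
      "\<And>c. eval_trm (eq_struc M) (eq_asg M c) u =
         Imag ss \<phi> (eqrel M ss \<phi> `` {map (\<lambda>j. F' j c) [0..<length ss]})"
      using real_trm_Quot[OF wft(2) s] by metis
    let ?n = "length ss"
    \<comment> \<open>Variables of \<phi> with an index below \<open>length ss\<close> belong to the
      first representative, the others to the second.\<close>
    let ?K = "\<lambda>k. if k < ?n then F k else F' (k - ?n)"
    have fv\<phi>: "fst v = (ss @ ss) ! snd v \<and> snd v < 2 * ?n" if "v \<in> fv \<phi>" for v
      using eqr that by (auto simp: defines_eqrel_def)
    have "definable M ?V {} (\<lambda>c. sat M (\<lambda>v. ?K (snd v) c) \<phi>)"
    proof (rule definable_subst_terms[OF M, where ss="ss @ ss"])
      show "wf_fm (lang M) \<phi>" using eqr by (simp add: defines_eqrel_def)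
      fix v assume v: "v \<in> fv \<phi>"
      note Ft = term_function_mono[OF F(1) mono(1)] term_function_mono[OF F'(1) mono(2)]
      show "fst v = (ss @ ss) ! snd v \<and> term_function M ?V (fst v) (?K (snd v))"
        using fv\<phi>[OF v] Ft by (auto simp: nth_append)
    qed
    moreover have "sat (eq_struc M) (eq_asg M c) (Eq t u) \<longleftrightarrow> sat M (\<lambda>v. ?K (snd v) c) \<phi>"
      if c: "sorted_asg M ?V c" for c
    proof -
      let ?as = "map (\<lambda>j. F j c) [0..<?n]" and ?bs = "map (\<lambda>j. F' j c) [0..<?n]"
      have "?as \<in> ltuples M ss" "?bs \<in> ltuples M ss"
        using term_function_in_univ[OF M term_function_mono[OF F(1) mono(1)] c]
          term_function_in_univ[OF M term_function_mono[OF F'(1) mono(2)] c]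
        by (auto simp: ltuples_def list_all2_conv_all_nth)
      moreover from this have "sat (eq_struc M) (eq_asg M c) (Eq t u) \<longleftrightarrow> (?as, ?bs) \<in> eqrel M ss \<phi>"
        using eqr eq_equiv_class_iff[of "ltuples M ss" "eqrel M ss \<phi>" ?as ?bs]
        by (simp add: F(2) F'(2) defines_eqrel_def)
      moreover have "sat M (\<lambda>v. (?as @ ?bs) ! snd v) \<phi> \<longleftrightarrow> sat M (\<lambda>v. ?K (snd v) c) \<phi>"
        by (rule sat_cong) (use fv\<phi> in \<open>force simp: nth_append\<close>)
      ultimately show ?thesis by (simp add: eqrel_def)
    qed
    ultimately show ?thesis by (subst definable_cong)
  qed
qed

text \<open>Induction on the formula. A quantifier over a quotient sort turns into finitely many
  quantifiers over the entries of a representative.\<close>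

lemma definable_eq_struc_fm:
  assumes M: "wf_struc M"
  shows "wf_fm (eq_lang M) \<phi> \<Longrightarrow>
    definable M (var_tvar (fv \<phi>)) {} (\<lambda>c. sat (eq_struc M) (eq_asg M c) \<phi>)"
proof (induction \<phi>)
  case (Eq t u)
  then show ?case using definable_eq_struc_Eq[OF M Eq] by (simp only: fv.simps)
next
  case (Rel r ts)
  then have r: "r \<in> rels (lang M)"
    and args: "map (sort_of (eq_lang M)) ts = map Home (rargs (lang M) r)"
    and wf: "\<And>t. t \<in> set ts \<Longrightarrow> wf_trm (eq_lang M) t"
    by (auto simp: eq_lang_def list_all_iff)
  have len: "length ts = length (rargs (lang M) r)" using arg_cong[OF args, of length] by simp
  have srt: "sort_of (eq_lang M) (ts ! i) = Home (rargs (lang M) r ! i)" if "i < length ts" for i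
    using arg_cong[OF args, of "\<lambda>l. l ! i"] that len by simp
  note rt = real_trm_Home[OF wf[OF nth_mem] srt]
  let ?\<psi> = "(Rel r (map real_trm ts), \<lambda>v. Inl ((Home (fst v), snd v), 0))"
  have "\<forall>t\<in>set ts. \<forall>v\<in>fv_trm (real_trm t). (Home (fst v), snd v) \<in> fv_trm t"
  proof
    fix t assume "t \<in> set ts"
    then obtain i where "i < length ts" "t = ts ! i" by (auto simp: in_set_conv_nth)
    then show "\<forall>v\<in>fv_trm (real_trm t). (Home (fst v), snd v) \<in> fv_trm t"
      using rt[of i] by blast
  qed
  moreover have "map (sort_of (lang M)) (map real_trm ts) = rargs (lang M) r"
    using rt len by (intro nth_equalityI) auto
  moreover have "list_all (wf_trm (lang M)) (map real_trm ts)"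
    using rt by (simp add: list_all_length)
  ultimately have "?\<psi> \<in> pfms M (var_tvar (fv (Rel r ts))) {}"
    using r by (simp add: pfms_iff var_tvar_def real_tvar_def) blast
  moreover have "sat (eq_struc M) (eq_asg M c) (Rel r ts) \<longleftrightarrow> holds M ?\<psi> c" for c
  proof -
    have "rint M r (map (un_real \<circ> eval_trm (eq_struc M) (eq_asg M c)) ts) =
        rint M r (map (eval_trm M (\<lambda>v. c ((Home (fst v), snd v), 0)) \<circ> real_trm) ts)"
      by (intro arg_cong[where f="rint M r"] nth_equalityI) (use rt in auto)
    then show ?thesis by (simp add: holds_def comp_def)
  qed
  ultimately show ?case unfolding definable_def by blast
next
  case (Neg \<phi>)
  then show ?case using definable_not by force
next
  case (And \<phi>1 \<phi>2)
  have "definable M (var_tvar (fv (And \<phi>1 \<phi>2))) {} (\<lambda>c. sat (eq_struc M) (eq_asg M c) \<phi>1)"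
    using And by (intro definable_mono[OF And.IH(1)] var_tvar_mono) auto
  moreover have "definable M (var_tvar (fv (And \<phi>1 \<phi>2))) {} (\<lambda>c. sat (eq_struc M) (eq_asg M c) \<phi>2)"
    using And by (intro definable_mono[OF And.IH(2)] var_tvar_mono) auto
  ultimately show ?case by (auto dest: definable_conj)
next
  case (Ex v \<phi>)
  let ?W = "insert v (fv \<phi>)"
  \<comment> \<open>The places that code the quantified variable.\<close>
  let ?S = "{p \<in> dom (var_tvar ?W). fst p = v}"
  let ?P = "\<lambda>c. sat (eq_struc M) (eq_asg M c) \<phi>"
  have v: "fst v \<in> sorts (eq_lang M)" using Ex.prems by simp
  have ne: "sorts (lang M) \<noteq> {}" "\<And>s. s \<in> sorts (lang M) \<Longrightarrow> univ M s \<noteq> {}"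
    using M by (auto simp: wf_struc_def wf_language_def)
  have sub: "set ss \<subseteq> sorts (lang M)" if "fst v = Quot ss \<chi>" for ss \<chi>
    using v that by (simp add: defines_eqrel_def)
  have finS: "finite ?S"
  proof (cases "fst v")
    case (Home s)
    then have "?S \<subseteq> {(v, 0)}" by (auto simp: var_tvar_def real_tvar_def split: if_splits)
    then show ?thesis by (rule finite_subset) simp
  next
    case (Quot ss \<chi>)
    then have "?S \<subseteq> {v} \<times> {..<length ss}" by (auto simp: var_tvar_def real_tvar_def split: if_splits)
    then show ?thesis by (rule finite_subset) simp
  qed
  have "definable M (var_tvar ?W) {} ?P"
    using Ex by (intro definable_mono[OF Ex.IH] var_tvar_mono) auto
  then have "definable M (var_tvar ?W |` (- ?S)) {}
      (\<lambda>c. \<exists>c'. sorted_asg M (var_tvar ?W |` ?S) c' \<and> ?P (override_on c c' ?S))"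
  proof (rule definable_Ex_finite[OF _ finS])
    fix p s assume p: "p \<in> ?S" "var_tvar ?W p = Some s"
    then obtain j where "p = (v, j)" by (cases p) auto
    then have "s \<in> sorts (lang M)"
      using p(2) v sub by (cases "fst v") (auto simp: var_tvar_def real_tvar_def split: if_splits)
    then show "univ M s \<noteq> {}" by (rule ne(2))
  qed auto
  moreover have "var_tvar ?W |` (- ?S) \<subseteq>\<^sub>m var_tvar (fv (Ex v \<phi>))"
    by (auto simp: map_le_def var_tvar_def real_tvar_def restrict_map_def split: if_splits)
  ultimately have "definable M (var_tvar (fv (Ex v \<phi>))) {}
      (\<lambda>c. \<exists>c'. sorted_asg M (var_tvar ?W |` ?S) c' \<and> ?P (override_on c c' ?S))"
    by (rule definable_mono) simp
  moreover have "(\<exists>c'. sorted_asg M (var_tvar ?W |` ?S) c' \<and> ?P (override_on c c' ?S)) \<longleftrightarrow>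
      sat (eq_struc M) (eq_asg M c) (Ex v \<phi>)" for c
  proof -
    have upd: "eq_asg M (override_on c c' ?S) = (eq_asg M c)(v := eq_asg M c' v)" for c'
    proof
      fix w
      show "eq_asg M (override_on c c' ?S) w = ((eq_asg M c)(v := eq_asg M c' v)) w"
      proof (cases "w = v")
        case True
        have "to_eq M (\<lambda>v. Some (fst v)) (override_on c c' ?S) v = to_eq M (\<lambda>v. Some (fst v)) c' v"
        proof (rule to_eq_cong)
          fix j t assume "real_tvar (\<lambda>v. Some (fst v)) (v, j) = Some t"
          then have "(v, j) \<in> ?S" by (auto simp: var_tvar_def real_tvar_def)
          then show "override_on c c' ?S (v, j) = c' (v, j)" by (rule override_on_apply_in)
        qed
        with True show ?thesis by (simp add: eq_asg_def)
      next
        case False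
        then have "to_eq M (\<lambda>v. Some (fst v)) (override_on c c' ?S) w = to_eq M (\<lambda>v. Some (fst v)) c w"
          by (intro to_eq_cong override_on_apply_notin) auto
        with False show ?thesis by (simp add: eq_asg_def)
      qed
    qed
    have key: "var_tvar ?W (v, j) = real_tvar (\<lambda>v. Some (fst v)) (v, j)" for j
      by (simp add: var_tvar_def real_tvar_def)
    have "sorted_asg M (var_tvar ?W |` ?S) c' \<longleftrightarrow>
        (\<forall>j t. real_tvar (\<lambda>v. Some (fst v)) (v, j) = Some t \<longrightarrow> c' (v, j) \<in> univ M t)" for c'
    proof -
      have "(\<forall>p\<in>?S. \<forall>t. var_tvar ?W p = Some t \<longrightarrow> c' p \<in> univ M t) \<longleftrightarrow>
          (\<forall>j t. var_tvar ?W (v, j) = Some t \<longrightarrow> c' (v, j) \<in> univ M t)" (is "?L \<longleftrightarrow> ?R")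
      proof (intro iffI allI impI ballI)
        fix j t assume ?L "var_tvar ?W (v, j) = Some t"
        moreover from this(2) have "(v, j) \<in> ?S" by (simp add: domI)
        ultimately show "c' (v, j) \<in> univ M t" by blast
      next
        fix p t assume ?R "p \<in> ?S" "var_tvar ?W p = Some t"
        then show "c' p \<in> univ M t" by (cases p) simp
      qed
      then show ?thesis by (simp only: sorted_asg_restrict key)
    qed
    note srt = this
    \<comment> \<open>Quantifying over codes is the same as quantifying over the sort: each
      well-sorted code gives an element, and each element has a representative.\<close>
    have "{eq_asg M c' v | c'. sorted_asg M (var_tvar ?W |` ?S) c'} = univ (eq_struc M) (fst v)"
    proof (intro equalityI subsetI)
      fix a assume "a \<in> {eq_asg M c' v | c'. sorted_asg M (var_tvar ?W |` ?S) c'}"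
      then obtain c' where a: "a = eq_asg M c' v" and c': "sorted_asg M (var_tvar ?W |` ?S) c'" by blast
      show "a \<in> univ (eq_struc M) (fst v)"
        unfolding a eq_asg_def using c' srt[of c'] by (intro to_eq_in_univ) simp_all
    next
      fix a assume a: "a \<in> univ (eq_struc M) (fst v)"
      let ?c = "\<lambda>p. representative a ! snd p"
      have "eq_asg M ?c v = a"
        unfolding eq_asg_def by (rule to_eq_representative[OF _ v a]) auto
      moreover have "sorted_asg M (var_tvar ?W |` ?S) ?c"
        unfolding srt snd_conv
        using representative_in_univ(1)[where X="\<lambda>v. Some (fst v)" and i=v, OF refl v a] by blast
      ultimately show "a \<in> {eq_asg M c' v | c'. sorted_asg M (var_tvar ?W |` ?S) c'}"
        unfolding mem_Collect_eq by (intro exI[of _ ?c]) simp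
    qed
    then have "sat (eq_struc M) (eq_asg M c) (Ex v \<phi>) \<longleftrightarrow>
        (\<exists>a\<in>{eq_asg M c' v | c'. sorted_asg M (var_tvar ?W |` ?S) c'}.
          sat (eq_struc M) ((eq_asg M c)(v := a)) \<phi>)"
      by (simp only: sat.simps)
    then show ?thesis unfolding upd by blast
  qed
  ultimately show ?case by (subst definable_cong[symmetric])
qed

text \<open>The variables of the translated formula are now attached: a coordinate of
  \<open>X\<close> to its block of places, a parameter to the entries of its representative.\<close>

lemma definable_pull_back:
  assumes M: "wf_struc M" and X: "wf_tvar (eq_struc M) X"
    and P: "definable (eq_struc M) X B P"
  shows "definable M (real_tvar X) (\<Union>b\<in>B. set (representative b)) (\<lambda>c. P (to_eq M X c))"
proof -
  obtain \<phi> \<sigma> where \<psi>: "(\<phi>, \<sigma>) \<in> pfms (eq_struc M) X B"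
    "\<And>c. sorted_asg (eq_struc M) X c \<Longrightarrow> P c = holds (eq_struc M) (\<phi>, \<sigma>) c"
    using P by (auto simp: definable_def)
  have wf: "wf_fm (eq_lang M) \<phi>" using \<psi>(1) by (simp add: pfms_iff)
  let ?B = "\<Union>b\<in>B. set (representative b)"
  define f where "f p = (case \<sigma> (fst p) of Inl i \<Rightarrow> Inl (i, snd p) | Inr a \<Rightarrow> Inr (representative a ! snd p))"
    for p
  have sorts: "fst v \<in> sorts (eq_lang M)" if "v \<in> fv \<phi>" for v using fv_sorts[OF wf that] .
  have var: "v \<in> fv \<phi>" "real_tvar (\<lambda>v. Some (fst v)) (v, j) = Some s"
    if "var_tvar (fv \<phi>) (v, j) = Some s" for v j s
    using that by (auto simp: var_tvar_def real_tvar_def split: if_splits)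
  have "definable M (real_tvar X) ?B
      (\<lambda>c. sat (eq_struc M) (eq_asg M (\<lambda>p. case_sum c (\<lambda>a. a) (f p))) \<phi>)"
  proof (rule definable_subst[OF definable_eq_struc_fm[OF M wf]])
    fix p s assume p: "var_tvar (fv \<phi>) p = Some s"
    obtain v j where vj: "p = (v, j)" by (cases p) auto
    note v = var[OF p[unfolded vj]]
    show "case f p of Inl q \<Rightarrow> real_tvar X q = Some s | Inr a \<Rightarrow> a \<in> ?B \<inter> univ M s"
    proof (cases "\<sigma> v")
      case (Inl i)
      then have "X i = Some (fst v)" using \<psi>(1) v(1) by (simp add: pfms_iff)
      then show ?thesis using v(2) Inl by (simp add: f_def vj real_tvar_def)
    next
      case (Inr a)
      then have a: "a \<in> B" "a \<in> univ (eq_struc M) (fst v)" using \<psi>(1) v(1) by (simp_all add: pfms_iff)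
      show ?thesis
        using representative_in_univ[where X="\<lambda>v. Some (fst v)" and i=v, OF refl sorts[OF v(1)] a(2) v(2)]
          a(1) Inr by (auto simp: f_def vj)
    qed
  qed simp
  moreover have "sat (eq_struc M) (eq_asg M (\<lambda>p. case_sum c (\<lambda>a. a) (f p))) \<phi> = P (to_eq M X c)"
    if c: "sorted_asg M (real_tvar X) c" for c
  proof -
    have "sorted_asg (eq_struc M) X (to_eq M X c)"
      unfolding sorted_asg_def using c by (auto intro!: to_eq_in_univ simp: sorted_asg_def)
    then have "P (to_eq M X c) = holds (eq_struc M) (\<phi>, \<sigma>) (to_eq M X c)" by (rule \<psi>(2))
    also have "\<dots> = sat (eq_struc M) (eq_asg M (\<lambda>p. case_sum c (\<lambda>a. a) (f p))) \<phi>"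
      unfolding holds_def fst_conv snd_conv
    proof (rule sat_cong)
      fix v assume v: "v \<in> fv \<phi>"
      show "(case \<sigma> v of Inl i \<Rightarrow> to_eq M X c i | Inr a \<Rightarrow> a) =
          eq_asg M (\<lambda>p. case_sum c (\<lambda>a. a) (f p)) v"
      proof (cases "\<sigma> v")
        case (Inl i)
        then have "X i = Some (fst v)" using \<psi>(1) v by (simp add: pfms_iff)
        then show ?thesis using Inl by (cases "fst v") (simp_all add: eq_asg_def to_eq_def f_def)
      next
        case (Inr a)
        then have a: "a \<in> univ (eq_struc M) (fst v)" using \<psi>(1) v by (simp add: pfms_iff)
        have "eq_asg M (\<lambda>p. case_sum c (\<lambda>a. a) (f p)) v = a"
          unfolding eq_asg_def
          by (rule to_eq_representative[OF _ sorts[OF v] a]) (simp_all add: f_def Inr)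
        then show ?thesis using Inr by simp
      qed
    qed
    finally show ?thesis by simp
  qed
  ultimately show ?thesis by (subst definable_cong[symmetric])
qed

section \<open>Uncountability of \<kappa> and transfer of saturation\<close>

lemma infinite_wf_fms:
  assumes "wf_language L"
  shows "infinite {\<phi>. wf_fm L \<phi>}"
proof -
  obtain s where s: "s \<in> sorts L" using assms by (auto simp: wf_language_def)
  have "inj (\<lambda>n. Eq (Var (s, n)) (Var (s, n)))" by (auto simp: inj_def)
  then have "infinite (range (\<lambda>n. Eq (Var (s, n)) (Var (s, n))))" by (rule range_inj_infinite)
  moreover have "range (\<lambda>n. Eq (Var (s, n)) (Var (s, n))) \<subseteq> {\<phi>. wf_fm L \<phi>}" using s by auto
  ultimately show ?thesis by (rule infinite_super[rotated])
qed

text \<open>\<kappa> exceeds the number of formulas, which is infinite; hence it is uncountable, and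
  countably many small tuples together are still small.\<close>

lemma monster_model_card:
  assumes "monster_model \<kappa> T M"
  shows "Card_order \<kappa>" "infinite (Field \<kappa>)" "small \<kappa> (UNIV :: nat set)"
proof -
  show \<kappa>: "Card_order \<kappa>" using assms by (simp add: monster_model_def)
  have "infinite {\<phi>. wf_fm (lang M) \<phi>}"
    using assms by (intro infinite_wf_fms) (simp add: monster_model_def models_def wf_struc_def)
  then have "|UNIV :: nat set| \<le>o |{\<phi>. wf_fm (lang M) \<phi>}|" by (simp add: infinite_iff_card_of_nat)
  then show nat: "small \<kappa> (UNIV :: nat set)"
    using assms by (auto simp: monster_model_def small_def intro: ordLeq_ordLess_trans)
  have "\<kappa> =o |Field \<kappa>|" using card_of_Field_ordIso[OF \<kappa>] by (rule ordIso_symmetric)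
  with nat have "|UNIV :: nat set| <o |Field \<kappa>|" unfolding small_def by (rule ordLess_ordIso_trans)
  then show "infinite (Field \<kappa>)" by (simp add: infinite_iff_card_of_nat ordLess_imp_ordLeq)
qed

text \<open>The conditions are pulled back along \<open>to_eq\<close>, realized in \<open>M\<close>,
  and the realization is mapped forward again. Finite satisfiability passes to \<open>M\<close> by
  choosing representatives.\<close>

theorem saturated_eq_struc:
  fixes X :: "('i, ('s, 'f, 'r) eqsort) tvar" and M :: "('s, 'f, 'r, 'a) struc"
  assumes mm: "monster_model \<kappa> T M"
    and X: "wf_tvar (eq_struc M) X" "small \<kappa> (dom X)"
    and B: "B \<subseteq> elems (eq_struc M)" "small \<kappa> B"
    and def: "\<And>P. P \<in> \<P> \<Longrightarrow> definable (eq_struc M) X B P"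
    and fin: "fin_sat (eq_struc M) X \<P>"
  shows "\<exists>c. sorted_asg (eq_struc M) X c \<and> (\<forall>P\<in>\<P>. P c)"
proof -
  note \<kappa> = monster_model_card[OF mm]
  have M: "wf_struc M" "saturated \<kappa> M" using mm by (auto simp: monster_model_def models_def)
  have ne: "sorts (lang M) \<noteq> {}" "\<And>s. s \<in> sorts (lang M) \<Longrightarrow> univ M s \<noteq> {}"
    using M by (auto simp: wf_struc_def wf_language_def)
  have Xs: "s \<in> sorts (eq_lang M)" if "X i = Some s" for i s
    using X(1) that by (auto simp: wf_tvar_def ran_def)
  let ?X = "real_tvar X" and ?B = "\<Union>b\<in>B. set (representative b)"
  let ?\<P> = "(\<lambda>P c. P (to_eq M X c)) ` \<P>"
  have rX: "\<exists>s. X i = Some s" if "?X (i, j) = Some t" for i j t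
    using that by (auto simp: real_tvar_def split: option.splits)
  have "\<exists>c. sorted_asg M ?X c \<and> (\<forall>P\<in>?\<P>. P c)"
  proof (rule saturated_tuple[OF ne \<kappa>(1,2) M(2)])
    have "t \<in> sorts (lang M)" if t: "?X (i, j) = Some t" for i j t
    proof -
      obtain s where "X i = Some s" using rX[OF t] by blast
      with Xs[OF this] t show ?thesis
        by (cases s) (auto simp: real_tvar_def defines_eqrel_def split: if_splits)
    qed
    then show "wf_tvar M ?X" by (auto simp: wf_tvar_def ran_def)
    have "dom ?X \<subseteq> dom X \<times> UNIV" using rX by auto
    then show "small \<kappa> (dom ?X)" using small_Times[OF \<kappa>(1,2) X(2) \<kappa>(3)] by (rule small_subset)
    have "?B \<subseteq> (\<lambda>(b, j). representative b ! j) ` (B \<times> UNIV)"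
      by (force simp: in_set_conv_nth)
    then show "small \<kappa> ?B"
      using small_image[OF small_Times[OF \<kappa>(1,2) B(2) \<kappa>(3)]] by (rule small_subset)
    show "?B \<subseteq> elems M"
    proof
      fix x assume "x \<in> ?B"
      then obtain b where b: "b \<in> B" "x \<in> set (representative b)" by blast
      then obtain s where s: "s \<in> sorts (eq_lang M)" "b \<in> univ (eq_struc M) s"
        using B(1) by (auto simp: elems_def)
      show "x \<in> elems M"
      proof (cases s)
        case (Home t)
        then show ?thesis using b s by (auto simp: elems_def)
      next
        case (Quot ss \<phi>)
        then have "representative b \<in> ltuples M ss"
          using s representative_Quot(1)[of M ss \<phi>] by auto
        moreover have "set ss \<subseteq> sorts (lang M)" using s Quot by (simp add: defines_eqrel_def)
        moreover obtain i where "i < length (representative b)" "x = representative b ! i"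
          using b(2) by (auto simp: in_set_conv_nth)
        ultimately have "x \<in> univ M (ss ! i)" "ss ! i \<in> sorts (lang M)"
          by (auto simp: ltuples_def list_all2_conv_all_nth)
        then show ?thesis by (auto simp: elems_def)
      qed
    qed
    show "definable M ?X ?B P" if "P \<in> ?\<P>" for P
      using that definable_pull_back[OF M(1) X(1) def] by auto
    show "fin_sat M ?X ?\<P>"
      unfolding fin_sat_def
    proof (intro allI impI)
      fix \<Q> assume "\<Q> \<subseteq> ?\<P>" "finite \<Q>"
      then obtain \<Q>' where \<Q>': "\<Q>' \<subseteq> \<P>" "finite \<Q>'" "\<Q> = (\<lambda>P c. P (to_eq M X c)) ` \<Q>'"
        using finite_subset_image by metis
      then obtain c where c: "sorted_asg (eq_struc M) X c" "\<forall>P\<in>\<Q>'. P c"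
        using fin unfolding fin_sat_def by meson
      let ?c = "\<lambda>p. representative (c (fst p)) ! snd p"
      have "sorted_asg M ?X ?c"
        unfolding sorted_asg_def
      proof (intro allI impI)
        fix p t assume t: "?X p = Some t"
        obtain i j where p: "p = (i, j)" by (cases p) auto
        obtain s where s: "X i = Some s" using rX t p by blast
        then have "c i \<in> univ (eq_struc M) s" using c(1) by (simp add: sorted_asg_def)
        then show "?c p \<in> univ M t"
          using representative_in_univ(1)[OF s Xs[OF s] _ t[unfolded p]] p by simp
      qed
      moreover have Q': "P (to_eq M X ?c)" if "P \<in> \<Q>'" for P
      proof -
        have "c i = to_eq M X ?c i" if s: "X i = Some s" for i s
        proof (rule to_eq_representative[where s=s, symmetric])
          show "c i \<in> univ (eq_struc M) s" using c(1) s by (simp add: sorted_asg_def)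
        qed (simp_all add: s Xs[OF s])
        then have "P c = P (to_eq M X ?c)"
          using \<Q>'(1) that by (intro definable_asg_cong[OF def c(1)]) auto
        then show ?thesis using bspec[OF c(2) that] by (rule iffD1)
      qed
      moreover have "\<forall>P\<in>\<Q>. P ?c"
        unfolding \<Q>'(3) by (rule ballI, erule imageE) (simp only: Q')
      ultimately show "\<exists>c. sorted_asg M ?X c \<and> (\<forall>P\<in>\<Q>. P c)"
        by (intro exI[of _ ?c] conjI)
    qed
  qed
  then obtain c where c: "sorted_asg M ?X c \<and> (\<forall>P\<in>?\<P>. P c)" by (rule exE)
  then have "sorted_asg (eq_struc M) X (to_eq M X c)"
    unfolding sorted_asg_def by (auto intro!: to_eq_in_univ)
  moreover have "\<forall>P\<in>\<P>. P (to_eq M X c)"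
  proof
    fix P assume "P \<in> \<P>"
    then have "(\<lambda>c. P (to_eq M X c)) \<in> ?\<P>" by (rule imageI)
    from bspec[OF conjunct2[OF c] this] show "P (to_eq M X c)" .
  qed
  ultimately show ?thesis by (intro exI[of _ "to_eq M X c"] conjI)
qed

lemma eq_struc_nonempty:
  assumes "wf_struc M"
  shows "sorts (eq_lang M) \<noteq> {}" "s \<in> sorts (eq_lang M) \<Longrightarrow> univ (eq_struc M) s \<noteq> {}"
proof -
  obtain t where "t \<in> sorts (lang M)" using assms by (auto simp: wf_struc_def wf_language_def)
  then have "Home t \<in> sorts (eq_lang M)" by simp
  then show "sorts (eq_lang M) \<noteq> {}" by blast
  assume s: "s \<in> sorts (eq_lang M)"
  have ne: "univ M t \<noteq> {}" if "t \<in> sorts (lang M)" for t using assms that by (simp add: wf_struc_def)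
  show "univ (eq_struc M) s \<noteq> {}"
  proof (cases s)
    case (Home t)
    then show ?thesis using s ne by simp
  next
    case (Quot ss \<phi>)
    then have "set ss \<subseteq> sorts (lang M)" using s by (simp add: defines_eqrel_def)
    then have "map (\<lambda>t. SOME a. a \<in> univ M t) ss \<in> ltuples M ss"
      using ne by (auto simp: ltuples_def list_all2_conv_all_nth some_in_eq subset_iff)
    then show ?thesis using Quot by (auto simp: quotient_def)
  qed
qed

section \<open>Cosets and homogeneous sequences in groups\<close>

text \<open>Induction on the number of subgroups. If some coset T x is not in the cover, it is
  disjoint from all cosets of T in the cover, so cosets of the other subgroups cover it. Every T a
  in the cover is the right translate of T x by x^-1 a and can be replaced by translates of those
  cosets; this eliminates T.\<close>

lemma (in group) neumann_coset_cover:
  assumes "finite \<S>" "\<And>S. S \<in> \<S> \<Longrightarrow> subgroup S G"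
    and "finite F" "F \<subseteq> \<S> \<times> carrier G" "carrier G \<subseteq> (\<Union>(S, a)\<in>F. S #> a)"
  shows "\<exists>S\<in>\<S>. finite (rcosets S)"
  using assms
proof (induction \<S> arbitrary: F rule: finite_induct)
  case empty
  then show ?case using one_closed by auto
next
  case (insert T \<S>)
  have T: "subgroup T G" and S: "\<And>S. S \<in> \<S> \<Longrightarrow> subgroup S G" using insert.prems by auto
  show ?case
  proof (cases "rcosets T \<subseteq> (\<lambda>(S, a). S #> a) ` F")
    case True
    then have "finite (rcosets T)" using insert.prems(2) by (meson finite_imageI finite_subset)
    then show ?thesis by blast
  next
    case False
    then obtain x where x: "x \<in> carrier G" "\<And>a. (T, a) \<in> F \<Longrightarrow> T #> x \<noteq> T #> a"
      by (fastforce simp: RCOSETS_def)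
    have cover: "\<exists>S a. (S, a) \<in> F \<and> S \<in> \<S> \<and> y \<in> S #> a" if y: "y \<in> T #> x" for y
    proof -
      have "y \<in> carrier G" using y T x(1) r_coset_subset_G subgroup.subset by blast
      then obtain S a where Sa: "(S, a) \<in> F" "y \<in> S #> a" using insert.prems(4) by auto
      have "S \<noteq> T"
      proof
        assume "S = T"
        then have "a \<in> carrier G" "y \<in> T #> a" using Sa insert.prems(3) by auto
        then have "T #> x = T #> a" using y T x(1) repr_independence by metis
        with x(2) Sa \<open>S = T\<close> show False by blast
      qed
      then show ?thesis using Sa insert.prems(3) by blast
    qed
    \<comment> \<open>Cosets of the other subgroups are kept; the second set holds their right
      translates by x^-1 a, for every T a in the cover.\<close>
    let ?F = "{p \<in> F. fst p \<in> \<S>} \<union>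
      (\<lambda>(p, q). (fst p, snd p \<otimes> (inv x \<otimes> snd q))) ` ({p \<in> F. fst p \<in> \<S>} \<times> {q \<in> F. fst q = T})"
    have "finite ?F" using insert.prems(2) by simp
    moreover have "?F \<subseteq> \<S> \<times> carrier G"
    proof -
      have "snd p \<in> carrier G" if "p \<in> F" for p using that insert.prems(3) by auto
      then show ?thesis using x(1) by (auto intro!: m_closed inv_closed)
    qed
    moreover have "carrier G \<subseteq> (\<Union>(S, a)\<in>?F. S #> a)"
    proof
      fix y assume y: "y \<in> carrier G"
      then obtain S a where Sa: "(S, a) \<in> F" "y \<in> S #> a" using insert.prems(4) by auto
      show "y \<in> (\<Union>(S, a)\<in>?F. S #> a)"
      proof (cases "S \<in> \<S>")
        case True
        then show ?thesis using Sa by force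
      next
        case False
        then have ST: "S = T" using Sa insert.prems(3) by auto
        have a: "a \<in> carrier G" using Sa insert.prems(3) by auto
        obtain t where t: "t \<in> T" "y = t \<otimes> a" using Sa ST by (auto simp: r_coset_def)
        have tc: "t \<in> carrier G" using t T subgroup.mem_carrier by metis
        have "t \<otimes> x \<in> T #> x" using t by (auto simp: r_coset_def)
        then obtain S' b where S': "(S', b) \<in> F" "S' \<in> \<S>" "t \<otimes> x \<in> S' #> b" using cover by blast
        then obtain s where s: "s \<in> S'" "t \<otimes> x = s \<otimes> b" by (auto simp: r_coset_def)
        have sc: "s \<in> carrier G" "b \<in> carrier G"
          using subgroup.mem_carrier[OF S[OF S'(2)] s(1)] S'(1) insert.prems(3) by auto
        have "(t \<otimes> x) \<otimes> (inv x \<otimes> a) = t \<otimes> ((x \<otimes> inv x) \<otimes> a)"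
          using tc a x(1) by (simp only: m_assoc m_closed inv_closed)
        then have "y = (t \<otimes> x) \<otimes> (inv x \<otimes> a)" using t tc a x(1) by simp
        also have "\<dots> = s \<otimes> (b \<otimes> (inv x \<otimes> a))" using s sc x(1) a by (simp add: m_assoc)
        finally have "y \<in> S' #> (b \<otimes> (inv x \<otimes> a))" using s by (auto simp: r_coset_def)
        moreover have "(S', b \<otimes> (inv x \<otimes> a)) \<in> ?F"
          using S' Sa ST by (intro UnI2 image_eqI[of _ _ "((S', b), (T, a))"]) auto
        ultimately show ?thesis by blast
      qed
    qed
    ultimately have "\<exists>S\<in>\<S>. finite (rcosets S)" using insert.IH[of ?F] S by blast
    then show ?thesis by blast
  qed
qed

lemma (in group) conjugate_subgroup:
  assumes K: "subgroup K G" and v: "v \<in> carrier G"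
  shows "subgroup ((\<lambda>k. v \<otimes> k \<otimes> inv v) ` K) G"
proof -
  have "group_hom G G (\<lambda>k. v \<otimes> k \<otimes> inv v)"
    using v by unfold_locales (auto simp: hom_def m_assoc inv_solve_left)
  then show ?thesis using K by (rule group_hom.subgroup_img_is_subgroup)
qed

text \<open>b u = v k with k in K says that b lies in the right coset of v K v^-1 through v u^-1. If
  no b were good, H would be a finite union of such cosets, so by Neumann's lemma some conjugate of
  K, and with it K, would have finite index in H.\<close>

lemma infinite_index_avoid:
  assumes G: "group G" and H: "subgroup H G" and K: "subgroup K G" "K \<subseteq> H"
    and inf: "infinite_index G H K" and F: "finite F" "F \<subseteq> H \<times> H"
  shows "\<exists>b\<in>H. \<forall>(v, u)\<in>F. \<forall>k\<in>K. b \<otimes>\<^bsub>G\<^esub> u \<noteq> v \<otimes>\<^bsub>G\<^esub> k"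
proof (rule ccontr)
  assume "\<not> ?thesis"
  then have cov: "\<exists>v u k. (v, u) \<in> F \<and> k \<in> K \<and> b \<otimes>\<^bsub>G\<^esub> u = v \<otimes>\<^bsub>G\<^esub> k" if "b \<in> H" for b
    using that by fast
  define L where "L = G\<lparr>carrier := H\<rparr>"
  interpret G: group G by (rule G)
  interpret L: group L unfolding L_def using H by (rule subgroup.subgroup_is_group[OF _ G])
  have KL: "subgroup K L" unfolding L_def using G.subgroup_incl[OF K(1) H K(2)] .
  have mult: "x \<otimes>\<^bsub>L\<^esub> y = x \<otimes>\<^bsub>G\<^esub> y" for x y by (simp add: L_def)
  have carr: "carrier L = H" by (simp add: L_def)
  let ?S = "\<lambda>v. (\<lambda>k. v \<otimes>\<^bsub>L\<^esub> k \<otimes>\<^bsub>L\<^esub> inv\<^bsub>L\<^esub> v) ` K"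
  have sub: "subgroup (?S v) L" if "v \<in> H" for v
    using that by (intro L.conjugate_subgroup KL) (simp add: carr)
  have Kc: "k \<in> carrier L" if "k \<in> K" for k using that K(2) carr by auto
  have "\<exists>S\<in>?S ` fst ` F. finite (rcosets\<^bsub>L\<^esub> S)"
  proof (rule L.neumann_coset_cover[where F="(\<lambda>(v, u). (?S v, v \<otimes>\<^bsub>L\<^esub> inv\<^bsub>L\<^esub> u)) ` F"])
    show "finite (?S ` fst ` F)" "finite ((\<lambda>(v, u). (?S v, v \<otimes>\<^bsub>L\<^esub> inv\<^bsub>L\<^esub> u)) ` F)"
      using F(1) by simp_all
    show "subgroup S L" if "S \<in> ?S ` fst ` F" for S
      using that sub F(2) by auto
    show "(\<lambda>(v, u). (?S v, v \<otimes>\<^bsub>L\<^esub> inv\<^bsub>L\<^esub> u)) ` F \<subseteq> ?S ` fst ` F \<times> carrier L"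
      using F(2) carr by (force intro!: L.m_closed L.inv_closed)
    show "carrier L \<subseteq> (\<Union>(S, a)\<in>(\<lambda>(v, u). (?S v, v \<otimes>\<^bsub>L\<^esub> inv\<^bsub>L\<^esub> u)) ` F. S #>\<^bsub>L\<^esub> a)"
    proof
      fix b assume b: "b \<in> carrier L"
      then obtain v u k where vu: "(v, u) \<in> F" and k: "k \<in> K" and e: "b \<otimes>\<^bsub>L\<^esub> u = v \<otimes>\<^bsub>L\<^esub> k"
        using cov carr mult by metis
      have c: "v \<in> carrier L" "u \<in> carrier L" "k \<in> carrier L" using vu F(2) k Kc carr by auto
      have "b = (v \<otimes>\<^bsub>L\<^esub> k) \<otimes>\<^bsub>L\<^esub> inv\<^bsub>L\<^esub> u" using e b c by (metis L.inv_solve_right L.m_closed)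
      also have "\<dots> = (v \<otimes>\<^bsub>L\<^esub> k \<otimes>\<^bsub>L\<^esub> inv\<^bsub>L\<^esub> v) \<otimes>\<^bsub>L\<^esub> (v \<otimes>\<^bsub>L\<^esub> inv\<^bsub>L\<^esub> u)"
        using c by (simp add: L.m_assoc) (simp add: L.r_inv L.l_inv flip: L.m_assoc)
      finally have "b \<in> ?S v #>\<^bsub>L\<^esub> (v \<otimes>\<^bsub>L\<^esub> inv\<^bsub>L\<^esub> u)" using k by (auto simp: r_coset_def)
      then show "b \<in> (\<Union>(S, a)\<in>(\<lambda>(v, u). (?S v, v \<otimes>\<^bsub>L\<^esub> inv\<^bsub>L\<^esub> u)) ` F. S #>\<^bsub>L\<^esub> a)"
        using vu by force
    qed
  qed
  then obtain v where v: "v \<in> carrier L" and fin: "finite (rcosets\<^bsub>L\<^esub> (?S v))"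
    using F(2) carr by auto
  \<comment> \<open>(v K v^-1) v a = v K a, so left translation by v^-1 takes cosets of the
    conjugate to cosets of K, and all of these are reached.\<close>
  have "rcosets\<^bsub>L\<^esub> K \<subseteq> (\<lambda>C. (\<lambda>c. inv\<^bsub>L\<^esub> v \<otimes>\<^bsub>L\<^esub> c) ` C) ` (rcosets\<^bsub>L\<^esub> (?S v))"
  proof
    fix C assume "C \<in> rcosets\<^bsub>L\<^esub> K"
    then obtain a where a: "a \<in> carrier L" "C = K #>\<^bsub>L\<^esub> a" by (auto simp: RCOSETS_def)
    have rc: "A #>\<^bsub>L\<^esub> x = (\<lambda>h. h \<otimes>\<^bsub>L\<^esub> x) ` A" for A x by (auto simp: r_coset_def)
    have "inv\<^bsub>L\<^esub> v \<otimes>\<^bsub>L\<^esub> ((v \<otimes>\<^bsub>L\<^esub> k \<otimes>\<^bsub>L\<^esub> inv\<^bsub>L\<^esub> v) \<otimes>\<^bsub>L\<^esub> (v \<otimes>\<^bsub>L\<^esub> a)) = k \<otimes>\<^bsub>L\<^esub> a" if "k \<in> K" for k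
    proof -
      have k: "k \<in> carrier L" using that by (rule Kc)
      have "(v \<otimes>\<^bsub>L\<^esub> k \<otimes>\<^bsub>L\<^esub> inv\<^bsub>L\<^esub> v) \<otimes>\<^bsub>L\<^esub> (v \<otimes>\<^bsub>L\<^esub> a) = v \<otimes>\<^bsub>L\<^esub> (k \<otimes>\<^bsub>L\<^esub> ((inv\<^bsub>L\<^esub> v \<otimes>\<^bsub>L\<^esub> v) \<otimes>\<^bsub>L\<^esub> a))"
        using v a k by (simp only: L.m_assoc L.m_closed L.inv_closed)
      then show ?thesis using v a k by (simp flip: L.m_assoc)
    qed
    then have "C = (\<lambda>c. inv\<^bsub>L\<^esub> v \<otimes>\<^bsub>L\<^esub> c) ` (?S v #>\<^bsub>L\<^esub> (v \<otimes>\<^bsub>L\<^esub> a))"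
      unfolding a(2) rc image_image by (intro image_cong refl) simp
    moreover have "?S v #>\<^bsub>L\<^esub> (v \<otimes>\<^bsub>L\<^esub> a) \<in> rcosets\<^bsub>L\<^esub> (?S v)"
      using v a by (auto simp: RCOSETS_def)
    ultimately show "C \<in> (\<lambda>C. (\<lambda>c. inv\<^bsub>L\<^esub> v \<otimes>\<^bsub>L\<^esub> c) ` C) ` (rcosets\<^bsub>L\<^esub> (?S v))" by blast
  qed
  then have "finite (rcosets\<^bsub>L\<^esub> K)" using fin by (meson finite_imageI finite_subset)
  then show False using inf by (simp add: infinite_index_def L_def)
qed

text \<open>Later entries multiply on the left: when two cosets of K are compared, a common last
  factor cancels there, whereas on the right it would stand between the product and K.\<close>

definition rprod :: "('g, 'b) monoid_scheme \<Rightarrow> 'g list \<Rightarrow> 'g" where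
  "rprod G xs = foldl (\<lambda>x a. a \<otimes>\<^bsub>G\<^esub> x) \<one>\<^bsub>G\<^esub> xs"

lemma rprod_simps [simp]:
  "rprod G [] = \<one>\<^bsub>G\<^esub>" "rprod G (xs @ [a]) = a \<otimes>\<^bsub>G\<^esub> rprod G xs"
  by (simp_all add: rprod_def)

lemma rprod_in_subgroup:
  assumes "subgroup H G"
  shows "set xs \<subseteq> H \<Longrightarrow> rprod G xs \<in> H"
  by (induction xs rule: rev_induct) (simp_all add: subgroup.one_closed[OF assms] subgroup.m_closed[OF assms])

lemma (in group) rprod_closed: "set xs \<subseteq> carrier G \<Longrightarrow> rprod G xs \<in> carrier G"
  by (rule rprod_in_subgroup[OF subgroup_self])

lemma (in group) rprod_append:
  "set xs \<subseteq> carrier G \<Longrightarrow> set ys \<subseteq> carrier G \<Longrightarrow> rprod G (xs @ ys) = rprod G ys \<otimes> rprod G xs"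
proof (induction ys rule: rev_induct)
  case (snoc y ys)
  have "rprod G (xs @ ys @ [y]) = y \<otimes> rprod G (xs @ ys)"
    using rprod_simps(2)[of G "xs @ ys" y] by simp
  with snoc show ?case by (simp add: m_assoc rprod_closed)
qed (simp add: rprod_closed)

lemma finite_increasing_lists: "finite {is. sorted_wrt (<) is \<and> set is \<subseteq> {..<m :: nat}}"
proof (rule finite_subset)
  show "{is. sorted_wrt (<) is \<and> set is \<subseteq> {..<m}} \<subseteq> sorted_list_of_set ` Pow {..<m}"
    by (auto simp: image_iff intro!: bexI[of _ "set x" for x] sorted_list_of_set.idem_if_sorted_distinct[symmetric]
      simp: strict_sorted_iff)
qed simp

text \<open>Each term is chosen to avoid all coincidences with products of earlier terms. If two
  lists have the same last index, that factor cancels and induction applies; otherwise the term with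
  the larger last index was chosen so as to exclude the equality.\<close>

lemma independent_sequence:
  assumes G: "group G" and H: "subgroup H G" and K: "subgroup K G" "K \<subseteq> H"
    and inf: "infinite_index G H K"
  shows "\<exists>c :: nat \<Rightarrow> 'g. (\<forall>i. c i \<in> H) \<and>
    (\<forall>is js h. sorted_wrt (<) is \<longrightarrow> sorted_wrt (<) js \<longrightarrow> length is = length js \<longrightarrow> is \<noteq> js \<longrightarrow> h \<in> K
      \<longrightarrow> rprod G (map c is) \<noteq> rprod G (map c js) \<otimes>\<^bsub>G\<^esub> h)"
proof -
  interpret group G by (rule G)
  let ?I = "\<lambda>m. {is. sorted_wrt (<) is \<and> set is \<subseteq> {..<m :: nat}}"
  let ?F = "\<lambda>c m. (\<lambda>(is, js). (rprod G (map c is), rprod G (map c js))) ` (?I m \<times> ?I m)"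
  \<comment> \<open>The choice principle does not provide that earlier terms lie in
    \<open>H\<close>. This inclusion is therefore a premise inside the condition and is discharged
    when the whole sequence is available.\<close>
  let ?P = "\<lambda>c m b. b \<in> H \<and> (?F c m \<subseteq> H \<times> H \<longrightarrow> (\<forall>(v, u)\<in>?F c m. \<forall>k\<in>K. b \<otimes>\<^bsub>G\<^esub> u \<noteq> v \<otimes>\<^bsub>G\<^esub> k))"
  have "\<exists>c. \<forall>m. ?P c m (c m)"
  proof (rule dependent_wellorder_choice)
    fix r m and f g :: "nat \<Rightarrow> 'g" assume fg: "\<And>i. i < m \<Longrightarrow> f i = g i"
    have "?F f m = ?F g m"
    proof (rule image_cong[OF refl])
      fix p assume "p \<in> ?I m \<times> ?I m"
      moreover have "rprod G (map f l) = rprod G (map g l)" if "set l \<subseteq> {..<m}" for l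
        using that by (intro arg_cong[where f="rprod G"] map_cong refl fg) auto
      ultimately show "(\<lambda>(is, js). (rprod G (map f is), rprod G (map f js))) p =
          (\<lambda>(is, js). (rprod G (map g is), rprod G (map g js))) p" by auto
    qed
    then show "?P f m r = ?P g m r" by simp
  next
    fix m and f :: "nat \<Rightarrow> 'g"
    show "\<exists>r. ?P f m r"
    proof (cases "?F f m \<subseteq> H \<times> H")
      case True
      have "finite (?F f m)" using finite_increasing_lists by simp
      from infinite_index_avoid[OF G H K inf this True] show ?thesis by blast
    next
      case False
      then show ?thesis using subgroup.one_closed[OF H] by blast
    qed
  qed
  then obtain c where c: "\<And>m. ?P c m (c m)" by blast
  have cH: "c i \<in> H" for i using c by blast
  have prod_H: "rprod G (map c l) \<in> H" for l using cH by (intro rprod_in_subgroup H) auto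
  have Hc: "x \<in> carrier G" if "x \<in> H" for x using H that by (rule subgroup.mem_carrier)
  have avoid: "c m \<otimes>\<^bsub>G\<^esub> rprod G (map c js) \<noteq> rprod G (map c is) \<otimes>\<^bsub>G\<^esub> k"
    if "is \<in> ?I m" "js \<in> ?I m" "k \<in> K" for m "is" js k
  proof -
    have "?F c m \<subseteq> H \<times> H" using prod_H by auto
    then have "\<forall>(v, u)\<in>?F c m. \<forall>k\<in>K. c m \<otimes>\<^bsub>G\<^esub> u \<noteq> v \<otimes>\<^bsub>G\<^esub> k" using c by blast
    moreover have "(rprod G (map c is), rprod G (map c js)) \<in> ?F c m" using that by auto
    ultimately have "case (rprod G (map c is), rprod G (map c js)) of (v, u) \<Rightarrow>
        \<forall>k\<in>K. c m \<otimes>\<^bsub>G\<^esub> u \<noteq> v \<otimes>\<^bsub>G\<^esub> k" by (rule bspec)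
    then show ?thesis using that(3) by simp
  qed
  have "rprod G (map c is) \<noteq> rprod G (map c js) \<otimes>\<^bsub>G\<^esub> h"
    if "sorted_wrt (<) is" "sorted_wrt (<) js" "length is = length js" "is \<noteq> js" "h \<in> K" for "is" js h
    using that
  proof (induction "is" arbitrary: js rule: rev_induct)
    case (snoc i "is")
    obtain js' j where js: "js = js' @ [j]"
      using snoc.prems(3) by (cases js rule: rev_cases) auto
    have srt: "sorted_wrt (<) is" "sorted_wrt (<) js'" "\<And>x. x \<in> set is \<Longrightarrow> x < i" "\<And>x. x \<in> set js' \<Longrightarrow> x < j"
      using snoc.prems(1,2) by (auto simp: js sorted_wrt_append)
    have h: "h \<in> H" using snoc.prems(5) K(2) by blast
    note cl = Hc[OF prod_H[of "is"]] Hc[OF prod_H[of js']] Hc[OF cH] Hc[OF h]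
    consider "i = j" | "j < i" | "i < j" by linarith
    then show ?case
    proof cases
      case 1
      have "rprod G (map c is) \<noteq> rprod G (map c js') \<otimes>\<^bsub>G\<^esub> h"
        using snoc.prems srt 1 by (intro snoc.IH) (auto simp: js)
      then show ?thesis using 1 cl by (simp add: js m_assoc)
    next
      case 2
      have "c i \<otimes>\<^bsub>G\<^esub> rprod G (map c is) \<noteq> rprod G (map c js) \<otimes>\<^bsub>G\<^esub> h"
        using srt 2 snoc.prems by (intro avoid) (auto simp: js intro: less_trans)
      then show ?thesis by simp
    next
      \<comment> \<open>The larger last index is on the right-hand side, so the equation is solved
        for that product, with the inverse of \<open>h\<close> in \<open>K\<close>.\<close>
      case 3
      have "c j \<otimes>\<^bsub>G\<^esub> rprod G (map c js') \<noteq> rprod G (map c (is @ [i])) \<otimes>\<^bsub>G\<^esub> inv\<^bsub>G\<^esub> h"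
        using srt 3 snoc.prems subgroup.m_inv_closed[OF K(1)] by (intro avoid) (auto intro: less_trans)
      moreover have "rprod G (map c js) = rprod G (map c (is @ [i])) \<otimes>\<^bsub>G\<^esub> inv\<^bsub>G\<^esub> h"
        if "rprod G (map c (is @ [i])) = rprod G (map c js) \<otimes>\<^bsub>G\<^esub> h"
        using that Hc[OF h] Hc[OF prod_H] by (subst inv_solve_right) simp_all
      ultimately show ?thesis by (auto simp: js)
    qed
  qed simp
  with cH show ?thesis by (intro exI[of _ c] conjI allI impI)
qed

text \<open>Ramsey's theorem once per colouring; an infinite subset inherits the homogeneity already
  reached.\<close>

lemma homogeneous_subset:
  fixes \<Theta> :: "(nat \<times> (nat list \<Rightarrow> bool)) set"
  assumes "finite \<Theta>"
  shows "\<exists>Y :: nat set. infinite Y \<and> (\<forall>(m, Q)\<in>\<Theta>. \<forall>is js. sorted_wrt (<) is \<and> length is = m \<and> set is \<subseteq> Y \<and>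
    sorted_wrt (<) js \<and> length js = m \<and> set js \<subseteq> Y \<longrightarrow> Q is = Q js)"
  using assms
proof (induction \<Theta>)
  case empty
  then show ?case by (auto intro: exI[of _ UNIV])
next
  case (insert p \<Theta>)
  obtain m Q where p: "p = (m, Q)" by (cases p)
  obtain Y where Y: "infinite Y" and hom: "\<And>m Q is js. (m, Q) \<in> \<Theta> \<Longrightarrow>
      sorted_wrt (<) is \<and> length is = m \<and> set is \<subseteq> Y \<and> sorted_wrt (<) js \<and> length js = m \<and> set js \<subseteq> Y \<Longrightarrow> Q is = Q js"
    using insert.IH by fast
  \<comment> \<open>Ramsey's theorem colours finite sets; these correspond to their increasing
    enumerations.\<close>
  let ?f = "\<lambda>X. if Q (sorted_list_of_set X) then 1 else 0 :: nat"
  have "\<forall>X. X \<subseteq> Y \<and> finite X \<and> card X = m \<longrightarrow> ?f X < 2" by simp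
  from Ramsey[OF Y this] obtain Z t where Zt: "Z \<subseteq> Y \<and> infinite Z \<and> t < 2 \<and>
      (\<forall>X. X \<subseteq> Z \<and> finite X \<and> card X = m \<longrightarrow> ?f X = t)"
    by (elim exE)
  then have Z: "Z \<subseteq> Y" "infinite Z" by simp_all
  have t: "?f X = t" if "X \<subseteq> Z" "finite X" "card X = m" for X
    using Zt that by simp
  have Q: "Q is = (t = 1)" if "sorted_wrt (<) is" "length is = m" "set is \<subseteq> Z" for "is"
  proof -
    have "sorted_list_of_set (set is) = is" "card (set is) = m"
      using that(1,2) by (auto simp: strict_sorted_iff sorted_list_of_set.idem_if_sorted_distinct distinct_card)
    then show ?thesis using t[of "set is"] that(3) by (auto split: if_splits)
  qed
  have "Q' is = Q' js" if "(m', Q') \<in> insert p \<Theta>" "sorted_wrt (<) is" "length is = m'" "set is \<subseteq> Z"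
    "sorted_wrt (<) js" "length js = m'" "set js \<subseteq> Z" for m' Q' "is" js
  proof (cases "(m', Q') \<in> \<Theta>")
    case True
    then show ?thesis using that Z(1) by (intro hom) auto
  next
    case False
    then show ?thesis using that p Q[of "is"] Q[of js] by auto
  qed
  with Z(2) show ?case by (intro exI[of _ Z]) blast
qed

text \<open>The enumeration of a homogeneous set is strictly increasing, so increasing lists stay
  increasing and different ones stay different; hence the subsequence is again independent.\<close>

lemma independent_homogeneous_sequence:
  fixes \<Theta> :: "(nat \<times> ('g list \<Rightarrow> bool)) set"
  assumes "group G" "subgroup H G" "subgroup K G" "K \<subseteq> H" "infinite_index G H K" and \<Theta>: "finite \<Theta>"
  obtains b :: "nat \<Rightarrow> 'g" where "\<And>i. b i \<in> H"
    "\<And>is js h. \<lbrakk>sorted_wrt (<) is; sorted_wrt (<) js; length is = length js; is \<noteq> js; h \<in> K\<rbrakk>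
      \<Longrightarrow> rprod G (map b is) \<noteq> rprod G (map b js) \<otimes>\<^bsub>G\<^esub> h"
    "\<And>m Q is js. \<lbrakk>(m, Q) \<in> \<Theta>; sorted_wrt (<) is; length is = m; sorted_wrt (<) js; length js = m\<rbrakk>
      \<Longrightarrow> Q (map b is) = Q (map b js)"
proof -
  obtain c :: "nat \<Rightarrow> 'g" where c: "\<And>i. c i \<in> H"
    "\<And>is js h. \<lbrakk>sorted_wrt (<) is; sorted_wrt (<) js; length is = length js; is \<noteq> js; h \<in> K\<rbrakk>
      \<Longrightarrow> rprod G (map c is) \<noteq> rprod G (map c js) \<otimes>\<^bsub>G\<^esub> h"
    using independent_sequence[OF assms(1-5)] by blast
  let ?\<Theta> = "(\<lambda>(m, Q). (m, \<lambda>is. Q (map c is))) ` \<Theta>"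
  have "finite ?\<Theta>" using \<Theta> by (rule finite_imageI)
  from homogeneous_subset[OF this] obtain Y where Y0: "infinite Y \<and> (\<forall>(m, Q)\<in>?\<Theta>. \<forall>is js.
      sorted_wrt (<) is \<and> length is = m \<and> set is \<subseteq> Y \<and>
      sorted_wrt (<) js \<and> length js = m \<and> set js \<subseteq> Y \<longrightarrow> Q is = Q js)"
    by (elim exE)
  then have Y: "infinite Y" by (rule conjunct1)
  have hom: "Q (map c is) = Q (map c js)"
    if "(m, Q) \<in> \<Theta>" "sorted_wrt (<) is" "length is = m" "set is \<subseteq> Y"
      "sorted_wrt (<) js" "length js = m" "set js \<subseteq> Y" for m Q "is" js
  proof -
    have "\<forall>is js. sorted_wrt (<) is \<and> length is = m \<and> set is \<subseteq> Y \<and>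
      sorted_wrt (<) js \<and> length js = m \<and> set js \<subseteq> Y \<longrightarrow> Q (map c is) = Q (map c js)"
      using bspec[OF conjunct2[OF Y0] imageI[OF that(1)]] by (simp only: prod.case)
    from this[THEN spec, THEN spec, THEN mp] show ?thesis using that(2-) by blast
  qed
  let ?s = "enumerate Y"
  have mono: "sorted_wrt (<) (map ?s is)" if "sorted_wrt (<) is" for "is"
    using that Y by (auto simp: sorted_wrt_map enumerate_mono elim!: sorted_wrt_mono_rel[rotated])
  have inj: "map ?s is = map ?s js \<longleftrightarrow> is = js" for "is" js
    using strict_mono_enumerate[OF Y] by (auto dest: strict_mono_imp_inj_on inj_map_eq_map)
  have inY: "set (map ?s is) \<subseteq> Y" for "is" using enumerate_in_set[OF Y] by auto
  show ?thesis
  proof (rule that[of "c \<circ> ?s"])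
    show "(c \<circ> ?s) i \<in> H" for i using c(1) by simp
    show "rprod G (map (c \<circ> ?s) is) \<noteq> rprod G (map (c \<circ> ?s) js) \<otimes>\<^bsub>G\<^esub> h"
      if "sorted_wrt (<) is" "sorted_wrt (<) js" "length is = length js" "is \<noteq> js" "h \<in> K" for "is" js h
      using c(2)[OF mono mono _ _ that(5), of "is" js] that by (simp add: inj)
    show "Q (map (c \<circ> ?s) is) = Q (map (c \<circ> ?s) js)"
      if "(m, Q) \<in> \<Theta>" "sorted_wrt (<) is" "length is = m" "sorted_wrt (<) js" "length js = m" for m Q "is" js
    proof -
      have "Q (map c (map ?s is)) = Q (map c (map ?s js))"
        using that by (intro hom mono inY) simp_all
      then show ?thesis by (simp only: map_map)
    qed
  qed
qed

section \<open>Relative definability of cosets\<close>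

text \<open>\<open>P\<close> depends on finitely many coordinates. Those on the right are
  quantified; the remaining ones can be filled with any elements of their sorts.\<close>

lemma definable_Ex_right:
  assumes P: "definable M (case_sum Z X) B P"
    and ne: "\<And>i s. X i = Some s \<Longrightarrow> univ M s \<noteq> {}"
  shows "definable M Z B (\<lambda>z. \<exists>c. sorted_asg M X c \<and> P (case_sum z c))"
proof -
  let ?Y = "case_sum Z X"
  obtain F B' Q where F: "finite F" "F \<subseteq> dom ?Y" "B' \<subseteq> B" and Q: "definable M (?Y |` F) B' Q"
    "\<And>c. sorted_asg M ?Y c \<Longrightarrow> P c = Q c"
    by (rule definable_finite_support[OF P]) blast
  let ?S = "F \<inter> range Inr"
  let ?ov = "\<lambda>z c'. override_on (\<lambda>q. z (case_sum id undefined q)) c' ?S"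
  have "definable M (?Y |` F |` (- ?S)) B'
      (\<lambda>c. \<exists>c'. sorted_asg M (?Y |` F |` ?S) c' \<and> Q (override_on c c' ?S))"
    using F ne by (intro definable_Ex_finite Q) (auto simp: restrict_map_def split: if_splits)
  then have "definable M Z B' (\<lambda>z. \<exists>c'. sorted_asg M (?Y |` F |` ?S) c' \<and> Q (?ov z c'))"
    by (rule definable_reindex) (auto simp: restrict_map_def split: sum.splits if_splits)
  then have "definable M Z B (\<lambda>z. \<exists>c'. sorted_asg M (?Y |` F |` ?S) c' \<and> Q (?ov z c'))"
    using F(3) by (rule definable_mono[OF _ map_le_refl])
  moreover have "(\<exists>c. sorted_asg M X c \<and> P (case_sum z c)) \<longleftrightarrow>
      (\<exists>c'. sorted_asg M (?Y |` F |` ?S) c' \<and> Q (?ov z c'))" if z: "sorted_asg M Z z" for z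
  proof
    assume "\<exists>c. sorted_asg M X c \<and> P (case_sum z c)"
    then obtain c where c: "sorted_asg M X c" "P (case_sum z c)" by (elim exE conjE)
    then have s: "sorted_asg M ?Y (case_sum z c)" using z by (auto simp: sorted_asg_def split: sum.splits)
    have "Q (case_sum z c) \<longleftrightarrow> Q (?ov z (case_sum undefined c))"
      by (rule definable_restrict_cong[OF Q(1) s]) (auto simp: override_on_def split: sum.splits)
    with c(2) Q(2)[OF s] have "Q (?ov z (case_sum undefined c))" by simp
    moreover have "sorted_asg M (?Y |` F |` ?S) (case_sum undefined c)"
      using c(1) by (auto simp: sorted_asg_def restrict_map_def split: if_splits)
    ultimately show "\<exists>c'. sorted_asg M (?Y |` F |` ?S) c' \<and> Q (?ov z c')" by blast
  next
    assume "\<exists>c'. sorted_asg M (?Y |` F |` ?S) c' \<and> Q (?ov z c')"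
    then obtain c' where c': "sorted_asg M (?Y |` F |` ?S) c'" "Q (?ov z c')" by blast
    let ?c = "\<lambda>i. if Inr i \<in> F then c' (Inr i) else SOME a. a \<in> univ M (the (X i))"
    have "c' (Inr i) \<in> univ M s" if "X i = Some s" "Inr i \<in> F" for i s
      using c'(1)[unfolded sorted_asg_restrict] that by auto
    then have "?c i \<in> univ M s" if "X i = Some s" for i s
      using ne[OF that] that by (simp add: some_in_eq)
    then have c: "sorted_asg M X ?c" by (simp add: sorted_asg_def)
    then have s: "sorted_asg M ?Y (case_sum z ?c)" using z by (auto simp: sorted_asg_def split: sum.splits)
    have "Q (case_sum z ?c) \<longleftrightarrow> Q (?ov z c')"
      by (rule definable_restrict_cong[OF Q(1) s]) (auto simp: override_on_def split: sum.splits)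
    with c'(2) Q(2)[OF s] have "P (case_sum z ?c)" by simp
    with c show "\<exists>c. sorted_asg M X c \<and> P (case_sum z c)" by (intro exI[of _ ?c] conjI)
  qed
  ultimately show ?thesis by (subst definable_cong)
qed

lemma wf_tvar_iff: "wf_tvar M X \<longleftrightarrow> (\<forall>i s. X i = Some s \<longrightarrow> s \<in> sorts (lang M))"
  by (auto simp: wf_tvar_def ran_def)

lemma all_sum_iff: "(\<forall>x. P x) \<longleftrightarrow> (\<forall>a. P (Inl a)) \<and> (\<forall>b. P (Inr b))"
  by (metis sum.exhaust)

lemma wf_tvar_case_sum: "wf_tvar M Z \<Longrightarrow> wf_tvar M X \<Longrightarrow> wf_tvar M (case_sum Z X)"
  unfolding wf_tvar_iff by (subst all_sum_iff) simp

lemma dom_case_sum: "dom (case_sum Z X) = Inl ` dom Z \<union> Inr ` dom X"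
proof (rule Set.set_eqI)
  fix q show "q \<in> dom (case_sum Z X) \<longleftrightarrow> q \<in> Inl ` dom Z \<union> Inr ` dom X" by (cases q) auto
qed

lemma definable_iff:
  assumes "definable M X B P" "definable M X B Q"
  shows "definable M X B (\<lambda>c. P c \<longleftrightarrow> Q c)"
proof -
  have "definable M X B (\<lambda>c. \<not> (P c \<and> \<not> Q c) \<and> \<not> (Q c \<and> \<not> P c))"
    by (intro definable_conj definable_not assms)
  moreover have "(\<lambda>c. \<not> (P c \<and> \<not> Q c) \<and> \<not> (Q c \<and> \<not> P c)) = (\<lambda>c. P c \<longleftrightarrow> Q c)"
    by (intro ext) blast
  ultimately show ?thesis by simp
qed

section \<open>Compactness along a type-definable relation\<close>

locale eq_monster =
  fixes \<kappa> :: "'k rel" and T :: "('s, 'f, 'r) fm set" and M :: "('s, 'f, 'r, 'a) struc"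
  assumes mm: "monster_model \<kappa> T M"
begin

abbreviation N where "N \<equiv> eq_struc M"

lemma wf_M: "wf_struc M"
  using mm by (simp add: monster_model_def models_def)

lemmas card_\<kappa> = monster_model_card[OF mm]
lemmas N_nonempty = eq_struc_nonempty[OF wf_M]

text \<open>For replacing a parameter by a coordinate that has it as value: the two then have the
  same sort.\<close>

lemma N_disjoint:
  assumes "s \<in> sorts (eq_lang M)" "t \<in> sorts (eq_lang M)" "a \<in> univ N s" "a \<in> univ N t"
  shows "s = t"
  using assms wf_M by (cases s; cases t) (auto simp: wf_struc_def)

text \<open>If a type-definable relation determines the truth value of \<open>\<chi>\<close> at its second
  argument, then by compactness so does a formula in the first argument.\<close>

lemma definable_along_type:
  fixes Z :: "('j, ('s, 'f, 'r) eqsort) tvar" and X :: "('i, ('s, 'f, 'r) eqsort) tvar"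
  assumes Z: "wf_tvar N Z" "small \<kappa> (dom Z)" and X: "wf_tvar N X" "small \<kappa> (dom X)"
    and B: "B \<subseteq> elems N" "small \<kappa> B"
    and \<P>: "\<And>P. P \<in> \<P> \<Longrightarrow> definable N (case_sum Z X) B P"
    and \<chi>: "definable N (case_sum Z X) B \<chi>"
    and determined: "\<And>z c c'. sorted_asg N Z z \<Longrightarrow> sorted_asg N X c \<Longrightarrow> sorted_asg N X c' \<Longrightarrow>
      (\<And>P. P \<in> \<P> \<Longrightarrow> P (case_sum z c) \<and> P (case_sum z c')) \<Longrightarrow> \<chi> (case_sum z c) \<Longrightarrow> \<chi> (case_sum z c')"
  shows "\<exists>\<theta>. definable N Z B \<theta> \<and> (\<forall>z c. sorted_asg N Z z \<longrightarrow> sorted_asg N X c \<longrightarrow>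
    (\<forall>P\<in>\<P>. P (case_sum z c)) \<longrightarrow> \<theta> z = \<chi> (case_sum z c))"
proof -
  let ?Y = "case_sum Z (case_sum X X)"
  let ?l = "\<lambda>P (y :: 'j + 'i + 'i \<Rightarrow> ('s, 'f, 'r, 'a) eqelem). P (\<lambda>q. y (case_sum Inl (\<lambda>i. Inr (Inl i)) q))"
  let ?r = "\<lambda>P (y :: 'j + 'i + 'i \<Rightarrow> ('s, 'f, 'r, 'a) eqelem). P (\<lambda>q. y (case_sum Inl (\<lambda>i. Inr (Inr i)) q))"
  \<comment> \<open>Two tuples related to the same \<open>z\<close>, with \<chi> true of one and
    false of the other. By \<open>determined\<close> this is inconsistent, so by saturation finitely
    many members of \<open>\<P>\<close> already determine \<chi>.\<close>
  let ?\<U> = "?l ` \<P> \<union> ?r ` \<P> \<union> {?l \<chi>, \<lambda>y. \<not> ?r \<chi> y}"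
  have ne: "univ N s \<noteq> {}" if "X i = Some s" for i s
    using that X(1) N_nonempty(2) by (auto simp: wf_tvar_def ran_def)
  have lr: "definable N ?Y B (?l P)" "definable N ?Y B (?r P)" if "definable N (case_sum Z X) B P" for P
    using that by (rule definable_reindex; auto split: sum.splits)+
  have val: "sorted_asg N Z (\<lambda>j. y (Inl j))" "sorted_asg N X (\<lambda>i. y (Inr (Inl i)))"
    "sorted_asg N X (\<lambda>i. y (Inr (Inr i)))" if "sorted_asg N ?Y y" for y
    using that by (auto simp: sorted_asg_def)
  have split: "(\<lambda>q. y (case_sum Inl (\<lambda>i. Inr (Inl i)) q)) = case_sum (\<lambda>j. y (Inl j)) (\<lambda>i. y (Inr (Inl i)))"
    "(\<lambda>q. y (case_sum Inl (\<lambda>i. Inr (Inr i)) q)) = case_sum (\<lambda>j. y (Inl j)) (\<lambda>i. y (Inr (Inr i)))"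
    for y :: "'j + 'i + 'i \<Rightarrow> ('s, 'f, 'r, 'a) eqelem"
    by (auto simp: fun_eq_iff split: sum.splits)
  have "\<not> fin_sat N ?Y ?\<U>"
  proof
    assume fin: "fin_sat N ?Y ?\<U>"
    have "\<exists>y. sorted_asg N ?Y y \<and> (\<forall>P\<in>?\<U>. P y)"
    proof (rule saturated_eq_struc[OF mm _ _ B _ fin])
      show "wf_tvar N ?Y" by (intro wf_tvar_case_sum Z X)
      show "small \<kappa> (dom ?Y)" unfolding dom_case_sum
        by (intro small_Un card_\<kappa> small_image Z X)
      show "definable N ?Y B P" if "P \<in> ?\<U>" for P
      proof -
        from that consider Q where "Q \<in> \<P>" "P = ?l Q" | Q where "Q \<in> \<P>" "P = ?r Q"
          | "P = ?l \<chi>" | "P = (\<lambda>y. \<not> ?r \<chi> y)"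
          by blast
        then show ?thesis
        proof cases
          case 4
          then show ?thesis using definable_not[OF lr(2)[OF \<chi>]] by (simp only:)
        qed (simp_all only: lr \<P> \<chi>)
      qed
    qed
    then obtain y where y: "sorted_asg N ?Y y \<and> (\<forall>P\<in>?\<U>. P y)" by (rule exE)
    have P: "P y" if "P \<in> ?\<U>" for P using conjunct2[OF y] that by (rule bspec)
    have "\<chi> (case_sum (\<lambda>j. y (Inl j)) (\<lambda>i. y (Inr (Inr i))))"
    proof (rule determined[OF val[OF conjunct1[OF y]]])
      show "Q (case_sum (\<lambda>j. y (Inl j)) (\<lambda>i. y (Inr (Inl i)))) \<and>
          Q (case_sum (\<lambda>j. y (Inl j)) (\<lambda>i. y (Inr (Inr i))))" if "Q \<in> \<P>" for Q
      proof -
        have "?l Q \<in> ?\<U>" "?r Q \<in> ?\<U>" using that by blast+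
        from P[OF this(1)] P[OF this(2)] show ?thesis unfolding split by blast
      qed
      have "?l \<chi> \<in> ?\<U>" by blast
      from P[OF this] show "\<chi> (case_sum (\<lambda>j. y (Inl j)) (\<lambda>i. y (Inr (Inl i))))" unfolding split .
    qed
    moreover have "(\<lambda>y. \<not> ?r \<chi> y) \<in> ?\<U>" by blast
    from P[OF this] have "\<not> \<chi> (case_sum (\<lambda>j. y (Inl j)) (\<lambda>i. y (Inr (Inr i))))" unfolding split .
    ultimately show False by blast
  qed
  then have "\<exists>\<Q>. \<Q> \<subseteq> ?\<U> \<and> finite \<Q> \<and> \<not> (\<exists>y. sorted_asg N ?Y y \<and> (\<forall>P\<in>\<Q>. P y))"
    unfolding fin_sat_def not_all not_imp .
  then obtain \<Q> where \<Q>: "\<Q> \<subseteq> ?\<U>" "finite \<Q>" "\<not> (\<exists>y. sorted_asg N ?Y y \<and> (\<forall>P\<in>\<Q>. P y))"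
    by (elim exE conjE)
  obtain \<Q>l where \<Q>l: "\<Q>l \<subseteq> \<P>" "finite \<Q>l" "\<Q> \<inter> ?l ` \<P> = ?l ` \<Q>l"
    using finite_subset_image[of "\<Q> \<inter> ?l ` \<P>" ?l \<P>] \<Q>(2) by auto
  obtain \<Q>r where \<Q>r: "\<Q>r \<subseteq> \<P>" "finite \<Q>r" "\<Q> \<inter> ?r ` \<P> = ?r ` \<Q>r"
    using finite_subset_image[of "\<Q> \<inter> ?r ` \<P>" ?r \<P>] \<Q>(2) by auto
  let ?\<P> = "\<Q>l \<union> \<Q>r"
  have fin_determined: "\<chi> (case_sum z c')"
    if s: "sorted_asg N Z z" "sorted_asg N X c" "sorted_asg N X c'"
      and P: "\<And>P. P \<in> ?\<P> \<Longrightarrow> P (case_sum z c)" "\<And>P. P \<in> ?\<P> \<Longrightarrow> P (case_sum z c')"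
      and "\<chi> (case_sum z c)" for z c c'
  proof (rule ccontr)
    assume n: "\<not> \<chi> (case_sum z c')"
    let ?y = "case_sum z (case_sum c c')"
    have sp: "(\<lambda>q. ?y (case_sum Inl (\<lambda>i. Inr (Inl i)) q)) = case_sum z c"
      "(\<lambda>q. ?y (case_sum Inl (\<lambda>i. Inr (Inr i)) q)) = case_sum z c'"
      by (auto simp: fun_eq_iff split: sum.splits)
    have "U ?y" if "U \<in> \<Q>" for U
    proof -
      from that \<Q>(1) consider "U \<in> \<Q> \<inter> ?l ` \<P>" | "U \<in> \<Q> \<inter> ?r ` \<P>" | "U = ?l \<chi>" | "U = (\<lambda>y. \<not> ?r \<chi> y)"
        by blast
      then show ?thesis
      proof cases
        case 1
        then obtain Q where "Q \<in> \<Q>l" "U = ?l Q" unfolding \<Q>l(3) by (rule imageE)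
        then show ?thesis using P(1)[of Q] by (simp only: sp Un_iff simp_thms)
      next
        case 2
        then obtain Q where "Q \<in> \<Q>r" "U = ?r Q" unfolding \<Q>r(3) by (rule imageE)
        then show ?thesis using P(2)[of Q] by (simp only: sp Un_iff simp_thms)
      next
        case 3
        then show ?thesis using \<open>\<chi> (case_sum z c)\<close> by (simp only: sp)
      next
        case 4
        then show ?thesis using n by (simp only: sp simp_thms)
      qed
    qed
    moreover have "sorted_asg N ?Y ?y" using s by (auto simp: sorted_asg_def split: sum.splits)
    ultimately have "sorted_asg N ?Y ?y \<and> (\<forall>P\<in>\<Q>. P ?y)" by (intro conjI ballI)
    then show False by (rule notE[OF \<Q>(3) exI])
  qed
  \<comment> \<open>As the finite part determines \<chi>, its truth at one realization is its truth
    at all, so an existential quantifier yields the formula.\<close>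
  let ?\<theta> = "\<lambda>z. \<exists>c. sorted_asg N X c \<and> (\<forall>P\<in>?\<P>. P (case_sum z c)) \<and> \<chi> (case_sum z c)"
  have "definable N (case_sum Z X) B (\<lambda>y. (\<forall>P\<in>?\<P>. P y) \<and> \<chi> y)"
    using \<Q>l \<Q>r N_nonempty(1)
    by (intro definable_conj[OF _ \<chi>] definable_Ball \<P>) auto
  then have "definable N Z B ?\<theta>"
    by (rule definable_Ex_right) (rule ne)
  moreover have "?\<theta> z = \<chi> (case_sum z c)"
    if s: "sorted_asg N Z z" "sorted_asg N X c" and P: "\<forall>P\<in>\<P>. P (case_sum z c)" for z c
  proof
    have P': "P (case_sum z c)" if "P \<in> ?\<P>" for P
      by (rule bspec[OF P]) (use that \<Q>l(1) \<Q>r(1) in blast)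
    assume "?\<theta> z"
    then obtain c0 where c0: "sorted_asg N X c0" "\<forall>P\<in>?\<P>. P (case_sum z c0)" "\<chi> (case_sum z c0)"
      by (elim exE conjE)
    show "\<chi> (case_sum z c)"
    proof (rule fin_determined[OF s(1) c0(1) s(2)])
      show "P (case_sum z c0)" if "P \<in> ?\<P>" for P using c0(2) that by (rule bspec)
      show "P (case_sum z c)" if "P \<in> ?\<P>" for P using that by (rule P')
    qed (rule c0(3))
  next
    have P': "\<forall>P\<in>?\<P>. P (case_sum z c)"
      by (rule ballI, rule bspec[OF P]) (use \<Q>l(1) \<Q>r(1) in blast)
    assume "\<chi> (case_sum z c)"
    with s(2) P' show "?\<theta> z" by (intro exI[of _ c] conjI)
  qed
  ultimately show ?thesis by (intro exI[of _ ?\<theta>] conjI allI impI)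
qed

end

lemma case_sum_eq_iff: "case_sum f g = case_sum f' g' \<longleftrightarrow> f = f' \<and> g = g'"
  by (auto elim: case_sum_inject)

lemma holds_pneg: "holds M (pneg \<psi>) c \<longleftrightarrow> \<not> holds M \<psi> c"
  by (simp add: pneg_def holds_def)

lemma holds_agree:
  assumes "\<psi> \<in> pfms M X B" "\<And>i s. X i = Some s \<Longrightarrow> c i = c' i"
  shows "holds M \<psi> c \<longleftrightarrow> holds M \<psi> c'"
proof (cases \<psi>)
  case (Pair \<phi> \<sigma>)
  show ?thesis unfolding Pair by (rule holds_cong[OF assms(1)[unfolded Pair] assms(2)])
qed

section \<open>Membership in cosets of a type-definable group\<close>

locale tdef_group = eq_monster \<kappa> T M
  for \<kappa> :: "'k rel" and T :: "('s, 'f, 'r) fm set" and M :: "('s, 'f, 'r, 'a) struc" +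
  fixes X :: "('i, ('s, 'f, 'r) eqsort) tvar" and A :: "('s, 'f, 'r, 'a) eqelem set"
    and G :: "('i \<Rightarrow> ('s, 'f, 'r, 'a) eqelem) monoid" (structure)
  assumes X: "wf_tvar N X" "small \<kappa> (dom X)" and A: "A \<subseteq> elems N" "small \<kappa> A"
    and tdef: "type_definable_group_over N X A G"
begin

sublocale group G
  using tdef by (simp add: type_definable_group_over_def)

text \<open>An assignment \<open>z\<close> holds many tuples, named by \<open>w\<close>. Outside the
  domain of \<open>X\<close> the value is normalized, because the elements of \<open>G\<close> are
  tuples that are \<open>undefined\<close> there.\<close>

definition block :: "('w \<times> 'i \<Rightarrow> ('s, 'f, 'r, 'a) eqelem) \<Rightarrow> 'w \<Rightarrow> 'i \<Rightarrow> ('s, 'f, 'r, 'a) eqelem" where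
  "block z w = (\<lambda>i. if X i = None then undefined else z (w, i))"

lemma carrier_tuples: "c \<in> carrier G \<Longrightarrow> c \<in> tuples N X"
  using tdef by (auto simp: type_definable_group_over_def type_definable_over_def solutions_def)

lemma carrier_ext: "c \<in> carrier G \<Longrightarrow> (\<lambda>i. if X i = None then undefined else c i) = c"
  using carrier_tuples[of c] by (simp add: tuples_iff fun_eq_iff)

lemma block_sorted: "block z w \<in> carrier G \<Longrightarrow> X i = Some s \<Longrightarrow> z (w, i) \<in> univ N s"
  using carrier_tuples[of "block z w"] by (fastforce simp: tuples_iff sorted_asg_def block_def)

abbreviation blocks_tvar :: "('w \<times> 'i, ('s, 'f, 'r) eqsort) tvar" where
  "blocks_tvar \<equiv> \<lambda>(w, i). X i"

lemma blocks_sorted: "(\<And>w. block z w \<in> carrier G) \<Longrightarrow> sorted_asg N blocks_tvar z"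
  by (auto simp: sorted_asg_def intro: block_sorted)

text \<open>Only the graph of multiplication is type-definable, so the coset relation is not visibly
  given by a formula. Induction on the number of factors: x lies in a y K iff a^-1 x lies in y K,
  and a^-1 x is determined by a and x along the graph, so \<open>definable_along_type\<close>
  applies. The result is correct for elements of \<open>G\<close> only.\<close>

lemma coset_definable:
  assumes K: "subgroup K G" "K = {c \<in> carrier G. holds N \<chi> c}" and \<chi>: "\<chi> \<in> pfms N X A"
  shows "\<exists>R. definable N blocks_tvar A R \<and> (\<forall>z. (\<forall>l::nat. block z l \<in> carrier G) \<longrightarrow>
    R z = (\<exists>k\<in>K. block z 0 = rprod G (map (block z) [1..<Suc m]) \<otimes> k))"
proof (induction m)
  case 0
  have "definable N blocks_tvar A (\<lambda>z. holds N \<chi> (\<lambda>i. z (0 :: nat, i)))"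
    using definable_holds[OF \<chi>] by (rule definable_reindex) simp
  moreover have "holds N \<chi> (\<lambda>i. z (0, i)) = (\<exists>k\<in>K. block z 0 = \<one> \<otimes> k)"
    if z: "\<forall>l. block z l \<in> carrier G" for z :: "nat \<times> 'i \<Rightarrow> ('s, 'f, 'r, 'a) eqelem"
  proof -
    have "holds N \<chi> (\<lambda>i. z (0, i)) = holds N \<chi> (block z 0)"
      by (rule holds_agree[OF \<chi>]) (simp add: block_def)
    also have "\<dots> = (block z 0 \<in> K)" using z K(2) by simp
    also have "\<dots> = (\<exists>k\<in>K. block z 0 = \<one> \<otimes> k)"
      using subgroup.mem_carrier[OF K(1)] by auto
    finally show ?thesis .
  qed
  ultimately show ?case by (intro exI[of _ "\<lambda>z. holds N \<chi> (\<lambda>i. z (0, i))"]) simp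
next
  case (Suc m)
  then obtain R where R: "definable N blocks_tvar A R" and
    R_iff: "\<And>z. (\<And>l. block z l \<in> carrier G) \<Longrightarrow>
      R z = (\<exists>k\<in>K. block z 0 = rprod G (map (block z) [1..<Suc m]) \<otimes> k)"
    by blast
  obtain \<Gamma> where \<Gamma>: "\<Gamma> \<subseteq> pfms N (case_sum X (case_sum X X)) A" and
    graph: "{case_sum a (case_sum b (a \<otimes> b)) | a b. a \<in> carrier G \<and> b \<in> carrier G} =
      solutions N (case_sum X (case_sum X X)) \<Gamma>"
    using tdef by (auto simp: type_definable_group_over_def type_definable_over_def)
  let ?Z = "blocks_tvar :: (nat \<times> 'i, ('s, 'f, 'r) eqsort) tvar"
  \<comment> \<open>Reading the graph: block \<open>Suc m\<close> is the left factor, the new tuple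
    is the right factor, block 0 is the product.\<close>
  let ?g = "\<lambda>q. case q of Inl i \<Rightarrow> Inl (Suc m, i) | Inr (Inl i) \<Rightarrow> Inr i | Inr (Inr i) \<Rightarrow> Inl (0 :: nat, i)"
  \<comment> \<open>In \<open>R\<close> the new tuple takes the place of block 0.\<close>
  let ?h = "\<lambda>(l, i). if l = 0 then Inr i else Inl (l :: nat, i :: 'i)"
  let ?\<P> = "(\<lambda>\<psi> y. holds N \<psi> (\<lambda>q. y (?g q))) ` \<Gamma>"
  let ?\<chi> = "\<lambda>y. R (\<lambda>q. y (?h q))"
  let ?e = "\<lambda>c :: 'i \<Rightarrow> ('s, 'f, 'r, 'a) eqelem. (\<lambda>i. if X i = None then undefined else c i)"
  have graph_iff: "(\<forall>P\<in>?\<P>. P (case_sum z c)) \<longleftrightarrow>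
      block z (Suc m) \<in> carrier G \<and> ?e c \<in> carrier G \<and> block z 0 = block z (Suc m) \<otimes> ?e c"
    if z: "sorted_asg N ?Z z" and c: "sorted_asg N X c" for z c
  proof -
    let ?t = "case_sum (block z (Suc m)) (case_sum (?e c) (block z 0))"
    have t: "?t \<in> tuples N (case_sum X (case_sum X X))"
      using z c by (auto simp: tuples_iff sorted_asg_def block_def split: sum.splits)
    have "holds N \<psi> (\<lambda>q. case_sum z c (?g q)) = holds N \<psi> ?t" if "\<psi> \<in> \<Gamma>" for \<psi>
    proof -
      have "case_sum z c (?g q) = ?t q" if "case_sum X (case_sum X X) q = Some s" for q s
        using that by (auto simp: block_def split: sum.splits)
      then show ?thesis
        using \<Gamma> \<open>\<psi> \<in> \<Gamma>\<close> by (intro holds_agree[where X="case_sum X (case_sum X X)"]) auto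
    qed
    then have "(\<forall>P\<in>?\<P>. P (case_sum z c)) \<longleftrightarrow> ?t \<in> solutions N (case_sum X (case_sum X X)) \<Gamma>"
      using t by (simp add: solutions_def)
    also have "\<dots> \<longleftrightarrow> (\<exists>a b. ?t = case_sum a (case_sum b (a \<otimes> b)) \<and> a \<in> carrier G \<and> b \<in> carrier G)"
      unfolding graph[symmetric] by blast
    also have "\<dots> \<longleftrightarrow> block z (Suc m) \<in> carrier G \<and> ?e c \<in> carrier G \<and> block z 0 = block z (Suc m) \<otimes> ?e c"
      by (auto simp: case_sum_eq_iff)
    finally show ?thesis .
  qed
  have "\<exists>\<theta>. definable N ?Z A \<theta> \<and> (\<forall>z c. sorted_asg N ?Z z \<longrightarrow> sorted_asg N X c \<longrightarrow>
      (\<forall>P\<in>?\<P>. P (case_sum z c)) \<longrightarrow> \<theta> z = ?\<chi> (case_sum z c))"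
  proof (rule definable_along_type[OF _ _ X A])
    show "wf_tvar N ?Z" using X(1) by (auto simp: wf_tvar_iff)
    have "dom ?Z \<subseteq> UNIV \<times> dom X" by auto
    then show "small \<kappa> (dom ?Z)"
      using small_Times[OF card_\<kappa>(1,2) card_\<kappa>(3) X(2)] by (rule small_subset)
    show \<chi>: "definable N (case_sum ?Z X) A ?\<chi>"
      using R by (rule definable_reindex) (auto split: if_splits)
    show "definable N (case_sum ?Z X) A P" if P: "P \<in> ?\<P>" for P
    proof -
      obtain \<psi> where \<psi>: "\<psi> \<in> \<Gamma>" "P = (\<lambda>y. holds N \<psi> (\<lambda>q. y (?g q)))" using P by (elim imageE)
      have "definable N (case_sum X (case_sum X X)) A (holds N \<psi>)"
        using \<psi>(1) \<Gamma> by (intro definable_holds) blast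
      then show ?thesis unfolding \<psi>(2) by (rule definable_reindex) (auto split: sum.splits)
    qed
    fix z c c' assume s: "sorted_asg N ?Z z" "sorted_asg N X c" "sorted_asg N X c'"
      and P: "\<And>P. P \<in> ?\<P> \<Longrightarrow> P (case_sum z c) \<and> P (case_sum z c')" and "?\<chi> (case_sum z c)"
    have "\<forall>P\<in>?\<P>. P (case_sum z c)" "\<forall>P\<in>?\<P>. P (case_sum z c')"
      by (rule ballI, drule P, erule conjunct1) (rule ballI, drule P, erule conjunct2)
    then have "block z (Suc m) \<in> carrier G" "?e c \<in> carrier G" "?e c' \<in> carrier G"
      "block z (Suc m) \<otimes> ?e c = block z (Suc m) \<otimes> ?e c'"
      unfolding graph_iff[OF s(1,2)] graph_iff[OF s(1,3)] by simp_all
    then have "?e c = ?e c'" by simp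
    then have "c i = c' i" if "X i = Some t" for i t
      using that by (metis option.distinct(1))
    then have "?\<chi> (case_sum z c) = ?\<chi> (case_sum z c')"
      using s by (intro definable_asg_cong[OF \<chi>]) (auto simp: sorted_asg_def split: sum.splits)
    with \<open>?\<chi> (case_sum z c)\<close> show "?\<chi> (case_sum z c')" by (rule iffD1[rotated])
  qed
  then obtain \<theta> where \<theta>: "definable N ?Z A \<theta>" and \<theta>_iff: "\<And>z c. sorted_asg N ?Z z \<Longrightarrow> sorted_asg N X c \<Longrightarrow>
      (\<forall>P\<in>?\<P>. P (case_sum z c)) \<Longrightarrow> \<theta> z = ?\<chi> (case_sum z c)"
    by (elim exE conjE) (simp only: simp_thms)
  have "\<theta> z = (\<exists>k\<in>K. block z 0 = rprod G (map (block z) [1..<Suc (Suc m)]) \<otimes> k)"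
    if z: "\<forall>l. block z l \<in> carrier G" for z
  proof -
    let ?a = "block z (Suc m)" and ?x = "block z 0"
    \<comment> \<open>The tuple that the graph assigns to \<open>z\<close>: block 0 with its
      leftmost factor removed.\<close>
    let ?c = "inv ?a \<otimes> ?x"
    have ax: "?a \<in> carrier G" "?x \<in> carrier G" "?c \<in> carrier G" using z by simp_all
    have s: "sorted_asg N ?Z z" "sorted_asg N X ?c"
      using blocks_sorted z carrier_tuples[OF ax(3)] by (auto simp: tuples_iff)
    have "\<forall>P\<in>?\<P>. P (case_sum z ?c)"
      unfolding graph_iff[OF s] carrier_ext[OF ax(3)] using ax by (simp flip: m_assoc)
    then have \<theta>R: "\<theta> z = R (\<lambda>q. case_sum z ?c (?h q))" by (rule \<theta>_iff[OF s])
    have bl: "block (\<lambda>q. case_sum z ?c (?h q)) l = (if l = 0 then ?c else block z l)" for l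
    proof (cases "l = 0")
      case True
      have "block (\<lambda>q. case_sum z ?c (?h q)) 0 = ?e ?c"
        unfolding block_def[of "\<lambda>q. case_sum z ?c (?h q)"] by (rule ext) simp
      then show ?thesis using True carrier_ext[OF ax(3)] by simp
    qed (auto simp: block_def fun_eq_iff)
    have map: "map (block (\<lambda>q. case_sum z ?c (?h q))) [1..<Suc m] = map (block z) [1..<Suc m]"
      using bl by auto
    have b0: "block (\<lambda>q. case_sum z ?c (?h q)) 0 = ?c" using bl by simp
    have "\<theta> z = (\<exists>k\<in>K. block (\<lambda>q. case_sum z ?c (?h q)) 0 =
        rprod G (map (block (\<lambda>q. case_sum z ?c (?h q))) [1..<Suc m]) \<otimes> k)"
      unfolding \<theta>R by (rule R_iff) (use z ax(3) in \<open>simp only: bl split: if_splits\<close>, simp)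
    then have "\<theta> z = (\<exists>k\<in>K. ?c = rprod G (map (block z) [1..<Suc m]) \<otimes> k)"
      unfolding map b0 .
    also have "\<dots> = (\<exists>k\<in>K. ?x = (?a \<otimes> rprod G (map (block z) [1..<Suc m])) \<otimes> k)"
    proof (intro bex_cong refl)
      fix k assume "k \<in> K"
      then have k: "k \<in> carrier G" by (rule subgroup.mem_carrier[OF K(1)])
      have r: "rprod G (map (block z) [1..<Suc m]) \<in> carrier G"
        using z by (intro rprod_closed) auto
      show "(?c = rprod G (map (block z) [1..<Suc m]) \<otimes> k) =
          (?x = (?a \<otimes> rprod G (map (block z) [1..<Suc m])) \<otimes> k)"
        using ax k r by (metis inv_solve_left m_assoc m_closed)
    qed
    finally show ?thesis by simp
  qed
  with \<theta> show ?case by (intro exI[of _ \<theta>] conjI allI impI)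
qed

end

text \<open>The dividing formula demands \<open>R\<close> at the even choice of indices and at no
  other. Skew dividing allows no parameters besides the sequence and wants its tuples indexed by
  numbers. So parameters from \<open>B\<close> become constant coordinates of the sequence, which
  remains indiscernible over \<open>A\<close> because \<open>b\<close> is homogeneous over
  \<open>B\<close>, and only coordinates that occur in the formula are kept.\<close>

lemma skew_dividesI:
  fixes M :: "('s, 'f, 'r, 'a) struc" and X :: "('i, 's) tvar" and Xb :: "('j, 's) tvar"
  assumes ne: "sorts (lang M) \<noteq> {}" and k: "k \<ge> 1" and AB: "A \<subseteq> B" and BE: "B \<subseteq> E"
    and b: "\<And>n. sorted_asg M Xb (b n)" and bE: "\<And>n j s. Xb j = Some s \<Longrightarrow> b n j \<in> E"
    and hom: "\<And>m \<theta> is js. definable M (\<lambda>(l, j). if l < m then Xb j else None) B \<theta> \<Longrightarrow>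
      sorted_wrt (<) is \<Longrightarrow> sorted_wrt (<) js \<Longrightarrow> length is = m \<Longrightarrow> length js = m \<Longrightarrow>
      \<theta> (\<lambda>(l, j). b (is ! l) j) = \<theta> (\<lambda>(l, j). b (js ! l) j)"
    and R: "definable M (case_sum X (\<lambda>(l, j). if l < k then Xb j else None)) B R"
    and x: "sorted_asg M X x"
    and Rx: "\<And>is. sorted_wrt (<) is \<Longrightarrow> length is = k \<Longrightarrow> set is \<subseteq> {..<2 * k} \<Longrightarrow>
      R (case_sum x (\<lambda>(l, j). b (is ! l) j)) \<longleftrightarrow> is = map (\<lambda>l. 2 * l) [0..<k]"
  shows "\<exists>\<psi>\<in>pfms M X E. holds M \<psi> x \<and> skew_divides M X k A {\<psi>}"
proof -
  let ?XR = "case_sum X (\<lambda>(l, j). if l < k then Xb j else None)"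
  let ?ev = "map (\<lambda>l. 2 * l) [0..<k]"
  obtain \<phi> \<sigma> where \<phi>: "(\<phi>, \<sigma>) \<in> pfms M ?XR B"
    "\<And>c. sorted_asg M ?XR c \<Longrightarrow> R c = holds M (\<phi>, \<sigma>) c"
    using R by (auto simp: definable_def)
  have wf: "wf_fm (lang M) \<phi>" using \<phi>(1) by (simp add: pfms_iff)
  have \<sigma>1: "X i = Some (fst v)" if "v \<in> fv \<phi>" "\<sigma> v = Inl (Inl i)" for v i
    using \<phi>(1) that by (auto simp: pfms_iff)
  have \<sigma>2: "l < k" "Xb j = Some (fst v)" if "v \<in> fv \<phi>" "\<sigma> v = Inl (Inr (l, j))" for v l j
    using \<phi>(1) that by (auto simp: pfms_iff split: if_splits)
  have \<sigma>3: "a \<in> B" "a \<in> univ M (fst v)" if "v \<in> fv \<phi>" "\<sigma> v = Inr a" for v a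
    using \<phi>(1) that by (auto simp: pfms_iff)
  obtain h :: "'s var \<Rightarrow> nat" where h: "inj_on h (fv \<phi>)"
    using finite_imp_inj_to_nat_seg[OF finite_fv] by metis
  define hi where "hi = inv_into (fv \<phi>) h"
  have hi: "hi (h v) = v" if "v \<in> fv \<phi>" for v
    unfolding hi_def using h that by (rule inv_into_f_f)
  \<comment> \<open>One coordinate for each variable of \<phi> that is not attached to
    \<open>X\<close>; it holds a coordinate of \<open>b\<close> or a constant.\<close>
  define Y where "Y j = (if j \<in> h ` fv \<phi> then (case \<sigma> (hi j) of Inl (Inl i) \<Rightarrow> None | _ \<Rightarrow> Some (fst (hi j))) else None)" for j
  define b' where "b' n j = (if Y j = None then undefined else
    (case \<sigma> (hi j) of Inl (Inr (l, j')) \<Rightarrow> b n j' | Inr a \<Rightarrow> a))" for n j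
  \<comment> \<open>A constant is the same in all terms of the sequence; it is read off the term at
    position 0, which exists since k \<ge> 1.\<close>
  define \<tau> where "\<tau> v = (case \<sigma> v of Inl (Inl i) \<Rightarrow> Inl i | Inl (Inr (l, j)) \<Rightarrow> Inr (l, h v) | Inr a \<Rightarrow> Inr (0, h v))" for v
  have Y_D: "\<exists>v\<in>fv \<phi>. j = h v \<and> s = fst v \<and> (\<forall>i. \<sigma> v \<noteq> Inl (Inl i))" if "Y j = Some s" for j s
    using that hi by (auto simp: Y_def split: if_splits sum.splits)
  have Y_h: "Y (h v) = Some (fst v)" if "v \<in> fv \<phi>" "\<And>i. \<sigma> v \<noteq> Inl (Inl i)" for v
    using that hi by (auto simp: Y_def split: sum.splits)
  have b'_tuple: "b' n \<in> tuples M Y" for n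
  proof -
    have "b' n j \<in> univ M s" if Yj: "Y j = Some s" for j s
    proof -
      obtain v where v: "v \<in> fv \<phi>" "j = h v" "s = fst v" "\<forall>i. \<sigma> v \<noteq> Inl (Inl i)"
        using Y_D[OF Yj] by blast
      show ?thesis
        using b[of n] v Yj hi[OF v(1)] \<sigma>2[OF v(1)] \<sigma>3(2)[OF v(1)]
        by (auto simp: b'_def sorted_asg_def split: sum.splits)
    qed
    then show ?thesis by (auto simp: tuples_iff sorted_asg_def b'_def)
  qed
  have ind: "indiscernible M Y A b'"
    unfolding indiscernible_def
  proof (intro conjI allI impI ballI b'_tuple)
    fix m :: nat and "is" js :: "nat list" and \<psi>
    let ?Ym = "\<lambda>(l, j). if l < m then Y j else None"
    assume l: "sorted_wrt (<) is" "sorted_wrt (<) js" "length is = m" "length js = m"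
      and \<psi>: "\<psi> \<in> pfms M ?Ym A"
    let ?f = "\<lambda>(l, j). case \<sigma> (hi j) of Inl (Inr (l', j')) \<Rightarrow> Inl (l, j') | Inr a \<Rightarrow> Inr a"
    let ?P = "\<lambda>c. holds M \<psi> (\<lambda>q. case_sum c (\<lambda>a. a) (?f q))"
    have "definable M (\<lambda>(l, j). if l < m then Xb j else None) B ?P"
    proof (rule definable_subst[OF definable_holds[OF \<psi>] AB])
      fix q s assume q: "?Ym q = Some s"
      then obtain l j where lj: "q = (l, j)" "l < m" "Y j = Some s" by (cases q) (auto split: if_splits)
      obtain v where v: "v \<in> fv \<phi>" "j = h v" "s = fst v" "\<forall>i. \<sigma> v \<noteq> Inl (Inl i)"
        using Y_D[OF lj(3)] by blast
      show "case ?f q of Inl q \<Rightarrow> (case q of (l, j) \<Rightarrow> if l < m then Xb j else None) = Some s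
          | Inr a \<Rightarrow> a \<in> B \<inter> univ M s"
        using v lj hi[OF v(1)] \<sigma>2[OF v(1)] \<sigma>3[OF v(1)] by (auto split: sum.splits)
    qed
    then have "?P (\<lambda>(l, j). b (is ! l) j) = ?P (\<lambda>(l, j). b (js ! l) j)"
      using l by (rule hom)
    moreover have "holds M \<psi> (\<lambda>(l, j). b' (is ! l) j) = ?P (\<lambda>(l, j). b (is ! l) j)" for "is"
    proof -
      have "(\<lambda>(l, j). b' (is ! l) j) q = case_sum (\<lambda>(l, j). b (is ! l) j) (\<lambda>a. a) (?f q)"
        if q: "?Ym q = Some s" for q s
      proof -
        obtain l j where lj: "q = (l, j)" "l < m" "Y j = Some s"
          using q by (cases q) (auto split: if_splits)
        obtain v where v: "v \<in> fv \<phi>" "j = h v" "s = fst v" "\<forall>i. \<sigma> v \<noteq> Inl (Inl i)"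
          using Y_D[OF lj(3)] by blast
        show ?thesis
          using v lj hi[OF v(1)] by (auto simp: b'_def split: sum.splits)
      qed
      then show ?thesis by (rule holds_agree[OF \<psi>])
    qed
    ultimately show "holds M \<psi> (\<lambda>(l, j). b' (is ! l) j) = holds M \<psi> (\<lambda>(l, j). b' (js ! l) j)" by simp
  qed
  have wfY: "wf_tvar M Y"
    unfolding wf_tvar_iff using Y_D fv_sorts[OF wf] by blast
  have plug: "holds M (plug \<phi> \<tau> b' is) c = R (case_sum c (\<lambda>(l, j). b (is ! l) j))"
    if c: "sorted_asg M X c" for c "is"
  proof -
    have "sorted_asg M ?XR (case_sum c (\<lambda>(l, j). b (is ! l) j))"
      using c b by (auto simp: sorted_asg_def split: sum.splits if_splits)
    then have "R (case_sum c (\<lambda>(l, j). b (is ! l) j)) = holds M (\<phi>, \<sigma>) (case_sum c (\<lambda>(l, j). b (is ! l) j))"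
      by (rule \<phi>(2))
    also have "\<dots> = holds M (plug \<phi> \<tau> b' is) c"
      unfolding holds_def plug_def fst_conv snd_conv
    proof (rule sat_cong)
      fix v assume v: "v \<in> fv \<phi>"
      show "(case \<sigma> v of Inl i \<Rightarrow> case_sum c (\<lambda>(l, j). b (is ! l) j) i | Inr a \<Rightarrow> a) =
          (case case \<tau> v of Inl i \<Rightarrow> Inl i | Inr (l, j) \<Rightarrow> Inr (b' (is ! l) j) of Inl i \<Rightarrow> c i | Inr a \<Rightarrow> a)"
        using hi[OF v] Y_h[OF v] by (auto simp: \<tau>_def b'_def split: sum.splits)
    qed
    finally show ?thesis by simp
  qed
  let ?I = "{is. sorted_wrt (<) is \<and> length is = k \<and> set is \<subseteq> {..<2 * k}}"
  have finI: "finite ?I"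
    by (rule finite_subset[OF _ finite_increasing_lists[of "2 * k"]]) auto
  have ev: "?ev \<in> ?I" by (auto simp: sorted_wrt_map sorted_wrt_upt)
  \<comment> \<open>There are finitely many choices of k indices below 2k, so the conjunction of
    these conditions is one formula.\<close>
  let ?Q = "\<lambda>is c. R (case_sum c (\<lambda>(l, j). b (is ! l) j)) \<longleftrightarrow> is = ?ev"
  have "definable M X E (?Q is)" for "is"
  proof -
    have "definable M X E (\<lambda>c. R (\<lambda>q. case_sum c (\<lambda>a. a) ((\<lambda>q. case q of Inl i \<Rightarrow> Inl i | Inr (l, j) \<Rightarrow> Inr (b (is ! l) j)) q)))"
    proof (rule definable_subst[OF R BE])
      fix q s assume "?XR q = Some s"
      then show "case case q of Inl i \<Rightarrow> Inl i | Inr (l, j) \<Rightarrow> Inr (b (is ! l) j) of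
          Inl i \<Rightarrow> X i = Some s | Inr a \<Rightarrow> a \<in> E \<inter> univ M s"
        using b[of "is ! l" for l] bE by (auto simp: sorted_asg_def split: sum.splits if_splits)
    qed
    moreover have "(\<lambda>q. case_sum c (\<lambda>a. a) ((\<lambda>q. case q of Inl i \<Rightarrow> Inl i | Inr (l, j) \<Rightarrow> Inr (b (is ! l) j)) q)) =
        case_sum c (\<lambda>(l, j). b (is ! l) j)" for c :: "'i \<Rightarrow> 'a"
      by (auto simp: fun_eq_iff split: sum.splits)
    ultimately have d: "definable M X E (\<lambda>c. R (case_sum c (\<lambda>(l, j). b (is ! l) j)))"
      by (simp only:)
    show ?thesis
    proof (cases "is = ?ev")
      case True
      show ?thesis using d by (simp only: True simp_thms)
    next
      case False
      show ?thesis using definable_not[OF d] by (simp only: False simp_thms)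
    qed
  qed
  then have "definable M X E (\<lambda>c. \<forall>is\<in>?I. ?Q is c)"
    by (intro definable_Ball ne finI)
  then obtain \<psi> where \<psi>: "\<psi> \<in> pfms M X E" "\<And>c. sorted_asg M X c \<Longrightarrow> (\<forall>is\<in>?I. ?Q is c) = holds M \<psi> c"
    unfolding definable_def by blast
  have "holds M \<psi> x" using \<psi>(2)[OF x] Rx by blast
  moreover have sol: "?Q is c" if "c \<in> solutions M X {\<psi>}" "is \<in> ?I" for c "is"
  proof -
    have "holds M \<psi> c" "sorted_asg M X c" using that(1) by (auto simp: solutions_def tuples_iff)
    then have "\<forall>is\<in>?I. ?Q is c" using \<psi>(2) by simp
    then show ?thesis using that(2) by (rule bspec)
  qed
  have srt: "sorted_asg M X c" if "c \<in> solutions M X {\<psi>}" for c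
    using that by (auto simp: solutions_def tuples_iff)
  have "skew_divides M X k A {\<psi>}"
    unfolding skew_divides_def
  proof (intro exI conjI allI impI)
    show "wf_tvar M Y" "indiscernible M Y A b'" "wf_fm (lang M) \<phi>" by (fact wfY ind wf)+
    show "\<forall>v\<in>fv \<phi>. case \<tau> v of Inl i \<Rightarrow> X i = Some (fst v)
        | Inr (l, j) \<Rightarrow> l < k \<and> Y j = Some (fst v)"
      using \<sigma>1 \<sigma>2 Y_h k by (auto simp: \<tau>_def split: sum.splits)
    show "entails M X {\<psi>} (plug \<phi> \<tau> b' ?ev)"
      unfolding entails_def using plug[OF srt] sol[OF _ ev] by simp
    fix "is" assume "sorted_wrt (<) is \<and> length is = k \<and> set is \<subseteq> {..<2 * k} \<and> is \<noteq> ?ev"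
    then have i: "is \<in> ?I" "is \<noteq> ?ev" by auto
    then show "entails M X {\<psi>} (pneg (plug \<phi> \<tau> b' is))"
      unfolding entails_def using plug[OF srt] sol[OF _ i(1)] i(2) by (simp add: holds_pneg)
  qed
  ultimately show ?thesis using \<psi>(1) by blast
qed

section \<open>A tower of skew dividing cosets\<close>

abbreviation evens :: "nat \<Rightarrow> nat list" where
  "evens k \<equiv> map (\<lambda>l. 2 * l) [0..<k]"

text \<open>The first K - k even positions are reserved for the right factor d, and the sequence
  used for k starts at position 2(K - k). The even choice of k indices becomes the even choice of K
  indices, so one product serves every k \<le> K.\<close>

definition shift :: "nat \<Rightarrow> nat \<Rightarrow> nat list \<Rightarrow> nat list" where
  "shift K k is = evens (K - k) @ map (\<lambda>i. 2 * (K - k) + i) is"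

lemma length_shift [simp]: "length (shift K k is) = K - k + length is"
  by (simp add: shift_def)

lemma sorted_evens: "sorted_wrt (<) (evens k)"
  by (simp add: sorted_wrt_map)

lemma sorted_shift: "sorted_wrt (<) is \<Longrightarrow> sorted_wrt (<) (shift K k is)"
  by (auto simp: shift_def sorted_wrt_append sorted_wrt_map)

lemma shift_evens: "k \<le> K \<Longrightarrow> shift K k (evens k) = evens K"
  by (rule nth_equalityI) (auto simp: shift_def nth_append)

lemma shift_inject: "shift K k is = shift K k js \<longleftrightarrow> is = js"
  by (auto simp: shift_def inj_on_def inj_map_eq_map)

text \<open>Factors of later steps stand on the right and lie in smaller subgroups, where they are
  absorbed by the coset.\<close>

primrec gprod :: "('g, 'b) monoid_scheme \<Rightarrow> nat \<Rightarrow> (nat \<Rightarrow> nat \<Rightarrow> 'g) \<Rightarrow> nat \<Rightarrow> 'g" where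
  "gprod G K \<beta> 0 = \<one>\<^bsub>G\<^esub>"
| "gprod G K \<beta> (Suc n) = gprod G K \<beta> n \<otimes>\<^bsub>G\<^esub> rprod G (map (\<beta> n) (evens K))"

text \<open>The compactness argument has blocks of variables named by lists of numbers: \<open>[]\<close> is the
  realization $x$ of $p$, \<open>[n, k, l]\<close> is the $l$-th term of the sequence that witnesses skew
  $k$-dividing at step $n$, and the coset of $x$ is the product of \<open>[n]\<close>, of $k$ terms of this
  sequence and of \<open>[n, k]\<close>. In finite approximations \<open>m\<close> bounds the steps and \<open>K\<close> the $k$.\<close>

fun witness :: "('g, 'b) monoid_scheme \<Rightarrow> nat \<Rightarrow> nat \<Rightarrow> 'g \<Rightarrow> (nat \<Rightarrow> nat \<Rightarrow> 'g) \<Rightarrow> nat list \<Rightarrow> 'g" where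
  "witness G K m f \<beta> [] = inv\<^bsub>G\<^esub> f \<otimes>\<^bsub>G\<^esub> gprod G K \<beta> m"
| "witness G K m f \<beta> [n] = inv\<^bsub>G\<^esub> f \<otimes>\<^bsub>G\<^esub> gprod G K \<beta> n"
| "witness G K m f \<beta> [n, k] = rprod G (map (\<beta> n) (evens (K - k)))"
| "witness G K m f \<beta> [n, k, l] = \<beta> n (2 * (K - k) + l)"
| "witness G K m f \<beta> (n # k # l # j # w) = \<one>\<^bsub>G\<^esub>"

lemma gprod_cong: "(\<And>j. j < n \<Longrightarrow> \<beta> j = \<beta>' j) \<Longrightarrow> gprod G K \<beta> n = gprod G K \<beta>' n"
  by (induction n) simp_all

lemma witness_cong:
  assumes "\<And>j. j < n \<Longrightarrow> \<beta> j = \<beta>' j" "w = [n] \<or> w \<noteq> [] \<and> hd w < n"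
  shows "witness G K m f \<beta> w = witness G K m f \<beta>' w"
proof -
  have "gprod G K \<beta> j = gprod G K \<beta>' j" if "j \<le> n" for j
    using assms(1) that by (intro gprod_cong) simp
  then show ?thesis
    using assms by (cases "(G, K, m, f, \<beta>, w)" rule: witness.cases) auto
qed

text \<open>The blocks over which the sequence \<open>[n, k, _]\<close> has to be indiscernible.
  Sequences of the same step for other k are absent: in finite approximations they are made of the
  same terms.\<close>

definition consts_at :: "nat \<Rightarrow> nat \<Rightarrow> nat list set" where
  "consts_at n k = {w. w = [n] \<or> w = [n, k] \<or> w \<noteq> [] \<and> hd w < n}"

text \<open>Position 0 is the element tested. Then come the k + 2 factors from right to left, in the
  order of \<open>rprod\<close>: d, the k terms, and the left factor.\<close>

definition coset_vars :: "nat \<Rightarrow> nat \<Rightarrow> nat list \<Rightarrow> nat \<Rightarrow> nat list" where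
  "coset_vars n k is l = (if l = 0 then [] else if l = 1 then [n, k]
     else if l \<le> Suc k then [n, k, is ! (l - 2)] else [n])"

lemma map_coset_vars:
  assumes "length is = k"
  shows "map (\<lambda>l. F (coset_vars n k is l)) [1..<Suc (k + 2)] =
    [F [n, k]] @ map (\<lambda>i. F [n, k, i]) is @ [F [n]]"
proof (rule nth_equalityI)
  fix j assume "j < length (map (\<lambda>l. F (coset_vars n k is l)) [1..<Suc (k + 2)])"
  then have j: "j < k + 2" by (simp del: upt_Suc)
  then have "map (\<lambda>l. F (coset_vars n k is l)) [1..<Suc (k + 2)] ! j = F (coset_vars n k is (Suc j))"
    by (simp del: upt_Suc)
  also have "\<dots> = ([F [n, k]] @ map (\<lambda>i. F [n, k, i]) is @ [F [n]]) ! j"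
    using j assms by (cases j) (auto simp: coset_vars_def nth_append)
  finally show "map (\<lambda>l. F (coset_vars n k is l)) [1..<Suc (k + 2)] ! j =
      ([F [n, k]] @ map (\<lambda>i. F [n, k, i]) is @ [F [n]]) ! j" .
qed (simp add: assms del: upt_Suc)

definition param_asg :: "nat \<Rightarrow> nat \<Rightarrow> nat list \<Rightarrow> (nat list \<times> 'i \<Rightarrow> 'a) \<Rightarrow> (nat + nat list) \<times> 'i \<Rightarrow> 'a" where
  "param_asg n k is c = (\<lambda>(v, i). case v of Inl l \<Rightarrow> c ([n, k, is ! l], i) | Inr w \<Rightarrow> c (w, i))"

section \<open>Conditions on the tower and their finite satisfiability\<close>

locale subgroup_chain = tdef_group \<kappa> T M X A G
  for \<kappa> :: "'k rel" and T :: "('s, 'f, 'r) fm set" and M :: "('s, 'f, 'r, 'a) struc"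
    and X :: "('i, ('s, 'f, 'r) eqsort) tvar" and A :: "('s, 'f, 'r, 'a) eqelem set"
    and G :: "('i \<Rightarrow> ('s, 'f, 'r, 'a) eqelem) monoid" (structure) +
  fixes p :: "(('s, 'f, 'r) eqsort, ('s, 'f, 'r) eqfun, 'r, ('s, 'f, 'r, 'a) eqelem, 'i) ctype"
    and H :: "nat \<Rightarrow> ('i \<Rightarrow> ('s, 'f, 'r, 'a) eqelem) set"
    and \<chi> :: "nat \<Rightarrow> (('s, 'f, 'r) eqsort, ('s, 'f, 'r) eqfun, 'r, ('s, 'f, 'r, 'a) eqelem, 'i) pfm"
  assumes p: "complete_type \<kappa> N p" "tvars p = X" "tbase p \<subseteq> A"
    and generic: "\<And>\<psi>. \<psi> \<in> tfms p \<Longrightarrow> \<exists>F\<subseteq>carrier G. finite F \<and>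
      carrier G = (\<Union>g\<in>F. g <# {c \<in> carrier G. holds N \<psi> c})"
    and H: "\<And>n. subgroup (H n) G" "\<And>n. H n = {c \<in> carrier G. holds N (\<chi> n) c}"
      "\<And>n. H (Suc n) \<subseteq> H n" "\<And>n. infinite_index G (H n) (H (Suc n))"
    and \<chi>: "\<And>n. \<chi> n \<in> pfms N X A"
begin

lemma H_carrier: "x \<in> H n \<Longrightarrow> x \<in> carrier G"
  using H(1) by (rule subgroup.mem_carrier)

lemma H_antimono: "m \<le> n \<Longrightarrow> H n \<subseteq> H m"
  by (rule lift_Suc_antimono_le[where f=H]) (rule H(3))

definition coset_pred :: "nat \<Rightarrow> nat \<Rightarrow> (nat \<times> 'i \<Rightarrow> ('s, 'f, 'r, 'a) eqelem) \<Rightarrow> bool" where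
  "coset_pred n k = (SOME R. definable N blocks_tvar A R \<and> (\<forall>z. (\<forall>l::nat. block z l \<in> carrier G) \<longrightarrow>
    R z = (\<exists>h\<in>H (Suc n). block z 0 = rprod G (map (block z) [1..<Suc (k + 2)]) \<otimes> h)))"

lemma coset_pred:
  "definable N blocks_tvar A (coset_pred n k)"
  "(\<And>l. block z l \<in> carrier G) \<Longrightarrow>
    coset_pred n k z = (\<exists>h\<in>H (Suc n). block z 0 = rprod G (map (block z) [1..<Suc (k + 2)]) \<otimes> h)"
proof -
  have "definable N blocks_tvar A (coset_pred n k) \<and> (\<forall>z. (\<forall>l::nat. block z l \<in> carrier G) \<longrightarrow>
    coset_pred n k z = (\<exists>h\<in>H (Suc n). block z 0 = rprod G (map (block z) [1..<Suc (k + 2)]) \<otimes> h))"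
    using someI_ex[OF coset_definable[OF H(1,2) \<chi>, of "Suc n" "k + 2"]]
    unfolding coset_pred_def[symmetric] .
  then show "definable N blocks_tvar A (coset_pred n k)"
    "(\<And>l. block z l \<in> carrier G) \<Longrightarrow>
    coset_pred n k z = (\<exists>h\<in>H (Suc n). block z 0 = rprod G (map (block z) [1..<Suc (k + 2)]) \<otimes> h)"
    by blast+
qed

text \<open>A complete type contains a formula equivalent to the conjunction of \<Psi>, and finitely
  many translates of this one cover \<open>G\<close>. That \<open>F\<close> does not depend on x
  matters: x is constructed only after \<open>F\<close> has been used.\<close>

lemma generic_finite:
  assumes \<Psi>: "finite \<Psi>" "\<Psi> \<subseteq> tfms p"
  shows "\<exists>F\<subseteq>carrier G. finite F \<and> (\<forall>x\<in>carrier G. \<exists>f\<in>F. \<forall>\<psi>\<in>\<Psi>. holds N \<psi> (inv f \<otimes> x))"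
proof -
  have pfms: "tfms p \<subseteq> pfms N X (tbase p)" using p by (simp add: complete_type_def)
  have "definable N X (tbase p) (\<lambda>c. \<forall>\<psi>\<in>\<Psi>. holds N \<psi> c)"
    using \<Psi> pfms N_nonempty(1) by (intro definable_Ball definable_holds) auto
  then obtain \<psi> where \<psi>: "\<psi> \<in> pfms N X (tbase p)"
    "\<And>c. sorted_asg N X c \<Longrightarrow> (\<forall>\<psi>\<in>\<Psi>. holds N \<psi> c) = holds N \<psi> c"
    unfolding definable_def by blast
  have "\<psi> \<in> tfms p"
  proof (rule ccontr)
    assume "\<psi> \<notin> tfms p"
    then have "pneg \<psi> \<in> tfms p" using p \<psi>(1) unfolding complete_type_def by blast
    then have "insert (pneg \<psi>) \<Psi> \<subseteq> tfms p" "finite (insert (pneg \<psi>) \<Psi>)" using \<Psi> by auto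
    then have "solutions N X (insert (pneg \<psi>) \<Psi>) \<noteq> {}"
      using p(1,2) by (simp add: complete_type_def finitely_satisfiable_def)
    then obtain c where "c \<in> tuples N X" "holds N (pneg \<psi>) c" "\<forall>\<psi>\<in>\<Psi>. holds N \<psi> c"
      by (auto simp: solutions_def)
    then show False using \<psi>(2)[of c] by (simp add: holds_pneg tuples_iff)
  qed
  from generic[OF this] obtain F where F: "F \<subseteq> carrier G" "finite F"
    "carrier G = (\<Union>g\<in>F. g <# {c \<in> carrier G. holds N \<psi> c})"
    by (elim exE conjE)
  have "\<exists>f\<in>F. \<forall>\<psi>\<in>\<Psi>. holds N \<psi> (inv f \<otimes> x)" if x: "x \<in> carrier G" for x
  proof -
    have "x \<in> (\<Union>g\<in>F. g <# {c \<in> carrier G. holds N \<psi> c})" using F(3) x by (rule subst)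
    then obtain f c where f: "f \<in> F" and c: "c \<in> carrier G" "holds N \<psi> c" "x = f \<otimes> c"
      by (auto simp: l_coset_def)
    have "inv f \<otimes> x = c" using c f F(1) by (simp add: subset_iff flip: m_assoc)
    moreover have "\<forall>\<psi>\<in>\<Psi>. holds N \<psi> c"
      using \<psi>(2)[of c] c carrier_tuples by (simp add: tuples_iff)
    ultimately show ?thesis using f by auto
  qed
  with F(1,2) show ?thesis by blast
qed

definition param_tvar :: "nat \<Rightarrow> nat \<Rightarrow> nat \<Rightarrow> ((nat + nat list) \<times> 'i, ('s, 'f, 'r) eqsort) tvar" where
  "param_tvar n k m = (\<lambda>(v, i). case v of Inl l \<Rightarrow> if l < m then X i else None
     | Inr w \<Rightarrow> if w \<in> consts_at n k then X i else None)"

definition type_cond where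
  "type_cond \<psi> c = holds N \<psi> (\<lambda>i. c ([] :: nat list, i))"

definition coset_cond where
  "coset_cond = (\<lambda>(n, k, is) c.
     coset_pred n k (\<lambda>(l, i). c (coset_vars n k is l, i)) \<longleftrightarrow> is = evens k)"

text \<open>The predicate \<theta> has parameters in \<open>A\<close> only. Parameters from constant
  blocks enter as variables, because the values of these blocks are not known before compactness is
  applied.\<close>

definition ind_cond ::
  "nat \<times> nat \<times> nat \<times> (((nat + nat list) \<times> 'i \<Rightarrow> ('s, 'f, 'r, 'a) eqelem) \<Rightarrow> bool) \<times> nat list \<times> nat list
    \<Rightarrow> (nat list \<times> 'i \<Rightarrow> ('s, 'f, 'r, 'a) eqelem) \<Rightarrow> bool" where
  "ind_cond = (\<lambda>(n, k, m, \<theta>, is, js) c. \<theta> (param_asg n k is c) \<longleftrightarrow> \<theta> (param_asg n k js c))"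

definition coset_index :: "(nat \<times> nat \<times> nat list) set" where
  "coset_index = {(n, k, is). k \<ge> 1 \<and> sorted_wrt (<) is \<and> length is = k}"

definition ind_index where
  "ind_index = {(n, k, m, \<theta>, is, js). definable N (param_tvar n k m) A \<theta> \<and>
     sorted_wrt (<) is \<and> sorted_wrt (<) js \<and> length is = m \<and> length js = m}"

definition conditions where
  "conditions = type_cond ` tfms p \<union> coset_cond ` coset_index \<union> ind_cond ` ind_index"

text \<open>A colouring of lists of K - k + m terms of step n: the first K - k terms are multiplied
  to give d, the other m are the arguments. In this way homogeneity of one sequence yields
  indiscernibility over d, although d is built from the same sequence.\<close>

definition hom_pred ::
  "nat \<Rightarrow> nat \<Rightarrow> nat \<Rightarrow> nat \<Rightarrow> (((nat + nat list) \<times> 'i \<Rightarrow> ('s, 'f, 'r, 'a) eqelem) \<Rightarrow> bool)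
    \<Rightarrow> ('i \<Rightarrow> ('s, 'f, 'r, 'a) eqelem) \<Rightarrow> (nat \<Rightarrow> nat \<Rightarrow> 'i \<Rightarrow> ('s, 'f, 'r, 'a) eqelem)
    \<Rightarrow> ('i \<Rightarrow> ('s, 'f, 'r, 'a) eqelem) list \<Rightarrow> bool" where
  "hom_pred K N' n k \<theta> f \<beta> L = \<theta> (\<lambda>(v, i). case v of Inl l \<Rightarrow> (L ! (K - k + l)) i
     | Inr w \<Rightarrow> (if w = [n, k] then rprod G (take (K - k) L) else witness G K N' f \<beta> w) i)"

text \<open>The homogeneity required of the $n$-th sequence may only refer to earlier sequences.\<close>

definition truncate :: "(nat \<Rightarrow> nat \<Rightarrow> 'i \<Rightarrow> ('s, 'f, 'r, 'a) eqelem) \<Rightarrow> nat \<Rightarrow> nat \<Rightarrow> nat \<Rightarrow> 'i \<Rightarrow> ('s, 'f, 'r, 'a) eqelem" where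
  "truncate \<beta> n = (\<lambda>j. if j < n then \<beta> j else (\<lambda>_. \<one>))"

text \<open>Recursion on n, since the colourings of step n involve earlier sequences only. The
  translating element will be known after all sequences, so homogeneity is demanded for each
  candidate in \<open>F\<close>.\<close>

lemma exists_sequences:
  assumes J: "finite J" and F: "finite F"
  shows "\<exists>\<beta>. \<forall>n. (\<forall>i. \<beta> n i \<in> H n) \<and>
    (\<forall>is js h. sorted_wrt (<) is \<longrightarrow> sorted_wrt (<) js \<longrightarrow> length is = length js \<longrightarrow> is \<noteq> js \<longrightarrow> h \<in> H (Suc n)
      \<longrightarrow> rprod G (map (\<beta> n) is) \<noteq> rprod G (map (\<beta> n) js) \<otimes> h) \<and>
    (\<forall>k m \<theta> is0 js0 f is js. (n, k, m, \<theta>, is0, js0) \<in> J \<longrightarrow> f \<in> F \<longrightarrow>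
      sorted_wrt (<) is \<longrightarrow> length is = K - k + m \<longrightarrow> sorted_wrt (<) js \<longrightarrow> length js = K - k + m \<longrightarrow>
      hom_pred K N' n k \<theta> f (truncate \<beta> n) (map (\<beta> n) is) = hom_pred K N' n k \<theta> f (truncate \<beta> n) (map (\<beta> n) js))"
    (is "\<exists>\<beta>. \<forall>n. ?P \<beta> n (\<beta> n)")
proof (rule dependent_wellorder_choice)
  fix r n and \<beta> \<beta>' :: "nat \<Rightarrow> nat \<Rightarrow> 'i \<Rightarrow> ('s, 'f, 'r, 'a) eqelem"
  assume "\<And>j. j < n \<Longrightarrow> \<beta> j = \<beta>' j"
  then have "truncate \<beta> n = truncate \<beta>' n" by (auto simp: truncate_def)
  then show "?P \<beta> n r = ?P \<beta>' n r" by simp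
next
  fix n and \<beta> :: "nat \<Rightarrow> nat \<Rightarrow> 'i \<Rightarrow> ('s, 'f, 'r, 'a) eqelem"
  \<comment> \<open>Entries of \<open>J\<close> made for other steps are included too; they only add
    homogeneity.\<close>
  let ?\<Theta> = "(\<lambda>((n', k, m, \<theta>, is0, js0), f). (K - k + m, hom_pred K N' n k \<theta> f (truncate \<beta> n))) ` (J \<times> F)"
  have fin: "finite ?\<Theta>" using J F by simp
  obtain b :: "nat \<Rightarrow> 'i \<Rightarrow> ('s, 'f, 'r, 'a) eqelem" where b: "\<And>i. b i \<in> H n"
    "\<And>is js h. \<lbrakk>sorted_wrt (<) is; sorted_wrt (<) js; length is = length js; is \<noteq> js; h \<in> H (Suc n)\<rbrakk>
      \<Longrightarrow> rprod G (map b is) \<noteq> rprod G (map b js) \<otimes> h"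
    "\<And>m Q is js. \<lbrakk>(m, Q) \<in> ?\<Theta>; sorted_wrt (<) is; length is = m; sorted_wrt (<) js; length js = m\<rbrakk>
      \<Longrightarrow> Q (map b is) = Q (map b js)"
  proof (rule independent_homogeneous_sequence[OF is_group H(1)[of n] H(1) H(3) H(4) fin], goal_cases)
    case (1 b)
    show ?case by (rule 1(1)[of b]) (use 1(2-4) in \<open>simp_all only:\<close>)
  qed
  have "hom_pred K N' n k \<theta> f (truncate \<beta> n) (map b is) = hom_pred K N' n k \<theta> f (truncate \<beta> n) (map b js)"
    if "(n, k, m, \<theta>, is0, js0) \<in> J" "f \<in> F" "sorted_wrt (<) is" "length is = K - k + m"
      "sorted_wrt (<) js" "length js = K - k + m" for k m \<theta> is0 js0 f "is" js
  proof (rule b(3)[OF _ that(3-6)])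
    show "(K - k + m, hom_pred K N' n k \<theta> f (truncate \<beta> n)) \<in> ?\<Theta>"
      using that(1,2) by (intro image_eqI[of _ _ "((n, k, m, \<theta>, is0, js0), f)"]) auto
  qed
  with b(1,2) show "\<exists>r. ?P \<beta> n r" by (intro exI[of _ b] conjI allI impI)
qed

lemma gprod_H:
  assumes "\<And>n i. \<beta> n i \<in> H n"
  shows "gprod G K \<beta> n \<in> carrier G" "n \<le> m \<Longrightarrow> \<exists>r\<in>H n. gprod G K \<beta> m = gprod G K \<beta> n \<otimes> r"
proof -
  have r: "rprod G (map (\<beta> n) l) \<in> H n" for n l
    using assms by (intro rprod_in_subgroup H) auto
  show c: "gprod G K \<beta> n \<in> carrier G" for n
    by (induction n) (simp_all only: gprod.simps one_closed m_closed H_carrier[OF r])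
  show "n \<le> m \<Longrightarrow> \<exists>r\<in>H n. gprod G K \<beta> m = gprod G K \<beta> n \<otimes> r"
  proof (induction m rule: dec_induct)
    case base
    then show ?case using subgroup.one_closed[OF H(1)] c by (intro bexI[of _ \<one>]) simp_all
  next
    case (step m)
    then obtain s where s: "s \<in> H n" "gprod G K \<beta> m = gprod G K \<beta> n \<otimes> s" by blast
    have "rprod G (map (\<beta> m) (evens K)) \<in> H n" using r H_antimono[OF step.hyps(1)] by blast
    with s show ?case
      using c H_carrier subgroup.m_closed[OF H(1)]
      by (intro bexI[of _ "s \<otimes> rprod G (map (\<beta> m) (evens K))"]) (simp_all add: m_assoc)
  qed
qed

lemma param_asg_sorted:
  "sorted_asg N blocks_tvar c \<Longrightarrow> sorted_asg N (param_tvar n k m) (param_asg n k is c)"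
  by (auto simp: sorted_asg_def param_tvar_def param_asg_def split: sum.splits if_splits)

text \<open>For the coset condition of step n, the left factor f^-1 e_0 ... e_(n-1) cancels and the
  later e_j are absorbed in \<open>H (Suc n)\<close>. It remains to compare the cosets of e_n and of
  another product of K terms, which is settled by independence.\<close>

lemma fin_sat_conditions: "fin_sat N blocks_tvar conditions"
  unfolding fin_sat_def
proof (intro allI impI)
  fix \<Q> assume \<Q>: "\<Q> \<subseteq> conditions" "finite \<Q>"
  obtain \<Psi> where \<Psi>: "\<Psi> \<subseteq> tfms p" "finite \<Psi>" "\<Q> \<inter> type_cond ` tfms p = type_cond ` \<Psi>"
    using finite_subset_image[of "\<Q> \<inter> type_cond ` tfms p" type_cond "tfms p"] \<Q>(2) by auto
  obtain I where I: "I \<subseteq> coset_index" "finite I" "\<Q> \<inter> coset_cond ` coset_index = coset_cond ` I"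
    using finite_subset_image[of "\<Q> \<inter> coset_cond ` coset_index" coset_cond coset_index] \<Q>(2) by auto
  obtain J where J: "J \<subseteq> ind_index" "finite J" "\<Q> \<inter> ind_cond ` ind_index = ind_cond ` J"
    using finite_subset_image[of "\<Q> \<inter> ind_cond ` ind_index" ind_cond ind_index] \<Q>(2) by auto
  obtain N' where N': "\<forall>n\<in>fst ` I. n < N'"
    using I(2) finite_nat_set_iff_bounded by (metis finite_imageI)
  obtain K where K': "\<forall>k\<in>(\<lambda>q. fst (snd q)) ` I. k < K"
    using I(2) finite_nat_set_iff_bounded by (metis finite_imageI)
  have K: "k \<le> K" if "(n, k, is) \<in> I" for n k "is"
    using bspec[OF K' imageI[OF that]] by simp
  obtain F where F: "F \<subseteq> carrier G" "finite F" "\<forall>x\<in>carrier G. \<exists>f\<in>F. \<forall>\<psi>\<in>\<Psi>. holds N \<psi> (inv f \<otimes> x)"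
    using generic_finite[OF \<Psi>(2,1)] by blast
  from exists_sequences[OF J(2) F(2), of K N'] obtain \<beta> where seq: "\<forall>n. (\<forall>i. \<beta> n i \<in> H n) \<and>
    (\<forall>is js h. sorted_wrt (<) is \<longrightarrow> sorted_wrt (<) js \<longrightarrow> length is = length js \<longrightarrow> is \<noteq> js \<longrightarrow> h \<in> H (Suc n)
      \<longrightarrow> rprod G (map (\<beta> n) is) \<noteq> rprod G (map (\<beta> n) js) \<otimes> h) \<and>
    (\<forall>k m \<theta> is0 js0 f is js. (n, k, m, \<theta>, is0, js0) \<in> J \<longrightarrow> f \<in> F \<longrightarrow>
      sorted_wrt (<) is \<longrightarrow> length is = K - k + m \<longrightarrow> sorted_wrt (<) js \<longrightarrow> length js = K - k + m \<longrightarrow>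
      hom_pred K N' n k \<theta> f (truncate \<beta> n) (map (\<beta> n) is) = hom_pred K N' n k \<theta> f (truncate \<beta> n) (map (\<beta> n) js))"
    by (elim exE)
  note \<beta> = seq[THEN spec, THEN conjunct1, THEN spec]
  note indep = seq[THEN spec, THEN conjunct2, THEN conjunct1, rule_format]
  note hom = seq[THEN spec, THEN conjunct2, THEN conjunct2, rule_format]
  note gp = gprod_H[where \<beta>=\<beta> and K=K, OF \<beta>]
  \<comment> \<open>Chosen last: the translation that makes the finished product satisfy
    \<Psi>.\<close>
  obtain f where f: "f \<in> F" "\<forall>\<psi>\<in>\<Psi>. holds N \<psi> (inv f \<otimes> gprod G K \<beta> N')"
    using bspec[OF F(3) gp(1)[of N']] by (elim bexE)
  have fc: "f \<in> carrier G" using f(1) F(1) by blast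
  let ?w = "witness G K N' f \<beta>"
  let ?c = "\<lambda>(w, i). ?w w i"
  have rH: "rprod G (map (\<beta> n) l) \<in> H n" for n l
    using \<beta> by (intro rprod_in_subgroup H) auto
  note rc = H_carrier[OF rH]
  have w: "?w w \<in> carrier G" for w
    using fc gp(1) rc H_carrier[OF \<beta>]
    by (cases "(G, K, N', f, \<beta>, w)" rule: witness.cases) (auto simp del: map_map)
  have bc: "block ?c w = ?w w" for w
    unfolding block_def prod.case by (rule carrier_ext[OF w])
  have c: "sorted_asg N blocks_tvar ?c"
    by (rule blocks_sorted) (simp only: bc w)
  have type: "P ?c" if P: "P \<in> type_cond ` \<Psi>" for P
  proof -
    obtain \<psi> where "\<psi> \<in> \<Psi>" "P = type_cond \<psi>" using P by blast
    then show ?thesis using f(2) by (simp add: type_cond_def)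
  qed
  have coset: "P ?c" if P: "P \<in> coset_cond ` I" for P
  proof -
    obtain n k "is" where q: "(n, k, is) \<in> I" "P = coset_cond (n, k, is)" using P by auto
    then have "is": "sorted_wrt (<) is" "length is = k" using I(1) by (auto simp: coset_index_def)
    have nN: "Suc n \<le> N'" using q(1) N' by force
    have kK: "k \<le> K" using q(1) by (rule K)
    let ?z = "\<lambda>(l, i). ?c (coset_vars n k is l, i)"
    have bz: "block ?z l = ?w (coset_vars n k is l)" for l
      unfolding block_def prod.case by (rule carrier_ext[OF w])
    let ?g = "gprod G K \<beta> n" and ?E = "rprod G (map (\<beta> n) (evens K))"
      and ?W = "rprod G (map (\<beta> n) (shift K k is))"
    have gc: "?g \<in> carrier G" by (rule gp(1))
    have "map (block ?z) [1..<Suc (k + 2)] = map (\<lambda>l. ?w (coset_vars n k is l)) [1..<Suc (k + 2)]"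
      by (rule map_cong[OF refl]) (rule bz)
    also have "\<dots> = [?w [n, k]] @ map (\<lambda>i. ?w [n, k, i]) is @ [?w [n]]"
      by (rule map_coset_vars[OF "is"(2)])
    also have "\<dots> = ([rprod G (map (\<beta> n) (evens (K - k)))] @ map (\<beta> n) (map (\<lambda>i. 2 * (K - k) + i) is)) @ [inv f \<otimes> ?g]"
      by (simp add: comp_def)
    finally have "rprod G (map (block ?z) [1..<Suc (k + 2)]) =
        rprod G (([rprod G (map (\<beta> n) (evens (K - k)))] @ map (\<beta> n) (map (\<lambda>i. 2 * (K - k) + i) is)) @ [inv f \<otimes> ?g])"
      by (rule arg_cong)
    also have "\<dots> = (inv f \<otimes> ?g) \<otimes> (rprod G (map (\<beta> n) (map (\<lambda>i. 2 * (K - k) + i) is)) \<otimes> rprod G (map (\<beta> n) (evens (K - k))))"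
    proof -
      have one: "rprod G [x] = x" if "x \<in> carrier G" for x
        using rprod_simps(2)[of G "[]" x] that by simp
      show ?thesis
        unfolding rprod_simps(2)
        using rc H_carrier[OF \<beta>] by (subst rprod_append) (auto simp: one simp del: map_map)
    qed
    also have "rprod G (map (\<beta> n) (map (\<lambda>i. 2 * (K - k) + i) is)) \<otimes> rprod G (map (\<beta> n) (evens (K - k))) = ?W"
      unfolding shift_def map_append using H_carrier[OF \<beta>] by (intro rprod_append[symmetric]) auto
    finally have prod: "rprod G (map (block ?z) [1..<Suc (k + 2)]) = (inv f \<otimes> ?g) \<otimes> ?W" .
    \<comment> \<open>\<open>r\<close> collects the factors after step n.\<close>
    obtain r where r: "r \<in> H (Suc n)" "gprod G K \<beta> N' = ?g \<otimes> ?E \<otimes> r"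
      using gp(2)[OF nN] by auto
    have b0: "block ?z 0 = inv f \<otimes> (?g \<otimes> ?E \<otimes> r)"
    proof -
      have "block ?z 0 = ?w []" unfolding bz by (simp add: coset_vars_def)
      then show ?thesis by (simp only: witness.simps r(2))
    qed
    have "coset_pred n k ?z \<longleftrightarrow> (\<exists>h\<in>H (Suc n). inv f \<otimes> (?g \<otimes> ?E \<otimes> r) = (inv f \<otimes> ?g) \<otimes> ?W \<otimes> h)"
      unfolding b0[symmetric] prod[symmetric] by (rule coset_pred(2)) (simp only: bz w)
    also have "\<dots> \<longleftrightarrow> (\<exists>h\<in>H (Suc n). ?E \<otimes> r = ?W \<otimes> h)"
    proof (intro bex_cong refl)
      fix h assume "h \<in> H (Suc n)"
      then show "(inv f \<otimes> (?g \<otimes> ?E \<otimes> r) = (inv f \<otimes> ?g) \<otimes> ?W \<otimes> h) = (?E \<otimes> r = ?W \<otimes> h)"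
        using fc gc rc H_carrier[OF r(1)] H_carrier[of h "Suc n"] by (simp add: m_assoc del: map_map)
    qed
    also have "\<dots> \<longleftrightarrow> is = evens k"
    proof
      assume "\<exists>h\<in>H (Suc n). ?E \<otimes> r = ?W \<otimes> h"
      then obtain h where h: "h \<in> H (Suc n)" "?E \<otimes> r = ?W \<otimes> h" by blast
      then have "?E = ?W \<otimes> (h \<otimes> inv r)"
        using rc H_carrier[OF r(1)] H_carrier[OF h(1)]
        by (simp add: inv_solve_right del: map_map flip: m_assoc)
      moreover have "h \<otimes> inv r \<in> H (Suc n)"
        using h(1) r(1) by (intro subgroup.m_closed[OF H(1)] subgroup.m_inv_closed[OF H(1)])
      moreover have "length (evens K) = length (shift K k is)" using "is"(2) kK by simp
      ultimately have "evens K = shift K k is"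
        using indep[OF sorted_evens sorted_shift[OF "is"(1)]] by blast
      then show "is = evens k" by (simp only: shift_inject flip: shift_evens[OF kK])
    next
      assume "is = evens k"
      then show "\<exists>h\<in>H (Suc n). ?E \<otimes> r = ?W \<otimes> h" using r(1) shift_evens[OF kK] by auto
    qed
    finally show ?thesis by (simp add: q(2) coset_cond_def)
  qed
  have ind: "P ?c" if P: "P \<in> ind_cond ` J" for P
  proof -
    obtain n k m \<theta> "is" js where q: "(n, k, m, \<theta>, is, js) \<in> J" "P = ind_cond (n, k, m, \<theta>, is, js)"
      using P by auto
    then have \<theta>: "definable N (param_tvar n k m) A \<theta>" and l: "sorted_wrt (<) is" "sorted_wrt (<) js"
      "length is = m" "length js = m"
      using J(1) by (auto simp: ind_index_def)
    have "\<theta> (param_asg n k l ?c) = hom_pred K N' n k \<theta> f (truncate \<beta> n) (map (\<beta> n) (shift K k l))"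
      if l: "length l = m" for l
      unfolding hom_pred_def
    proof (rule definable_asg_cong[OF \<theta>])
      show "sorted_asg N (param_tvar n k m) (param_asg n k l ?c)"
        using c by (rule param_asg_sorted)
      fix q s assume "param_tvar n k m q = Some s"
      then consider j i where "q = (Inl j, i)" "j < m" | u i where "q = (Inr u, i)" "u \<in> consts_at n k"
        by (cases q) (auto simp: param_tvar_def split: sum.splits if_splits)
      then show "param_asg n k l ?c q = (\<lambda>(v, i). case v of
          Inl j \<Rightarrow> (map (\<beta> n) (shift K k l) ! (K - k + j)) i
        | Inr w \<Rightarrow> (if w = [n, k] then rprod G (take (K - k) (map (\<beta> n) (shift K k l)))
            else witness G K N' f (truncate \<beta> n) w) i) q"
      proof cases
        case 1
        then show ?thesis using l by (simp add: param_asg_def shift_def nth_append)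
      next
        case 2
        \<comment> \<open>A constant other than \<open>[n, k]\<close> is built from sequences before
          n, so truncation leaves it unchanged; \<open>[n, k]\<close> itself is recomputed from the
          list by \<open>hom_pred\<close>.\<close>
        have "?w u = witness G K N' f (truncate \<beta> n) u" if "u \<noteq> [n, k]"
          using 2 that by (intro witness_cong[of n]) (auto simp: truncate_def consts_at_def)
        then show ?thesis using 2 by (simp add: param_asg_def shift_def take_map)
      qed
    qed
    then have "\<theta> (param_asg n k is ?c) = \<theta> (param_asg n k js ?c)"
      using hom[OF q(1) f(1) sorted_shift[OF l(1), of K k] _ sorted_shift[OF l(2), of K k]] l by simp
    then show ?thesis by (simp add: q(2) ind_cond_def)
  qed
  have "P ?c" if "P \<in> \<Q>" for P
  proof -
    from that \<Q>(1) have "P \<in> \<Q> \<inter> type_cond ` tfms p \<or> P \<in> \<Q> \<inter> coset_cond ` coset_index \<or> P \<in> \<Q> \<inter> ind_cond ` ind_index"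
      unfolding conditions_def by blast
    then show ?thesis
      unfolding \<Psi>(3) I(3) J(3) by (elim disjE) (erule type, erule coset, erule ind)
  qed
  with c show "\<exists>c. sorted_asg N blocks_tvar c \<and> (\<forall>P\<in>\<Q>. P c)"
    by (intro exI[of _ ?c] conjI ballI)
qed

section \<open>Realizing the tower and reading off the chain of types\<close>

lemma tfms_p: "\<psi> \<in> tfms p \<Longrightarrow> \<psi> \<in> pfms N X A"
  using p pfms_mono[OF map_le_refl p(3), of N X] by (auto simp: complete_type_def)

lemma definable_param_asg:
  assumes "definable N (param_tvar n k m) A \<theta>" "length is = m"
  shows "definable N blocks_tvar A (\<lambda>c. \<theta> (param_asg n k is c))"
proof -
  have "definable N blocks_tvar A
      (\<lambda>c. \<theta> (\<lambda>q. c ((\<lambda>(v, i). case v of Inl l \<Rightarrow> ([n, k, is ! l], i) | Inr w \<Rightarrow> (w, i)) q)))"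
    using assms(1)
    by (rule definable_reindex) (auto simp: param_tvar_def split: sum.splits if_splits)
  moreover have "(\<lambda>q. c ((\<lambda>(v, i). case v of Inl l \<Rightarrow> ([n, k, is ! l], i) | Inr w \<Rightarrow> (w, i)) q)) =
      param_asg n k is c" for c :: "nat list \<times> 'i \<Rightarrow> ('s, 'f, 'r, 'a) eqelem"
    by (auto simp: param_asg_def fun_eq_iff split: sum.splits)
  ultimately show ?thesis by (simp only:)
qed

lemma definable_conditions:
  assumes "P \<in> conditions"
  shows "definable N blocks_tvar A P"
  using assms unfolding conditions_def
proof (elim UnE imageE)
  fix \<psi> assume P: "P = type_cond \<psi>" and \<psi>: "\<psi> \<in> tfms p"
  have "definable N blocks_tvar A (\<lambda>c. holds N \<psi> (\<lambda>i. c ([] :: nat list, i)))"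
    using definable_holds[OF tfms_p[OF \<psi>]] by (rule definable_reindex) simp
  then show ?thesis unfolding P type_cond_def[abs_def] .
next
  fix q assume P: "P = coset_cond q"
  obtain n k "is" where q: "q = (n, k, is)" by (cases q)
  have "definable N blocks_tvar A
      (\<lambda>c. coset_pred n k (\<lambda>p. c ((\<lambda>(l, i). (coset_vars n k is l, i)) p)))"
    using coset_pred(1) by (rule definable_reindex) auto
  moreover have "(\<lambda>p. c ((\<lambda>(l, i). (coset_vars n k is l, i)) p)) = (\<lambda>(l, i). c (coset_vars n k is l, i))"
    for c :: "nat list \<times> 'i \<Rightarrow> ('s, 'f, 'r, 'a) eqelem" by auto
  ultimately have d: "definable N blocks_tvar A (\<lambda>c. coset_pred n k (\<lambda>(l, i). c (coset_vars n k is l, i)))"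
    by (simp only:)
  show ?thesis
  proof (cases "is = evens k")
    case True
    show ?thesis using d by (simp only: P q coset_cond_def prod.case True simp_thms)
  next
    case False
    show ?thesis using definable_not[OF d] by (simp only: P q coset_cond_def prod.case False simp_thms)
  qed
next
  fix q assume P: "P = ind_cond q" and q: "q \<in> ind_index"
  obtain n k m \<theta> "is" js where q': "q = (n, k, m, \<theta>, is, js)" by (cases q)
  then have "definable N (param_tvar n k m) A \<theta>" "length is = m" "length js = m"
    using q by (auto simp: ind_index_def)
  then show ?thesis
    unfolding P q' ind_cond_def prod.case by (intro definable_iff definable_param_asg)
qed

lemma realize_conditions: "\<exists>c. sorted_asg N blocks_tvar c \<and> (\<forall>P\<in>conditions. P c)"
proof (rule saturated_eq_struc[OF mm _ _ A definable_conditions fin_sat_conditions])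
  show "wf_tvar N (blocks_tvar :: (nat list \<times> 'i, _) tvar)" using X(1) by (auto simp: wf_tvar_iff)
  have "dom (blocks_tvar :: (nat list \<times> 'i, _) tvar) \<subseteq> UNIV \<times> dom X" by auto
  then show "small \<kappa> (dom (blocks_tvar :: (nat list \<times> 'i, _) tvar))"
    using small_Times[OF card_\<kappa>(1,2) small_nat_list[OF card_\<kappa>] X(2)] by (rule small_subset)
qed

text \<open>\<open>P (Suc n)\<close> is the type of block \<open>[]\<close> over \<open>A\<close>
  and all blocks of steps up to n. Step n has its own sequence for each k, so this type contains a
  skew k-dividing formula for each k.\<close>

theorem forking_chain:
  "\<exists>P. P 0 = p \<and> (\<forall>n. omega_forking_extension \<kappa> N (P (Suc n)) (P n))"
proof -
  obtain c where c: "sorted_asg N blocks_tvar c \<and> (\<forall>P\<in>conditions. P c)"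
    using realize_conditions by (rule exE)
  note cs = conjunct1[OF c] and cond = bspec[OF conjunct2[OF c]]
  have cX: "c (w, i) \<in> univ N s" if "X i = Some s" for w i s
    using cs that by (simp add: sorted_asg_def)
  have Xs: "s \<in> sorts (eq_lang M)" if "X i = Some s" for i s
    using X(1) that by (simp add: wf_tvar_iff)
  define x where "x = block c []"
  have x: "x \<in> tuples N X" "sorted_asg N X x"
    using cX by (auto simp: x_def block_def tuples_iff sorted_asg_def)
  have holds_x: "holds N \<psi> x = holds N \<psi> (\<lambda>i. c ([], i))" if "\<psi> \<in> pfms N X B" for \<psi> B
    using that by (rule holds_agree) (simp add: x_def block_def)
  define B where "B n = A \<union> c ` ({w. w \<noteq> [] \<and> hd w < n} \<times> dom X)" for n
  have B_elems: "B n \<subseteq> elems N" for n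
    using A(1) cX Xs by (fastforce simp: B_def elems_def)
  have B_small: "small \<kappa> (B n)" for n
  proof -
    have "{w. w \<noteq> [] \<and> hd w < n} \<times> dom X \<subseteq> UNIV \<times> dom X" by blast
    then have "small \<kappa> ({w :: nat list. w \<noteq> [] \<and> hd w < n} \<times> dom X)"
      using small_Times[OF card_\<kappa>(1,2) small_nat_list[OF card_\<kappa>] X(2)] by (rule small_subset)
    then show ?thesis unfolding B_def by (intro small_Un card_\<kappa> A small_image)
  qed
  have B_mono: "B n \<subseteq> B (Suc n)" for n by (auto simp: B_def)
  \<comment> \<open>The chain has to start with \<open>p\<close> itself, whose base may be smaller
    than \<open>B 0\<close>.\<close>
  define P where "P n = (case n of 0 \<Rightarrow> p | Suc m \<Rightarrow>
    \<lparr>tvars = X, tbase = B n, tfms = {\<psi> \<in> pfms N X (B n). holds N \<psi> x}\<rparr>)" for n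
  have P0: "P 0 = p" by (simp add: P_def)
  have tbase: "tbase (P n) \<subseteq> B n" for n
    using p(3) by (cases n) (auto simp: P_def B_def)
  have tbase_mono: "tbase (P n) \<subseteq> tbase (P (Suc n))" for n
    using tbase[of n] B_mono[of n] by (simp add: P_def)
  have tfms: "\<psi> \<in> pfms N X (tbase (P n)) \<and> holds N \<psi> x" if "\<psi> \<in> tfms (P n)" for n \<psi>
  proof (cases n)
    case 0
    then have \<psi>: "\<psi> \<in> tfms p" using that by (simp add: P_def)
    then have "\<psi> \<in> pfms N X (tbase p)" using p by (auto simp: complete_type_def)
    moreover have "type_cond \<psi> c"
    proof (rule cond)
      show "type_cond \<psi> \<in> conditions" unfolding conditions_def using \<psi> by blast
    qed
    ultimately show ?thesis using holds_x 0 by (auto simp: P_def type_cond_def)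
  next
    case (Suc m)
    then show ?thesis using that by (simp add: P_def)
  qed
  have tvars: "tvars (P n) = X" for n using p(2) by (cases n) (simp_all add: P_def)
  have complete: "complete_type \<kappa> N (P n)" for n
  proof (cases n)
    case 0
    then show ?thesis using p(1) by (simp add: P_def)
  next
    case (Suc m)
    have "x \<in> solutions N X \<pi>" if "\<pi> \<subseteq> {\<psi> \<in> pfms N X (B n). holds N \<psi> x}" for \<pi>
      using that x(1) by (auto simp: solutions_def)
    then have "finitely_satisfiable N X {\<psi> \<in> pfms N X (B n). holds N \<psi> x}"
      unfolding finitely_satisfiable_def by blast
    moreover have "pneg \<psi> \<in> pfms N X (B n)" if "\<psi> \<in> pfms N X (B n)" for \<psi>
      using that by (cases \<psi>) (simp add: pneg_def pfms_iff)
    ultimately show ?thesis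
      using X B_elems B_small Suc by (auto simp: complete_type_def P_def holds_pneg)
  qed
  have forks: "omega_forks N X (tbase (P n)) (tfms (P (Suc n)))" for n
    unfolding omega_forks_def
  proof (intro allI impI)
    fix k :: nat assume k: "k \<ge> 1"
    \<comment> \<open>Beyond the base of \<open>P n\<close> this contains the factors
      \<open>[n]\<close> and \<open>[n, k]\<close>, which occur in the coset formula.\<close>
    define C where "C = A \<union> c ` (consts_at n k \<times> dom X)"
    have C1: "tbase (P n) \<subseteq> C" using tbase[of n] by (auto simp: B_def C_def consts_at_def)
    have C2: "C \<subseteq> B (Suc n)" by (auto simp: B_def C_def consts_at_def)
    let ?b = "\<lambda>l i. c ([n, k, l], i)"
    \<comment> \<open>Arguments in the order of \<open>coset_vars\<close>: block 0 is the variable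
      tuple, blocks 1 and k + 2 are constants, the k blocks between are terms of the
      sequence.\<close>
    let ?R = "\<lambda>y. coset_pred n k (\<lambda>q. case_sum y (\<lambda>a. a) ((\<lambda>(l, i). if l = 0 then Inl (Inl i) else if l = 1 then Inr (c ([n, k], i))
      else if l \<le> Suc k then Inl (Inr (l - 2, i)) else Inr (c ([n], i))) q))"
    have "\<exists>\<psi>\<in>pfms N X (B (Suc n)). holds N \<psi> (\<lambda>i. c ([], i)) \<and> skew_divides N X k (tbase (P n)) {\<psi>}"
    proof (rule skew_dividesI[OF _ k C1 C2, where b="?b" and Xb=X and R="?R"])
      show "sorts (lang N) \<noteq> {}" using N_nonempty(1) by simp
      show "sorted_asg N X (?b l)" for l using cX by (simp add: sorted_asg_def)
      show "?b l i \<in> B (Suc n)" if "X i = Some s" for l i s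
        unfolding B_def using that by (intro UnI2 image_eqI[of _ _ "([n, k, l], i)"]) auto
      show "sorted_asg N X (\<lambda>i. c ([], i))" using cX by (simp add: sorted_asg_def)
      show "definable N (case_sum X (\<lambda>(l, j). if l < k then X j else None)) C ?R"
      proof (rule definable_subst[OF coset_pred(1)])
        show "A \<subseteq> C" by (simp add: C_def)
        fix q :: "nat \<times> 'i" and s assume "blocks_tvar q = Some s"
        then obtain l i where q: "q = (l, i)" "X i = Some s" by (cases q) auto
        have "c (w, i) \<in> C \<inter> univ N s" if "w \<in> consts_at n k" for w
          using that q(2) cX by (auto simp: C_def)
        then show "case (\<lambda>(l, i). if l = 0 then Inl (Inl i) else if l = 1 then Inr (c ([n, k], i))
              else if l \<le> Suc k then Inl (Inr (l - 2, i)) else Inr (c ([n], i))) q of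
            Inl j \<Rightarrow> case_sum X (\<lambda>(l, j). if l < k then X j else None) j = Some s | Inr a \<Rightarrow> a \<in> C \<inter> univ N s"
          using q by (auto simp: consts_at_def)
      qed
      fix "is" assume "is": "sorted_wrt (<) is" "length is = k" "set is \<subseteq> {..<2 * k}"
      have "coset_cond (n, k, is) c"
      proof (rule cond)
        have "(n, k, is) \<in> coset_index" using k "is" by (simp add: coset_index_def)
        then show "coset_cond (n, k, is) \<in> conditions" unfolding conditions_def by blast
      qed
      moreover have "(\<lambda>q. case_sum (case_sum (\<lambda>i. c ([], i)) (\<lambda>(l, j). ?b (is ! l) j)) (\<lambda>a. a)
          ((\<lambda>(l, i). if l = 0 then Inl (Inl i) else if l = 1 then Inr (c ([n, k], i))
            else if l \<le> Suc k then Inl (Inr (l - 2, i)) else Inr (c ([n], i))) q)) =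
          (\<lambda>(l, i). c (coset_vars n k is l, i))"
        by (auto simp: coset_vars_def fun_eq_iff)
      ultimately show "?R (case_sum (\<lambda>i. c ([], i)) (\<lambda>(l, j). ?b (is ! l) j)) \<longleftrightarrow> is = evens k"
        by (simp only: coset_cond_def prod.case)
    next
      fix m :: nat and \<theta> and "is" js :: "nat list"
      assume \<theta>: "definable N (\<lambda>(l, j). if l < m then X j else None) C \<theta>"
        and l: "sorted_wrt (<) is" "sorted_wrt (<) js" "length is = m" "length js = m"
      obtain \<phi> \<sigma> where \<phi>: "(\<phi>, \<sigma>) \<in> pfms N (\<lambda>(l, j). if l < m then X j else None) C"
        "\<And>y. sorted_asg N (\<lambda>(l, j). if l < m then X j else None) y \<Longrightarrow> \<theta> y = holds N (\<phi>, \<sigma>) y"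
        using \<theta> by (auto simp: definable_def)
      \<comment> \<open>A parameter outside \<open>A\<close> is replaced by a coordinate of a
        constant block that has it as value, for \<open>ind_cond\<close> speaks of predicates over
        \<open>A\<close> only.\<close>
      define r where "r a = (SOME q. q \<in> consts_at n k \<times> dom X \<and> c q = a)" for a
      have r: "r a \<in> consts_at n k \<times> dom X \<and> c (r a) = a" if "a \<in> C" "a \<notin> A" for a
      proof -
        have "\<exists>q. q \<in> consts_at n k \<times> dom X \<and> c q = a" using that unfolding C_def by blast
        then show ?thesis unfolding r_def by (rule someI_ex)
      qed
      define \<sigma>' where "\<sigma>' v = (case \<sigma> v of Inl (l, j) \<Rightarrow> Inl (Inl l, j)
        | Inr a \<Rightarrow> if a \<in> A then Inr a else Inl (Inr (fst (r a)), snd (r a)))" for v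
      have "(\<phi>, \<sigma>') \<in> pfms N (param_tvar n k m) A"
        unfolding pfms_iff
      proof (intro conjI ballI allI impI)
        show "wf_fm (lang N) \<phi>" using \<phi>(1) by (simp add: pfms_iff)
        fix v assume v: "v \<in> fv \<phi>"
        show "param_tvar n k m i = Some (fst v)" if "\<sigma>' v = Inl i" for i
        proof (cases "\<sigma> v")
          case (Inl q)
          obtain l j where q: "q = (l, j)" by (cases q)
          then have "l < m" "X j = Some (fst v)"
            using \<phi>(1) v Inl by (auto simp: pfms_iff split: if_splits)
          then show ?thesis using that Inl q by (auto simp: \<sigma>'_def param_tvar_def)
        next
          case (Inr a)
          then have a: "a \<in> C" "a \<in> univ N (fst v)" "a \<notin> A"
            using \<phi>(1) v that by (auto simp: pfms_iff \<sigma>'_def split: if_splits)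
          obtain w j where wj: "r a = (w, j)" by (cases "r a")
          then obtain s where s: "w \<in> consts_at n k" "X j = Some s" "c (w, j) = a" using r[OF a(1,3)] by auto
          have "fst v \<in> sorts (eq_lang M)"
            using \<phi>(1) v fv_sorts[of "lang N" \<phi> v] by (simp add: pfms_iff)
          \<comment> \<open>An element lies in one sort only, so the coordinate has the sort of the
            variable.\<close>
          then have "s = fst v"
            using N_disjoint[OF Xs[OF s(2)] _ _ a(2)] cX[OF s(2), of w] s(3) by simp
          then show ?thesis using that Inr a(3) wj s by (auto simp: \<sigma>'_def param_tvar_def)
        qed
        show "a \<in> A" "a \<in> univ N (fst v)" if "\<sigma>' v = Inr a" for a
          using that \<phi>(1) v by (auto simp: \<sigma>'_def pfms_iff split: sum.splits if_splits)
      qed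
      then have \<theta>': "definable N (param_tvar n k m) A (holds N (\<phi>, \<sigma>'))" by (rule definable_holds)
      have eq: "holds N (\<phi>, \<sigma>') (param_asg n k is c) = \<theta> (\<lambda>(l, j). ?b (is ! l) j)" for "is"
      proof -
        have "sorted_asg N (\<lambda>(l, j). if l < m then X j else None) (\<lambda>(l, j). ?b (is ! l) j)"
          using cX by (auto simp: sorted_asg_def split: if_splits)
        then have "\<theta> (\<lambda>(l, j). ?b (is ! l) j) = holds N (\<phi>, \<sigma>) (\<lambda>(l, j). ?b (is ! l) j)" by (rule \<phi>(2))
        also have "\<dots> = holds N (\<phi>, \<sigma>') (param_asg n k is c)"
          unfolding holds_def fst_conv snd_conv
        proof (rule sat_cong)
          fix v assume v: "v \<in> fv \<phi>"
          show "(case \<sigma> v of Inl i \<Rightarrow> (\<lambda>(l, j). ?b (is ! l) j) i | Inr a \<Rightarrow> a) =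
              (case \<sigma>' v of Inl i \<Rightarrow> param_asg n k is c i | Inr a \<Rightarrow> a)"
          proof (cases "\<sigma> v")
            case (Inl q)
            then show ?thesis by (cases q) (simp add: \<sigma>'_def param_asg_def)
          next
            case (Inr a)
            then have "a \<in> C" using \<phi>(1) v by (auto simp: pfms_iff)
            then show ?thesis using Inr r[of a] by (simp add: \<sigma>'_def param_asg_def)
          qed
        qed
        finally show ?thesis by simp
      qed
      have "ind_cond (n, k, m, holds N (\<phi>, \<sigma>'), is, js) c"
      proof (rule cond)
        have "(n, k, m, holds N (\<phi>, \<sigma>'), is, js) \<in> ind_index" using \<theta>' l by (simp add: ind_index_def)
        then show "ind_cond (n, k, m, holds N (\<phi>, \<sigma>'), is, js) \<in> conditions"
          unfolding conditions_def by blast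
      qed
      then show "\<theta> (\<lambda>(l, j). ?b (is ! l) j) = \<theta> (\<lambda>(l, j). ?b (js ! l) j)"
        by (simp only: ind_cond_def prod.case eq)
    qed
    then obtain \<psi> where \<psi>: "\<psi> \<in> pfms N X (B (Suc n))" "holds N \<psi> (\<lambda>i. c ([], i))"
      "skew_divides N X k (tbase (P n)) {\<psi>}" by blast
    have "\<psi> \<in> pfms N X (elems N)" using pfms_mono[OF map_le_refl B_elems] \<psi>(1) by blast
    moreover have "\<psi> \<in> tfms (P (Suc n))" using \<psi> holds_x[OF \<psi>(1)] by (simp add: P_def)
    ultimately show "k_forks N X k (tbase (P n)) (tfms (P (Suc n)))"
      unfolding k_forks_def using \<psi>(3) by (intro exI[of _ "{\<psi>}"]) (auto simp: solutions_def)
  qed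
  have "tfms (P n) \<subseteq> tfms (P (Suc n))" for n
  proof
    fix \<psi> assume "\<psi> \<in> tfms (P n)"
    then have "\<psi> \<in> pfms N X (tbase (P n))" "holds N \<psi> x" using tfms by blast+
    moreover have "pfms N X (tbase (P n)) \<subseteq> pfms N X (tbase (P (Suc n)))"
      by (rule pfms_mono[OF map_le_refl tbase_mono])
    ultimately show "\<psi> \<in> tfms (P (Suc n))" by (auto simp: P_def)
  qed
  then have "omega_forking_extension \<kappa> N (P (Suc n)) (P n)" for n
    unfolding omega_forking_extension_def tvars using complete tbase_mono forks by blast
  with P0 show ?thesis by blast
qed

end

section \<open>The rank along an infinite chain of extensions\<close>

lemma ord_infty_exists_least:
  fixes S :: "'a ord_infty set"
  assumes "S \<noteq> {}"
  shows "\<exists>m\<in>S. \<forall>x\<in>S. m \<le> x"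
proof (cases "\<exists>\<alpha>. Ord \<alpha> \<in> S")
  case True
  then have m: "Ord (LEAST \<alpha>. Ord \<alpha> \<in> S) \<in> S" by (rule LeastI_ex)
  have "Ord (LEAST \<alpha>. Ord \<alpha> \<in> S) \<le> x" if "x \<in> S" for x
  proof (cases x)
    case (Ord \<beta>)
    then show ?thesis using that by (auto simp: less_eq_ord_infty_def intro: Least_le)
  qed (simp add: less_eq_ord_infty_def)
  with m show ?thesis by blast
next
  case False
  then have "x = Infty" if "x \<in> S" for x using that by (cases x) auto
  with assms show ?thesis by blast
qed

text \<open>\<open>LEAST\<close> is informative only if a least solution exists. The constant
  \<open>Infty\<close> is a solution, so the pointwise minimum L can be formed; it is again a
  solution, because at each p it equals some solution F(p) while L \<le> F elsewhere.\<close>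

lemma U_omega_forking_extension:
  assumes ext: "omega_forking_extension \<kappa> M q p" and le: "Ord \<alpha> \<le> U_omega \<kappa> M q"
  shows "Ord \<alpha> < U_omega \<kappa> M p"
proof -
  define C where "C F \<longleftrightarrow> (\<forall>\<alpha> p q. omega_forking_extension \<kappa> M q p \<and> Ord \<alpha> \<le> F q \<longrightarrow> Ord \<alpha> < F p)"
    for F :: "('b, 'c, 'd, 'e, 'f) ctype \<Rightarrow> ('b, 'c, 'd, 'e, 'f) ctype ord_infty"
  have C_Infty: "C (\<lambda>_. Infty)" by (simp add: C_def less_ord_infty_def less_eq_ord_infty_def)
  have "\<forall>p. \<exists>m. (\<exists>F. m = F p \<and> C F) \<and> (\<forall>F. C F \<longrightarrow> m \<le> F p)"
  proof
    fix p
    have in_S: "F p \<in> {F p | F. C F}" if "C F" for F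
      by (rule CollectI) (intro exI[of _ F] conjI refl that)
    obtain m where m: "m \<in> {F p | F. C F}" "\<forall>x\<in>{F p | F. C F}. m \<le> x"
      using in_S[OF C_Infty] by (elim bexE[OF ord_infty_exists_least[of "{F p | F. C F}"], rotated]) blast
    show "\<exists>m. (\<exists>F. m = F p \<and> C F) \<and> (\<forall>F. C F \<longrightarrow> m \<le> F p)"
      using m(1) bspec[OF m(2) in_S] unfolding mem_Collect_eq by (intro exI[of _ m] conjI allI impI)
  qed
  from choice[OF this] obtain L where L: "\<forall>p. (\<exists>F. L p = F p \<and> C F) \<and> (\<forall>F. C F \<longrightarrow> L p \<le> F p)"
    by (elim exE)
  have L_le: "L p \<le> F p" if "C F" for p F
    using L[THEN spec, THEN conjunct2, THEN spec, THEN mp, OF that] .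
  have CL: "C L"
    unfolding C_def
  proof (intro allI impI)
    fix \<alpha> p q assume q: "omega_forking_extension \<kappa> M q p \<and> Ord \<alpha> \<le> L q"
    obtain F where F: "L p = F p" "C F" using L[THEN spec, of p, THEN conjunct1] by (elim exE conjE)
    have "Ord \<alpha> \<le> F q" using q L_le[OF F(2), of q] by (auto intro: order_trans)
    then have "Ord \<alpha> < F p" using F(2)[unfolded C_def, THEN spec, THEN spec, THEN spec, THEN mp] q by blast
    then show "Ord \<alpha> < L p" by (simp only: F(1))
  qed
  have "U_omega \<kappa> M = L"
    unfolding U_omega_def C_def[symmetric] by (rule Least_equality[of C L, OF CL]) (simp add: le_fun_def L_le)
  then show ?thesis
    using CL[unfolded C_def, THEN spec, THEN spec, THEN spec, THEN mp, of q p \<alpha>] ext le by simp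
qed

text \<open>An ordinal rank would drop strictly at the first extension; induction on the rank,
  applied to the tail of the chain.\<close>

lemma U_omega_chain:
  assumes "\<And>n. omega_forking_extension \<kappa> M (P (Suc n)) (P n)"
  shows "U_omega \<kappa> M (P 0) = Infty"
proof -
  have "(\<forall>n. omega_forking_extension \<kappa> M (P (Suc n)) (P n)) \<longrightarrow> U_omega \<kappa> M (P 0) \<noteq> Ord \<alpha>" for \<alpha> P
  proof (induction \<alpha> arbitrary: P rule: less_induct)
    case (less \<alpha>)
    show ?case
    proof (intro impI notI)
      assume ext: "\<forall>n. omega_forking_extension \<kappa> M (P (Suc n)) (P n)" and \<alpha>: "U_omega \<kappa> M (P 0) = Ord \<alpha>"
      have "\<not> Ord \<alpha> \<le> U_omega \<kappa> M (P (Suc 0))"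
        using U_omega_forking_extension[of \<kappa> M "P (Suc 0)" "P 0" \<alpha>] ext \<alpha> by auto
      then obtain \<beta> where \<beta>: "U_omega \<kappa> M (P (Suc 0)) = Ord \<beta>" "\<beta> < \<alpha>"
        by (cases "U_omega \<kappa> M (P (Suc 0))") (auto simp: less_eq_ord_infty_def)
      have "\<forall>n. omega_forking_extension \<kappa> M (P (Suc (Suc n))) (P (Suc n))" using ext by blast
      then show False using less[OF \<beta>(2), of "\<lambda>n. P (Suc n)"] \<beta>(1) by blast
    qed
  qed
  with assms show ?thesis by (cases "U_omega \<kappa> M (P 0)") blast+
qed

section \<open>Collecting the parameters of the subgroups\<close>

lemma type_definable_over_mono:
  "type_definable_over M Y A S \<Longrightarrow> A \<subseteq> B \<Longrightarrow> type_definable_over M Y B S"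
  using pfms_mono[OF map_le_refl, of A B M Y] unfolding type_definable_over_def by blast

lemma type_definable_group_over_mono:
  "type_definable_group_over M X A G \<Longrightarrow> A \<subseteq> B \<Longrightarrow> type_definable_group_over M X B G"
  unfolding type_definable_group_over_def by (blast intro: type_definable_over_mono)

theorem corollary4p4:
  fixes \<kappa> :: "'k rel"
    and T :: "('s, 'f, 'r) fm set"
    and M :: "('s, 'f, 'r, 'a) struc"
    and X :: "('i, ('s, 'f, 'r) eqsort) tvar"
    and G :: "('i \<Rightarrow> ('s, 'f, 'r, 'a) eqelem) monoid"
  assumes "complete_theory (lang M) T"
    and "monster_model \<kappa> T M"
    and "stable_monster M"
    and "type_definable_group \<kappa> (eq_struc M) X G"
    and "has_U_omega \<kappa> (eq_struc M) X G u"
    and "u < Infty"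
  shows "\<not> (\<exists>H :: nat \<Rightarrow> ('i \<Rightarrow> ('s, 'f, 'r, 'a) eqelem) set.
    \<forall>n. rel_definable_subgroup (eq_struc M) X G (H n)
      \<and> H (Suc n) \<subseteq> H n \<and> infinite_index G (H n) (H (Suc n)))"
proof
  let ?N = "eq_struc M"
  assume "\<exists>H :: nat \<Rightarrow> ('i \<Rightarrow> ('s, 'f, 'r, 'a) eqelem) set.
    \<forall>n. rel_definable_subgroup ?N X G (H n) \<and> H (Suc n) \<subseteq> H n \<and> infinite_index G (H n) (H (Suc n))"
  then obtain H :: "nat \<Rightarrow> ('i \<Rightarrow> ('s, 'f, 'r, 'a) eqelem) set" where
    H: "\<And>n. rel_definable_subgroup ?N X G (H n)" "\<And>n. H (Suc n) \<subseteq> H n"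
      "\<And>n. infinite_index G (H n) (H (Suc n))"
    by blast
  have "\<forall>n. \<exists>\<psi>. \<psi> \<in> pfms ?N X (elems ?N) \<and> H n = {c \<in> carrier G. holds ?N \<psi> c}"
    using H(1) unfolding rel_definable_subgroup_def by blast
  from choice[OF this] obtain \<chi> where \<chi>: "\<And>n. \<chi> n \<in> pfms ?N X (elems ?N)"
    "\<And>n. H n = {c \<in> carrier G. holds ?N (\<chi> n) c}" by blast
  obtain p where p: "generic_type \<kappa> ?N X G p" "U_omega \<kappa> ?N p = u"
    using assms(5) unfolding has_U_omega_def by blast
  note \<kappa> = monster_model_card[OF assms(2)]
  \<comment> \<open>The formulas \<chi> n are given over all elements; the parameters that occur in
    them are collected, so that the whole chain lives over a small set.\<close>
  define D where "D n = {a. \<exists>v\<in>fv (fst (\<chi> n)). snd (\<chi> n) v = Inr a}" for n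
  have fin: "finite (D n)" for n
  proof (rule finite_subset)
    show "D n \<subseteq> (\<lambda>v. projr (snd (\<chi> n) v)) ` fv (fst (\<chi> n))" by (force simp: D_def)
  qed (simp add: finite_fv)
  \<comment> \<open>Enumerations present the union of the finite sets \<open>D n\<close> as an image
    of pairs of natural numbers.\<close>
  define xs where "xs n = (SOME xs. set xs = D n)" for n
  have xs: "set (xs n) = D n" for n
    unfolding xs_def by (rule someI_ex[OF finite_list[OF fin]])
  have "(\<Union>n. D n) \<subseteq> (\<lambda>(n, j). xs n ! j) ` (UNIV \<times> UNIV)"
    unfolding xs[symmetric] by (force simp: in_set_conv_nth)
  then have D_small: "small \<kappa> (\<Union>n. D n)"
    using small_image[OF small_Times[OF \<kappa>(1,2) \<kappa>(3) \<kappa>(3)]] by (rule small_subset)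
  have \<chi>D: "\<chi> n \<in> pfms ?N X (D n)" for n
    using \<chi>(1)[of n] by (cases "\<chi> n") (auto simp: pfms_iff D_def)
  have D_elems: "D n \<subseteq> elems ?N" for n
    using \<chi>(1)[of n] by (cases "\<chi> n") (auto simp: pfms_iff D_def)
  define A where "A = tbase p \<union> (\<Union>n. D n)"
  have "subgroup_chain \<kappa> T M X A G p H \<chi>"
    unfolding subgroup_chain_def tdef_group_def
  proof (intro conjI)
    show "eq_monster \<kappa> T M" by unfold_locales (rule assms(2))
    have p': "complete_type \<kappa> ?N p" "tvars p = X" "type_definable_group_over ?N X (tbase p) G"
      using p(1) by (simp_all add: generic_type_def)
    show "tdef_group_axioms \<kappa> M X A G"
    proof (rule tdef_group_axioms.intro)
      show "wf_tvar ?N X" "small \<kappa> (dom X)" using assms(4) by (simp_all add: type_definable_group_def)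
      show "A \<subseteq> elems ?N" using p'(1) D_elems by (auto simp: A_def complete_type_def)
      show "small \<kappa> A" unfolding A_def
        using p'(1) by (intro small_Un \<kappa> D_small) (simp add: complete_type_def)
      show "type_definable_group_over ?N X A G"
        using p'(3) by (rule type_definable_group_over_mono) (simp add: A_def)
    qed
    show "subgroup_chain_axioms \<kappa> M X A G p H \<chi>"
    proof (rule subgroup_chain_axioms.intro)
      show "complete_type \<kappa> ?N p" "tvars p = X" by (fact p')+
      show "tbase p \<subseteq> A" by (simp add: A_def)
      show "\<exists>F\<subseteq>carrier G. finite F \<and> carrier G = (\<Union>g\<in>F. g <#\<^bsub>G\<^esub> {c \<in> carrier G. holds ?N \<psi> c})"
        if "\<psi> \<in> tfms p" for \<psi>
        using p(1) that unfolding generic_type_def by (elim conjE) (rule bspec)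
      show "subgroup (H n) G" for n using H(1) by (simp add: rel_definable_subgroup_def)
      show "H n = {c \<in> carrier G. holds ?N (\<chi> n) c}" for n by (rule \<chi>(2))
      show "H (Suc n) \<subseteq> H n" "infinite_index G (H n) (H (Suc n))" for n by (fact H)+
      show "\<chi> n \<in> pfms ?N X A" for n
        using \<chi>D[of n] pfms_mono[OF map_le_refl, of "D n" A ?N X] by (auto simp: A_def)
    qed
  qed
  then obtain P where P: "P 0 = p" "\<And>n. omega_forking_extension \<kappa> ?N (P (Suc n)) (P n)"
    using subgroup_chain.forking_chain by blast
  have "U_omega \<kappa> ?N (P 0) = Infty" by (rule U_omega_chain) (rule P(2))
  with P(1) p(2) assms(6) show False by simp
qed

end
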